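(* Let $d\ge2$, $\alpha\in(1,2)$, and let $\mu$ be a nondegenerate $\alpha$-stable distribution on $\mathbb{R}^d$ with no shift and characteristic exponent $|z|^\alpha V(u_z)$. Let $\varrho_0=\sup_{u\in\mathbb{S}^{d-1}}|V(u)|^2/(2\Re V(u))$, fix $R>\varrho_0$, let $V_*=R-V$ and $S^*_{j,k}=(-i)^j\pi_j(V_*^k)$ for $j,k\in\mathbb{Z}_+$. Then the density of $\mu$ is $$g(x)=\frac{2^{1-d}}{\pi^{d/2}\alpha}\sum_{n=0}^\infty\Big(\frac{|x|}{2}\Big)^n\sum_{m=0}^{\lfloor n/2\rfloor}\frac{(-1)^m}{m!\,\Gamma(n-m+d/2)}\sum_{k=0}^\infty\frac{\Gamma(k+(n+d)/\alpha)}{k!\,R^{k+(n+d)/\alpha}}S^*_{n-2m,k}(u_x),\qquad x\in\mathbb{R}^d,$$ the series converging absolutely and uniformly on $\{x:|x|\le M\}$ for every $M>0$. If $X\sim\mu$, then $|X|$ has density $$g_{|X|}(r)=\frac{(r/2)^{d-1}}{\pi^{d/2}\alpha}\sum_{n=0}^\infty\frac{(-r^2/4)^n}{n!\,\Gamma(n+d/2)}\sum_{k=0}^\infty\frac{\Gamma(k+(2n+d)/\alpha)}{k!\,R^{k+(2n+d)/\alpha}}\int_{\mathbb{S}^{d-1}}V_*^k\,d\omega.$$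
   Context: Let $d\ge 2$, $\mathbb{S}^{d-1}$ the unit sphere, $\omega$ its surface measure, $u_x=x/|x|$ for $x\ne0$. $\pi_j$ is the orthogonal projection of $L^2(\mathbb{S}^{d-1},\omega)$ onto spherical harmonics of degree $j$ (restrictions of homogeneous harmonic polynomials of degree $j$). An $\alpha$-stable distribution ($\alpha\ne1$) with no shift has $\hat\mu(z)=\exp\{-|z|^\alpha V(u_z)\}$, $V(u)=\int_{\mathbb{S}^{d-1}}|\langle u,v\rangle|^\alpha[1-i\tan(\pi\alpha/2)\mathrm{sgn}\langle u,v\rangle]\lambda(dv)$, $\lambda$ a finite nonzero Borel measure on the sphere. Nondegenerate: support not contained in a proper affine subspace; then $\inf\Re V>0$ and $\varrho_0<\infty$. *)

theory Defs
  imports "HOL-Probability.Probability"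
begin

definition sphere_measure :: "(real^'n::finite) measure" where
  "sphere_measure = measure_of (sphere 0 1) (sets (restrict_space borel (sphere 0 1)))
     (\<lambda>A. of_nat CARD('n) * emeasure lborel {t *\<^sub>R v | t v. 0 < t \<and> t \<le> 1 \<and> v \<in> A})"

definition monom :: "('n::finite \<Rightarrow> nat) \<Rightarrow> real^'n \<Rightarrow> complex" where
  "monom \<beta> x = (\<Prod>i\<in>UNIV. complex_of_real ((x $ i) ^ (\<beta> i)))"

definition hom_poly :: "nat \<Rightarrow> (('n::finite \<Rightarrow> nat) \<Rightarrow> complex) \<Rightarrow> real^'n \<Rightarrow> complex" where
  "hom_poly j c x = (\<Sum>\<beta>\<in>{\<beta>. sum \<beta> UNIV = j}. c \<beta> * monom \<beta> x)"

definition partial2 :: "(real^'n::finite \<Rightarrow> complex) \<Rightarrow> 'n \<Rightarrow> real^'n \<Rightarrow> complex" where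
  "partial2 f i x = vector_derivative
      (\<lambda>t. vector_derivative (\<lambda>s. f (x + s *\<^sub>R axis i 1)) (at t)) (at 0)"

definition laplacian :: "(real^'n::finite \<Rightarrow> complex) \<Rightarrow> real^'n \<Rightarrow> complex" where
  "laplacian f x = (\<Sum>i\<in>UNIV. partial2 f i x)"

text \<open>Homogeneous harmonic polynomials of degree j (as functions on R^d);
  their restrictions to the sphere are the spherical harmonics of degree j.\<close>
definition harm :: "nat \<Rightarrow> (real^'n::finite \<Rightarrow> complex) set" where
  "harm j = {h. (\<exists>c. h = hom_poly j c) \<and> (\<forall>x. laplacian h x = 0)}"

text \<open>Orthogonal projection in L^2(sphere, omega) onto the spherical harmonics of degree j;
  the result is represented by the (unique) homogeneous harmonic polynomial whose
  restriction to the sphere is the projection.\<close>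
definition sh_proj :: "nat \<Rightarrow> (real^'n::finite \<Rightarrow> complex) \<Rightarrow> real^'n \<Rightarrow> complex" where
  "sh_proj j f = (THE h. h \<in> harm j \<and>
      (\<forall>q\<in>harm j. integral\<^sup>L sphere_measure (\<lambda>u. (f u - h u) * cnj (q u)) = 0))"

definition stable_V :: "real \<Rightarrow> (real^'n::finite) measure \<Rightarrow> real^'n \<Rightarrow> complex" where
  "stable_V \<alpha> lam u = integral\<^sup>L lam (\<lambda>v. complex_of_real (\<bar>u \<bullet> v\<bar> powr \<alpha>) *
      (1 - \<i> * complex_of_real (tan (pi * \<alpha> / 2)) * complex_of_real (sgn (u \<bullet> v))))"

definition rho0 :: "real \<Rightarrow> (real^'n::finite) measure \<Rightarrow> real" where
  "rho0 \<alpha> lam = (SUP u\<in>sphere 0 1. (cmod (stable_V \<alpha> lam u))\<^sup>2 / (2 * Re (stable_V \<alpha> lam u)))"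

definition measure_support :: "'a::metric_space measure \<Rightarrow> 'a set" where
  "measure_support M = {x. \<forall>e>0. emeasure M (ball x e) > 0}"

definition nondegenerate :: "(real^'n::finite) measure \<Rightarrow> bool" where
  "nondegenerate M \<longleftrightarrow> (\<forall>S. affine S \<and> S \<noteq> UNIV \<longrightarrow> \<not> measure_support M \<subseteq> S)"

definition Vstar :: "real \<Rightarrow> (real^'n::finite) measure \<Rightarrow> real \<Rightarrow> real^'n \<Rightarrow> complex" where
  "Vstar \<alpha> lam R u = complex_of_real R - stable_V \<alpha> lam u"

definition Sstar :: "real \<Rightarrow> (real^'n::finite) measure \<Rightarrow> real \<Rightarrow> nat \<Rightarrow> nat \<Rightarrow> real^'n \<Rightarrow> complex" where
  "Sstar \<alpha> lam R j k = (\<lambda>u. (- \<i>) ^ j * sh_proj j (\<lambda>v. (Vstar \<alpha> lam R v) ^ k) u)"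

definition dens_term :: "real \<Rightarrow> (real^'n::finite) measure \<Rightarrow> real \<Rightarrow> real^'n \<Rightarrow> nat \<Rightarrow> nat \<Rightarrow> nat \<Rightarrow> complex" where
  "dens_term \<alpha> lam R x n m k = (let d = real CARD('n) in
     complex_of_real (2 powr (1 - d) / (pi powr (d / 2) * \<alpha>) * (norm x / 2) ^ n
        * (-1) ^ m / (fact m * Gamma (real n - real m + d / 2))
        * Gamma (real k + (real n + d) / \<alpha>) / (fact k * R powr (real k + (real n + d) / \<alpha>)))
     * Sstar \<alpha> lam R (n - 2 * m) k (sgn x))"

definition stable_g :: "real \<Rightarrow> (real^'n::finite) measure \<Rightarrow> real \<Rightarrow> real^'n \<Rightarrow> complex" where
  "stable_g \<alpha> lam R x = (\<Sum>n. \<Sum>m\<le>n div 2. \<Sum>k. dens_term \<alpha> lam R x n m k)"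

definition radial_term :: "real \<Rightarrow> (real^'n::finite) measure \<Rightarrow> real \<Rightarrow> real \<Rightarrow> nat \<Rightarrow> nat \<Rightarrow> complex" where
  "radial_term \<alpha> lam R r n k = (let d = real CARD('n) in
     complex_of_real ((r / 2) ^ (CARD('n) - 1) / (pi powr (d / 2) * \<alpha>)
        * (- (r\<^sup>2 / 4)) ^ n / (fact n * Gamma (real n + d / 2))
        * Gamma (real k + (2 * real n + d) / \<alpha>) / (fact k * R powr (real k + (2 * real n + d) / \<alpha>)))
     * integral\<^sup>L (sphere_measure :: (real^'n) measure) (\<lambda>v. (Vstar \<alpha> lam R v) ^ k))"

definition radial_g :: "real \<Rightarrow> (real^'n::finite) measure \<Rightarrow> real \<Rightarrow> real \<Rightarrow> complex" where
  "radial_g \<alpha> lam R r = (\<Sum>n. \<Sum>k. radial_term \<alpha> lam R r n k)"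

end

theory Submission
  imports Defs
begin

text \<open>
  By Fourier inversion the density at \<open>x\<close> is \<open>(2 pi)^-d\<close> times the integral over \<open>z = r u\<close> (in polar
  coordinates) of \<open>exp (- i r (x \<bullet> u)) exp (- r^\<alpha> V u)\<close>. The condition \<open>R > rho0\<close> says that
  \<open>Vstar = R - V\<close> has modulus at most some \<open>q < R\<close> on the sphere. Expanding \<open>exp (- i r (x \<bullet> u))\<close> and
  \<open>exp (- r^\<alpha> V) = exp (- R r^\<alpha>) exp (r^\<alpha> Vstar)\<close> into power series, dominated by
  \<open>exp (r |x|) exp (- (R - q) r^\<alpha>)\<close> with \<open>\<alpha> > 1\<close>, turns the radial integrals into Gamma values and leaves the
  spherical moments \<open>F_n x = \<integral> (x \<bullet> u)^n Vstar(u)^k d\<omega>(u)\<close>.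

  These are homogeneous polynomials in \<open>x\<close> with \<open>\<Delta> F_n = n (n - 1) F_(n-2)\<close>. The Funk--Hecke
  constants for the powers \<open>t^n\<close> obey a matching two-step recursion, so subtracting from \<open>F_n\<close> its
  components of lower degree leaves a harmonic polynomial, which Fubini and the Funk--Hecke formula
  identify as a multiple of the projection of \<open>Vstar^k\<close> onto degree \<open>n\<close>.
  The Funk--Hecke formula itself follows by induction from \<open>\<integral> \<Delta> q d\<omega> = l (l + d - 2) \<integral> q d\<omega>\<close> for
  homogeneous \<open>q\<close> of degree \<open>l\<close>, which is Gaussian integration by parts. The density of the norm is obtained by
  integrating the series over spheres, where only the constant harmonic survives.
\<close>

section \<open>Polar coordinates\<close>

text \<open>Two objects have to be built before they can be used. \<open>sh_proj\<close> is a
  definite description, so the existence of the projection is part of the work: it is obtained as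
  the harmonic remainder of \<open>F_n\<close> divided by the positive diagonal constant
  \<open>fh_coeff d n n\<close>. Since that remainder involves the projections of lower degree,
  existence, orthogonality and the decomposition of \<open>F_n\<close> form a single induction.
  Likewise no density of \<mu> is given beforehand; smoothing with a Gaussian produces one and shows
  along the way that it is real and nonnegative.

  The Gaussian serves twice. It is both a product and radial, so integrals of polynomials over the
  sphere reduce to moments of the one-dimensional normal law.

  Convergence rests on crude bounds. Projecting onto degree \<open>j\<close> may cost a factor
  \<open>d ^ j\<close> in the supremum norm, and the sum over \<open>m\<close> a factor
  \<open>2 ^ n\<close>. Such losses are harmless because \<open>exp (K * r)\<close> is beaten by
  \<open>exp (- (R - q) * r powr \<alpha>)\<close> for every \<open>K\<close>, so the majorant
  series converges with any \<open>K ^ n\<close> inserted.\<close>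

text \<open>The value at 0 is an arbitrary unit vector, so that \<open>dir\<close> maps into the sphere everywhere.\<close>

definition dir :: "real^'n::finite \<Rightarrow> real^'n" where
  "dir x = (if x = 0 then axis undefined 1 else sgn x)"

lemma norm_dir [simp]: "norm (dir x) = 1"
  by (simp add: dir_def norm_sgn)

lemma norm_scaleR_dir [simp]: "norm x *\<^sub>R dir x = x"
  by (simp add: dir_def sgn_div_norm)

lemma dir_scaleR: "c > 0 \<Longrightarrow> dir (c *\<^sub>R x) = dir x"
  by (simp add: dir_def sgn_scaleR)

lemma dir_sphere: "norm u = 1 \<Longrightarrow> dir u = u"
  by (auto simp: dir_def sgn_div_norm)

lemma sgn_borel_measurable [measurable]: "sgn \<in> borel_measurable (borel :: (real^'n) measure)"
  unfolding sgn_div_norm[abs_def] by measurable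

lemma dir_borel_measurable [measurable]: "dir \<in> borel_measurable borel"
  unfolding dir_def[abs_def] by measurable

lemma dir_measurable [measurable]: "dir \<in> measurable borel (restrict_space borel (sphere 0 1))"
  by (rule measurable_restrict_space2) auto

lemma cball_borel [measurable]: "cball (a :: 'a :: metric_space) b \<in> sets borel"
  by (simp add: borel_closed)

text \<open>A measure built with \<open>measure_of\<close> takes the prescribed values only if the
  set function is countably additive. The volume of cones is the pushforward of Lebesgue measure on
  the ball under \<open>dir\<close>, which settles additivity and makes change of variables
  available.\<close>

lemma sphere_measure_eq_distr:
  "(sphere_measure :: (real^'n) measure) =
     distr (density lborel (\<lambda>x. of_nat CARD('n) * indicator (cball 0 1) x))
       (restrict_space borel (sphere 0 1)) dir" (is "_ = ?D")
proof -
  have *: "of_nat CARD('n) * emeasure lborel {t *\<^sub>R v | t v. 0 < t \<and> t \<le> 1 \<and> v \<in> A} = emeasure ?D A"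
    if A: "A \<in> sets (restrict_space borel (sphere 0 1))" for A :: "(real^'n) set"
  proof -
    have sub: "A \<subseteq> sphere 0 1"
      using sets.sets_into_space[OF A] by (simp add: space_restrict_space)
    have [measurable, simp]: "dir -` A \<in> sets borel"
      using measurable_sets[OF dir_measurable A] by simp
    \<comment> \<open>The cone omits the origin, where the value of \<open>dir\<close> is arbitrary;
      this point is null.\<close>
    have eq: "{t *\<^sub>R v | t v. 0 < t \<and> t \<le> 1 \<and> v \<in> A} = (cball 0 1 \<inter> dir -` A) - {0}"
    proof (intro set_eqI iffI)
      fix x assume "x \<in> {t *\<^sub>R v | t v. 0 < t \<and> t \<le> 1 \<and> v \<in> A}"
      then obtain t v where "x = t *\<^sub>R v" "0 < t" "t \<le> 1" "v \<in> A" by auto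
      then show "x \<in> (cball 0 1 \<inter> dir -` A) - {0}" using sub dir_sphere[of v]
        by (auto simp: dir_scaleR)
    next
      fix x assume "x \<in> (cball 0 1 \<inter> dir -` A) - {0}"
      then show "x \<in> {t *\<^sub>R v | t v. 0 < t \<and> t \<le> 1 \<and> v \<in> A}"
        by (auto intro!: exI[of _ "norm x"] exI[of _ "dir x"])
    qed
    have "emeasure lborel {t *\<^sub>R v | t v. 0 < t \<and> t \<le> 1 \<and> v \<in> A} = emeasure lborel (cball 0 1 \<inter> dir -` A)"
      unfolding eq by (rule emeasure_Diff_null_set) auto
    moreover have "emeasure ?D A = (\<integral>\<^sup>+x. of_nat CARD('n) * indicator (cball 0 1) x * indicator (dir -` A) x \<partial>lborel)"
      using A by (subst emeasure_distr, simp_all, subst emeasure_density, (simp; measurable)+)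
    moreover have "\<dots> = (\<integral>\<^sup>+x. of_nat CARD('n) * indicator (cball 0 1 \<inter> dir -` A) x \<partial>lborel)"
      by (intro nn_integral_cong) (auto split: split_indicator)
    ultimately show ?thesis
      by (simp add: nn_integral_cmult)
  qed
  have "sphere_measure = measure_of (sphere 0 1) (sets (restrict_space borel (sphere 0 1))) (emeasure ?D)"
    unfolding sphere_measure_def
  proof (rule measure_of_eq)
    show "sets (restrict_space borel (sphere (0::real^'n) 1)) \<subseteq> Pow (sphere 0 1)"
      using sets.space_closed[of "restrict_space borel (sphere (0::real^'n) 1)"] by (simp add: space_restrict_space)
    fix a :: "(real^'n) set" assume "a \<in> sigma_sets (sphere 0 1) (sets (restrict_space borel (sphere 0 1)))"
    then have "a \<in> sets (restrict_space borel (sphere 0 1))"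
      using sets.sigma_sets_eq[of "restrict_space borel (sphere (0::real^'n) 1)"] by (simp add: space_restrict_space)
    then show "of_nat CARD('n) * emeasure lborel {t *\<^sub>R v |t v. 0 < t \<and> t \<le> 1 \<and> v \<in> a} = emeasure ?D a"
      by (rule *)
  qed
  also have "\<dots> = ?D"
    using measure_of_of_measure[of ?D] by (simp add: space_restrict_space)
  finally show ?thesis .
qed

lemma sets_sphere_measure [measurable_cong, simp]:
  "sets (sphere_measure :: (real^'n) measure) = sets (restrict_space borel (sphere 0 1))"
  by (simp add: sphere_measure_eq_distr)

lemma space_sphere_measure [simp]: "space (sphere_measure :: (real^'n) measure) = sphere 0 1"
  by (simp add: sphere_measure_eq_distr space_restrict_space)

lemma vimage_dir_borel: "A \<in> sets (restrict_space borel (sphere 0 1)) \<Longrightarrow> dir -` A \<in> sets borel"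
  using measurable_sets[OF dir_measurable] by auto

lemma emeasure_sphere_measure:
  assumes A: "A \<in> sets (restrict_space borel (sphere (0::real^'n) 1))"
  shows "emeasure sphere_measure A = of_nat CARD('n) * emeasure lborel (cball 0 1 \<inter> dir -` A)"
proof -
  note [measurable, simp] = vimage_dir_borel[OF A]
  have "emeasure sphere_measure A = (\<integral>\<^sup>+x. of_nat CARD('n) * indicator (cball 0 1) x * indicator (dir -` A) x \<partial>lborel)"
    unfolding sphere_measure_eq_distr using A by (subst emeasure_distr, simp_all, subst emeasure_density, (simp; measurable)+)
  also have "\<dots> = (\<integral>\<^sup>+x. of_nat CARD('n) * indicator (cball 0 1 \<inter> dir -` A) x \<partial>lborel)"
    by (intro nn_integral_cong) (auto split: split_indicator)
  finally show ?thesis by (simp add: nn_integral_cmult)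
qed

lemma finite_sphere_measure: "finite_measure (sphere_measure :: (real^'n) measure)"
proof
  have "emeasure (sphere_measure :: (real^'n) measure) (sphere 0 1)
      \<le> of_nat CARD('n) * emeasure lborel (cball (0::real^'n) 1)"
    by (subst emeasure_sphere_measure)
       (auto intro!: mult_left_mono emeasure_mono simp: sets_restrict_space image_iff)
  also have "\<dots> < \<infinity>"
    using emeasure_lborel_cball_finite[of "0::real^'n" 1] by (simp add: ennreal_mult_less_top of_nat_less_top)
  finally show "emeasure sphere_measure (space (sphere_measure :: (real^'n) measure)) \<noteq> \<infinity>" by simp
qed

interpretation sph: finite_measure "sphere_measure :: (real^'n) measure"
  by (rule finite_sphere_measure)

text \<open>\<open>dir\<close> is constant along open rays, so dilation by \<open>b\<close> maps the
  unit cone over \<open>A\<close> to the cone of radius \<open>b\<close>, and only the Jacobian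
  remains.\<close>

lemma emeasure_cone_scale:
  assumes A: "A \<in> sets (restrict_space borel (sphere (0::real^'n) 1))" and b: "b > 0"
  shows "emeasure lborel (cball 0 b \<inter> dir -` A) = ennreal (b ^ CARD('n)) * emeasure lborel (cball 0 1 \<inter> dir -` A)"
proof -
  note [measurable, simp] = vimage_dir_borel[OF A]
  have "emeasure lborel (cball 0 b \<inter> dir -` A) =
     emeasure (density (distr lborel borel (\<lambda>x. 0 + b *\<^sub>R x)) (\<lambda>_. ennreal (\<bar>b\<bar>^DIM(real^'n)))) (cball 0 b \<inter> dir -` A)"
    using lborel_affine[of b "0::real^'n"] b by simp
  also have "\<dots> = ennreal (b ^ CARD('n)) * emeasure lborel ((\<lambda>x. b *\<^sub>R x) -` (cball 0 b \<inter> dir -` A))"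
    using b by (subst emeasure_density) (simp_all add: nn_integral_cmult_indicator emeasure_distr del: vimage_Int)
  also have "(\<lambda>x. b *\<^sub>R x) -` (cball 0 b \<inter> dir -` A) = cball 0 1 \<inter> dir -` A"
    using b by (auto simp: dir_scaleR)
  finally show ?thesis .
qed

section \<open>Lebesgue measure as a product of radial and surface measure\<close>

definition radial_measure :: "nat \<Rightarrow> real measure" where
  "radial_measure k = density lborel (\<lambda>r. ennreal (r ^ k) * indicator {0<..} r)"

lemma sets_radial_measure [measurable_cong, simp]: "sets (radial_measure k) = sets borel"
  and space_radial_measure [simp]: "space (radial_measure k) = UNIV"
  by (simp_all add: radial_measure_def)

lemma sigma_finite_radial_measure: "sigma_finite_measure (radial_measure k)"
proof -
  have *: "(\<lambda>r. ennreal (r ^ k) * indicator {0<..} r) = (\<lambda>r::real. ennreal (r ^ k * indicator {0<..} r))"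
    by (auto split: split_indicator)
  show ?thesis
    unfolding radial_measure_def *
    by (subst sigma_finite_measure.sigma_finite_iff_density_finite[OF sigma_finite_lborel]) auto
qed

lemma emeasure_radial_measure_atMost:
  "emeasure (radial_measure k) {..b} = ennreal (max 0 b ^ Suc k / Suc k)"
proof -
  have "emeasure (radial_measure k) {..b} = (\<integral>\<^sup>+r. ennreal (r ^ k) * indicator {0<..} r * indicator {..b} r \<partial>lborel)"
    by (simp add: radial_measure_def emeasure_density)
  also have "\<dots> = (\<integral>\<^sup>+r. ennreal (r ^ k) * indicator {0..max 0 b} r \<partial>lborel)"
    by (intro nn_integral_cong_AE AE_I[of _ _ "{0}"]) (auto split: split_indicator split_max)
  also have "\<dots> = ennreal (max 0 b ^ Suc k / Suc k - 0 ^ Suc k / Suc k)"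
    by (rule nn_integral_FTC_Icc[where F="\<lambda>r. r ^ Suc k / Suc k"])
       (auto intro!: DERIV_cong[OF DERIV_cdivide[OF DERIV_pow]] simp del: power_Suc of_nat_Suc)
  finally show ?thesis by simp
qed

text \<open>A product measure is determined by rectangles. For fixed \<open>A\<close> both sides are
  measures in \<open>B\<close>, and on half-lines the claim is cone scaling: the radial mass
  \<open>b ^ d / d\<close> cancels against the factor \<open>d\<close> built into
  \<open>sphere_measure\<close>.\<close>

theorem distr_norm_dir:
  "distr lborel (borel \<Otimes>\<^sub>M sphere_measure) (\<lambda>x::real^'n. (norm x, dir x))
     = radial_measure (CARD('n) - 1) \<Otimes>\<^sub>M sphere_measure" (is "?L = ?N \<Otimes>\<^sub>M _")
proof (rule pair_measure_eqI[symmetric])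
  show "sigma_finite_measure ?N" by (rule sigma_finite_radial_measure)
  show "sigma_finite_measure (sphere_measure :: (real^'n) measure)" by unfold_locales
  show "sets (?N \<Otimes>\<^sub>M sphere_measure) = sets ?L" by (simp cong: sets_pair_measure_cong)
  have [measurable]: "(\<lambda>x::real^'n. (norm x, dir x)) \<in> measurable borel (borel \<Otimes>\<^sub>M sphere_measure)"
    by measurable
  fix B A assume B: "B \<in> sets ?N" and A: "A \<in> sets (sphere_measure :: (real^'n) measure)"
  then have A': "A \<in> sets (restrict_space borel (sphere 0 1))" by simp
  note [measurable, simp] = vimage_dir_borel[OF A']
  from B have [measurable]: "B \<in> sets borel" by simp
  define N1 where "N1 = distr (density lborel (indicator (dir -` A))) borel (norm :: real^'n \<Rightarrow> real)"
  define N2 where "N2 = density ?N (\<lambda>_. emeasure sphere_measure A)"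
  have N1: "emeasure N1 C = emeasure lborel (norm -` C \<inter> dir -` A)" if [measurable]: "C \<in> sets borel" for C
  proof -
    have "emeasure N1 C = (\<integral>\<^sup>+x. indicator (dir -` A) x * indicator (norm -` C) x \<partial>lborel)"
      unfolding N1_def
      by (subst emeasure_distr, simp_all, subst emeasure_density, simp_all add: measurable_sets_borel[OF borel_measurable_norm])
    also have "\<dots> = (\<integral>\<^sup>+x. indicator (norm -` C \<inter> dir -` A) x \<partial>lborel)"
      by (intro nn_integral_cong) (auto split: split_indicator)
    finally show ?thesis by simp
  qed
  have N2: "emeasure N2 C = emeasure ?N C * emeasure sphere_measure A" if "C \<in> sets borel" for C
    unfolding N2_def using that
    by (subst emeasure_density) (simp_all add: nn_integral_cmult_indicator mult.commute[of "emeasure (radial_measure _) _"])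
  have fin: "emeasure sphere_measure A < \<infinity>" by (simp add: sph.emeasure_finite less_top[symmetric])
  have at: "emeasure N1 {..b} = emeasure N2 {..b}" for b
  proof (cases "b > 0")
    case True
    have "norm -` {..b} = cball (0::real^'n) b" by auto
    then have "emeasure N1 {..b} = ennreal (b ^ CARD('n)) * emeasure lborel (cball 0 1 \<inter> dir -` A)"
      using True by (simp add: N1 emeasure_cone_scale[OF A' True])
    moreover have "emeasure N2 {..b} = ennreal (b ^ CARD('n) / CARD('n)) * (of_nat CARD('n) * emeasure lborel (cball 0 1 \<inter> dir -` A))"
      using True emeasure_radial_measure_atMost[of "CARD('n) - 1" b]
      by (simp add: N2 emeasure_sphere_measure[OF A'])
    moreover have "ennreal (b ^ CARD('n) / CARD('n)) * of_nat CARD('n) = ennreal (b ^ CARD('n))"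
      using True by (simp add: ennreal_of_nat_eq_real_of_nat ennreal_mult[symmetric])
    ultimately show ?thesis by (simp add: mult.assoc[symmetric])
  next
    case False
    \<comment> \<open>For \<open>b \<le> 0\<close> at most the origin has norm at most
      \<open>b\<close>, so both measures vanish.\<close>
    have "emeasure N1 {..b} \<le> emeasure lborel {0::real^'n}"
    proof (subst N1)
      have "norm -` {..b} \<inter> dir -` A \<subseteq> {0::real^'n}"
        using False by (auto dest: order_trans[of "norm _" b 0])
      then show "emeasure lborel (norm -` {..b} \<inter> dir -` A) \<le> emeasure lborel {0::real^'n}"
        by (rule emeasure_mono) simp
    qed simp
    moreover have "emeasure N2 {..b} = 0"
      using False emeasure_radial_measure_atMost[of "CARD('n) - 1" b] by (simp add: N2)
    ultimately show ?thesis by simp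
  qed
  have "N1 = N2"
  proof (rule measure_eqI_generator_eq[where E="range (\<lambda>b. {..b::real})" and \<Omega>=UNIV and A="\<lambda>i. {..real i}"])
    show "Int_stable (range (\<lambda>b. {..b::real}))"
      by (auto simp: Int_stable_def)
    show "sets N1 = sigma_sets UNIV (range (\<lambda>b. {..b}))" "sets N2 = sigma_sets UNIV (range (\<lambda>b. {..b}))"
      by (simp_all add: N1_def N2_def borel_eq_atMost)
    show "(\<Union>i. {..real i}) = UNIV" by (auto intro: real_arch_simple)
    show "emeasure N1 {..real i} \<noteq> \<infinity>" for i
      unfolding at using emeasure_radial_measure_atMost[of "CARD('n) - 1" "real i"] fin
      by (simp add: N2 ennreal_mult_eq_top_iff)
  qed (auto simp: at)
  then have "emeasure N1 B = emeasure N2 B" by simp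
  moreover have "emeasure ?L (B \<times> A) = emeasure N1 B"
    unfolding N1[OF \<open>B \<in> sets borel\<close>] using A
    by (subst emeasure_distr) (auto intro!: arg_cong2[where f=emeasure])
  ultimately show "emeasure ?N B * emeasure sphere_measure A = emeasure ?L (B \<times> A)"
    by (simp add: N2)
qed


lemma borel_measurable_sphere_measure:
  "f \<in> borel_measurable borel \<Longrightarrow> f \<in> borel_measurable (sphere_measure :: (real^'n) measure)"
  unfolding measurable_cong_sets[OF sets_sphere_measure refl] by (rule measurable_restrict_space1)

lemma ident_sphere_measure [measurable]: "(\<lambda>u. u) \<in> borel_measurable (sphere_measure :: (real^'n) measure)"
  by (rule borel_measurable_sphere_measure) auto

lemma norm_dir_measurable [measurable]:
  "(\<lambda>x::real^'n. (norm x, dir x)) \<in> measurable lborel (borel \<Otimes>\<^sub>M sphere_measure)"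
proof (rule measurable_Pair)
  show "(dir :: real^'n \<Rightarrow> _) \<in> measurable lborel sphere_measure"
    unfolding measurable_cong_sets[OF sets_lborel sets_sphere_measure] by (rule dir_measurable)
qed simp

lemma polar_scaleR_measurable [measurable]:
  "(\<lambda>(r, u). r *\<^sub>R u) \<in> borel_measurable (borel \<Otimes>\<^sub>M (sphere_measure :: (real^'n) measure))"
  unfolding split_beta
  by (intro borel_measurable_scaleR measurable_fst measurable_compose[OF measurable_snd ident_sphere_measure])

lemma nn_integral_polar:
  assumes [measurable]: "f \<in> borel_measurable (borel :: (real^'n) measure)"
  shows "(\<integral>\<^sup>+x. f x \<partial>lborel) = (\<integral>\<^sup>+r. \<integral>\<^sup>+u. f (r *\<^sub>R u) \<partial>sphere_measure \<partial>radial_measure (CARD('n) - 1))"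
proof -
  have "(\<integral>\<^sup>+x. f x \<partial>lborel) = (\<integral>\<^sup>+x. (\<lambda>(r, u). f (r *\<^sub>R u)) (norm x, dir x) \<partial>lborel)"
    by simp
  also have "\<dots> = (\<integral>\<^sup>+y. (\<lambda>(r, u). f (r *\<^sub>R u)) y \<partial>(radial_measure (CARD('n) - 1) \<Otimes>\<^sub>M sphere_measure))"
    unfolding distr_norm_dir[symmetric] by (rule nn_integral_distr[symmetric]) measurable
  also have "\<dots> = (\<integral>\<^sup>+r. \<integral>\<^sup>+u. f (r *\<^sub>R u) \<partial>sphere_measure \<partial>radial_measure (CARD('n) - 1))"
    by (subst sigma_finite_measure.nn_integral_fst[symmetric]) (auto intro: sph.sigma_finite_measure_axioms)
  finally show ?thesis .
qed

text \<open>The Bochner integrals later evaluated in polar coordinates all factor into a radial and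
  an angular part, so this product form is enough.\<close>

lemma integral_polar_product:
  fixes h :: "real \<Rightarrow> real" and P :: "real^'n \<Rightarrow> 'b::{banach, second_countable_topology}"
  assumes h: "integrable (radial_measure (CARD('n) - 1)) h" and P: "integrable sphere_measure P"
  shows "integrable lborel (\<lambda>x. h (norm x) *\<^sub>R P (dir x))"
    and "integral\<^sup>L lborel (\<lambda>x. h (norm x) *\<^sub>R P (dir x))
           = integral\<^sup>L (radial_measure (CARD('n) - 1)) h *\<^sub>R integral\<^sup>L sphere_measure P"
proof -
  let ?N = "radial_measure (CARD('n) - 1)"
  interpret N: sigma_finite_measure ?N by (rule sigma_finite_radial_measure)
  interpret pair_sigma_finite ?N "sphere_measure :: (real^'n) measure" ..
  have [measurable]: "h \<in> borel_measurable borel" "P \<in> borel_measurable sphere_measure"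
    using borel_measurable_integrable[OF h] borel_measurable_integrable[OF P] by simp_all
  have m: "(\<lambda>(r, u). h r *\<^sub>R P u) \<in> borel_measurable (borel \<Otimes>\<^sub>M sphere_measure)" by measurable
  have i: "integrable (?N \<Otimes>\<^sub>M sphere_measure) (\<lambda>(r, u). h r *\<^sub>R P u)"
  proof (rule Fubini_integrable)
    show "integrable ?N (\<lambda>r. \<integral>u. norm (case (r, u) of (r, u) \<Rightarrow> h r *\<^sub>R P u) \<partial>sphere_measure)"
      using h P by simp
    show "AE r in ?N. integrable sphere_measure (\<lambda>u. case (r, u) of (r, u) \<Rightarrow> h r *\<^sub>R P u)"
      using P by simp
  qed measurable
  show "integrable lborel (\<lambda>x. h (norm x) *\<^sub>R P (dir x))"
    using i unfolding distr_norm_dir[symmetric] by (subst (asm) integrable_distr_eq) (use m in auto)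
  have "integral\<^sup>L lborel (\<lambda>x. h (norm x) *\<^sub>R P (dir x)) = integral\<^sup>L (?N \<Otimes>\<^sub>M sphere_measure) (\<lambda>(r, u). h r *\<^sub>R P u)"
    unfolding distr_norm_dir[symmetric] by (subst integral_distr) (use m in auto)
  also have "\<dots> = (\<integral>r. \<integral>u. h r *\<^sub>R P u \<partial>sphere_measure \<partial>?N)"
    using integral_fst'[OF i] by simp
  also have "\<dots> = integral\<^sup>L ?N h *\<^sub>R integral\<^sup>L sphere_measure P"
    using h P by simp
  finally show "integral\<^sup>L lborel (\<lambda>x. h (norm x) *\<^sub>R P (dir x)) = integral\<^sup>L ?N h *\<^sub>R integral\<^sup>L sphere_measure P" .
qed

section \<open>Radial integrals as values of Gamma\<close>

lemma has_bochner_integral_powr_exp_powr: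
  fixes a b R :: real
  assumes a: "a > 0" and b: "b > 0" and R: "R > 0"
  shows "has_bochner_integral lborel (\<lambda>r. indicator {0<..} r * (r powr (b - 1) * exp (- R * r powr a)))
           (Gamma (b / a) / (a * R powr (b / a)))"
proof -
  define f where "f t = t powr (b / a - 1) / exp t" for t :: real
  \<comment> \<open>\<open>g\<close> is the substitution \<open>t = R * r powr a\<close> in Euler's
    integral for \<open>Gamma (b / a)\<close>. It is a bijection of the open half-line onto itself
    with nonzero derivative, hence the removal of 0 below.\<close>
  define g where "g r = R * r powr a" for r :: real
  define g' where "g' r = R * (a * r powr (a - 1))" for r :: real
  have "(f has_integral Gamma (b / a)) {0..}"
    unfolding f_def using a b by (intro Gamma_integral_real) simp
  then have f: "(f has_integral Gamma (b / a)) {0<..}"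
    by (subst (asm) has_integral_spike_set_eq[where T="{0<..}"]) (auto intro!: negligible_subset[OF negligible_sing[of 0]])
  have img: "g ` {0<..} = {0<..}"
  proof safe
    fix t :: real assume "0 < t"
    then show "t \<in> g ` {0<..}" using a R
      by (intro image_eqI[of _ _ "(t / R) powr (1 / a)"]) (auto simp: g_def powr_powr)
  qed (use R in \<open>auto simp: g_def\<close>)
  have fabs: "f absolutely_integrable_on g ` {0<..} \<and> integral (g ` {0<..}) f = Gamma (b / a)"
    unfolding img using f
    by (auto intro!: nonnegative_absolutely_integrable_1 simp: f_def has_integral_integrable_integral)
  have sub: "\<bar>g' r\<bar> * f (g r) = a * R powr (b / a) * (r powr (b - 1) * exp (- R * r powr a))" if "r > 0" for r
  proof -
    have "r powr (a - 1) * (r powr a) powr (b / a - 1) = r powr (b - 1)"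
      using a by (simp add: powr_powr powr_add[symmetric] field_simps)
    moreover have "R * R powr (b / a - 1) = R powr (b / a)"
      using R by (simp add: powr_diff)
    ultimately show ?thesis
      using a R that by (simp add: g'_def f_def g_def powr_mult exp_minus field_simps)
  qed
  have inj: "inj_on g {0<..}"
    using R a by (intro inj_on_inverseI[of _ "\<lambda>t. (t / R) powr (1 / a)"]) (auto simp: g_def powr_powr)
  have "(\<lambda>r. \<bar>g' r\<bar> * f (g r)) absolutely_integrable_on {0<..} \<and> integral {0<..} (\<lambda>r. \<bar>g' r\<bar> * f (g r)) = Gamma (b / a)"
  proof (subst has_absolute_integral_change_of_variables_1'[where g=g and g'=g'])
    show "(g has_field_derivative g' r) (at r within {0<..})" if "r \<in> {0<..}" for r
      using that unfolding g_def g'_def by (auto intro!: derivative_eq_intros simp: algebra_simps)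
  qed (use inj fabs in auto)
  then have gi: "((\<lambda>r. \<bar>g' r\<bar> * f (g r)) has_integral Gamma (b / a)) {0<..}"
    by (auto simp: has_integral_integrable_integral set_lebesgue_integral_eq_integral(1))
  have "((\<lambda>r. a * R powr (b / a) * (r powr (b - 1) * exp (- R * r powr a))) has_integral Gamma (b / a)) {0<..}"
    by (rule has_integral_eq[OF _ gi]) (use sub in auto)
  then have "((\<lambda>r. inverse (a * R powr (b / a)) * (a * R powr (b / a) * (r powr (b - 1) * exp (- R * r powr a))))
      has_integral inverse (a * R powr (b / a)) * Gamma (b / a)) {0<..}"
    by (rule has_integral_mult_right)
  then have "((\<lambda>r. r powr (b - 1) * exp (- R * r powr a)) has_integral Gamma (b / a) / (a * R powr (b / a))) {0<..}"
    using a R by (simp add: field_simps)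
  then have *: "((\<lambda>r. indicator {0<..} r * (r powr (b - 1) * exp (- R * r powr a))) has_integral Gamma (b / a) / (a * R powr (b / a))) UNIV"
    by (subst (asm) has_integral_restrict_UNIV[symmetric])
       (auto elim!: has_integral_eq[rotated] split: split_indicator)
  show ?thesis
  proof (rule has_bochner_integral_nn_integral)
    show "(\<integral>\<^sup>+r. ennreal (indicator {0<..} r * (r powr (b - 1) * exp (- R * r powr a))) \<partial>lborel)
        = ennreal (Gamma (b / a) / (a * R powr (b / a)))"
      by (rule nn_integral_has_integral_lborel[OF _ _ *]) auto
    show "0 \<le> Gamma (b / a) / (a * R powr (b / a))"
      using a b R by (intro divide_nonneg_nonneg) (auto intro!: less_imp_le[OF Gamma_real_pos])
  qed auto
qed

lemma has_bochner_integral_radial_powr_exp: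
  fixes a s R :: real
  assumes a: "a > 0" and s: "s \<ge> 0" and R: "R > 0"
  shows "has_bochner_integral (radial_measure k) (\<lambda>r. r powr s * exp (- R * r powr a))
           (Gamma ((s + k + 1) / a) / (a * R powr ((s + k + 1) / a)))"
proof -
  have *: "has_bochner_integral lborel (\<lambda>r. (r ^ k * indicator {0<..} r) *\<^sub>R (r powr s * exp (- R * r powr a)))
           (Gamma ((s + k + 1) / a) / (a * R powr ((s + k + 1) / a)))"
    by (rule has_bochner_integral_cong[THEN iffD1, OF refl _ refl has_bochner_integral_powr_exp_powr[of a "s + k + 1" R]])
       (use assms in \<open>auto split: split_indicator simp: powr_realpow[symmetric] powr_add\<close>)
  have **: "(\<lambda>r. ennreal (r ^ k) * indicator {0<..} r) = (\<lambda>r::real. ennreal (r ^ k * indicator {0<..} r))"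
    by (auto split: split_indicator)
  show ?thesis
    unfolding radial_measure_def **
    by (rule has_bochner_integral_density[OF _ _ _ *]) (auto split: split_indicator)
qed

section \<open>Gaussian integrals\<close>

text \<open>\<open>lborel\<close> on \<open>real^'n\<close> is a product measure indexed by the
  vectors of \<open>Basis\<close>; reindexing along the unit vectors \<open>axis k 1\<close> makes
  it a product over coordinates.\<close>

lemma
  fixes g :: "'n::finite \<Rightarrow> real \<Rightarrow> 'b::{real_normed_field,banach,second_countable_topology}"
  assumes g: "\<And>k. integrable lborel (g k)"
  shows integrable_lborel_vec_prod: "integrable lborel (\<lambda>x::real^'n. \<Prod>k\<in>UNIV. g k (x $ k))"
    and integral_lborel_vec_prod:
      "integral\<^sup>L lborel (\<lambda>x::real^'n. \<Prod>k\<in>UNIV. g k (x $ k)) = (\<Prod>k\<in>UNIV. integral\<^sup>L lborel (g k))"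
proof -
  interpret product_sigma_finite "\<lambda>_::real^'n. lborel :: real measure" by standard
  define ax where "ax k = (axis k 1 :: real^'n)" for k :: 'n
  have inj: "inj ax" by (auto simp: inj_def ax_def axis_eq_axis)
  have B: "(Basis :: (real^'n) set) = range ax"
    by (auto simp: Basis_vec_def ax_def)
  have comp: "(\<Sum>b\<in>Basis. f b *\<^sub>R b) $ k = f (ax k)" for f :: "real^'n \<Rightarrow> real" and k
  proof -
    have "(\<Sum>b\<in>Basis. f b *\<^sub>R b) $ k = (\<Sum>b\<in>Basis. f b *\<^sub>R b) \<bullet> ax k"
      by (simp add: ax_def inner_axis)
    also have "\<dots> = f (ax k)" by (rule inner_sum_left_Basis) (simp add: B)
    finally show ?thesis .
  qed
  define G where "G b = g (inv ax b)" for b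
  have G: "G (ax k) = g k" for k by (simp add: G_def inv_f_f[OF inj])
  have Gi: "integrable lborel (G b)" for b by (simp add: G_def g)
  have [measurable]: "g k \<in> borel_measurable borel" for k
    using borel_measurable_integrable[OF g[of k]] by simp
  have pr: "(\<Prod>k\<in>UNIV. g k (f (ax k))) = (\<Prod>b\<in>Basis. G b (f b))" for f
    unfolding B by (subst prod.reindex[OF inj]) (simp add: G)
  have m: "(\<lambda>f::real^'n \<Rightarrow> real. \<Sum>b\<in>Basis. f b *\<^sub>R b) \<in> borel_measurable (\<Pi>\<^sub>M b\<in>Basis. lborel)"
    by measurable
  have m2: "(\<lambda>x::real^'n. \<Prod>k\<in>UNIV. g k (x $ k)) \<in> borel_measurable borel"
    by measurable
  have "integrable (\<Pi>\<^sub>M b\<in>Basis. lborel) (\<lambda>f. \<Prod>b\<in>Basis. G b (f b))"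
    by (rule product_integrable_prod) (auto simp: Gi)
  then show "integrable lborel (\<lambda>x::real^'n. \<Prod>k\<in>UNIV. g k (x $ k))"
    by (subst lborel_eq, subst integrable_distr_eq) (use m m2 in \<open>auto simp: comp pr simp del: sum_component vector_scaleR_component\<close>)
  have "integral\<^sup>L lborel (\<lambda>x::real^'n. \<Prod>k\<in>UNIV. g k (x $ k)) =
      integral\<^sup>L (\<Pi>\<^sub>M b\<in>Basis. lborel) (\<lambda>f. \<Prod>b\<in>Basis. G b (f b))"
    by (subst lborel_eq, subst integral_distr) (use m m2 in \<open>auto simp: comp pr simp del: sum_component vector_scaleR_component\<close>)
  also have "\<dots> = (\<Prod>b\<in>Basis. integral\<^sup>L lborel (G b))"
    by (rule product_integral_prod) (auto simp: Gi)
  also have "\<dots> = (\<Prod>k\<in>UNIV. integral\<^sup>L lborel (g k))"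
    unfolding B by (subst prod.reindex[OF inj]) (simp add: G)
  finally show "integral\<^sup>L lborel (\<lambda>x::real^'n. \<Prod>k\<in>UNIV. g k (x $ k)) = (\<Prod>k\<in>UNIV. integral\<^sup>L lborel (g k))" .
qed

text \<open>The product form gives moments coordinate by coordinate, the radial form
  \<open>gauss_eq\<close> gives polar coordinates. Comparing the two carries integration by parts
  over to the sphere.\<close>

definition gauss :: "real^'n::finite \<Rightarrow> real" where
  "gauss x = (\<Prod>k\<in>UNIV. std_normal_density (x $ k))"

lemma gauss_eq: "gauss (x :: real^'n) = (1 / sqrt (2 * pi)) ^ CARD('n) * exp (- (norm x)\<^sup>2 / 2)"
proof -
  have "(norm x)\<^sup>2 = (\<Sum>k\<in>UNIV. (x $ k)\<^sup>2)"
    unfolding power2_norm_eq_inner inner_vec_def by (simp add: power2_eq_square)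
  then have "- (norm x)\<^sup>2 / 2 = (\<Sum>k\<in>UNIV. - (x $ k)\<^sup>2 / 2)"
    by (simp add: sum_negf sum_divide_distrib)
  then show ?thesis
    by (simp only: gauss_def std_normal_density_def exp_sum[OF finite] prod.distrib prod_constant)
qed

lemma gauss_pos [simp]: "gauss x > 0"
  by (simp add: gauss_eq)

lemma gauss_nonneg [simp]: "gauss x \<ge> 0"
  by (simp add: less_imp_le)

lemma gauss_measurable [measurable]: "gauss \<in> borel_measurable borel"
  unfolding gauss_eq[abs_def] by measurable

definition gauss_moment :: "nat \<Rightarrow> real" where
  "gauss_moment k = integral\<^sup>L lborel (\<lambda>t. std_normal_density t * t ^ k)"

text \<open>This is integration by parts against the standard normal density, read off from the
  closed form of its moments. At \<open>k = 0\<close> the truncated index does no harm because its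
  factor is 0.\<close>

lemma gauss_moment_rec: "real k * gauss_moment (k - 1) = gauss_moment (Suc k)"
proof (cases "even k")
  case True
  then obtain m where m: "k = 2 * m" by auto
  have "gauss_moment (Suc k) = 0"
    using integral_std_normal_moment_odd[of m] by (simp add: gauss_moment_def m)
  moreover have "real k * gauss_moment (k - 1) = 0"
  proof (cases m)
    case (Suc l)
    then show ?thesis using integral_std_normal_moment_odd[of l] by (simp add: gauss_moment_def m)
  qed (simp add: m)
  ultimately show ?thesis by simp
next
  case False
  then obtain m where m: "k = 2 * m + 1" by (auto elim: oddE)
  have 1: "gauss_moment (2 * n) = fact (2 * n) / (2 ^ n * fact n)" for n
    using integral_std_normal_moment_even[of n] by (simp add: gauss_moment_def)
  have "gauss_moment (Suc k) = gauss_moment (2 * Suc m)" by (simp add: m)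
  also have "\<dots> = (2 * m + 2) * ((2 * m + 1) * fact (2 * m)) / (2 * 2 ^ m * ((m + 1) * fact m))"
    unfolding 1 by (simp add: algebra_simps)
  also have "\<dots> = (2 * m + 1) * (fact (2 * m) / (2 ^ m * fact m))"
  proof -
    have "(2 * x + 2) * ((2 * x + 1) * a) / (2 * b * ((x + 1) * c)) = (2 * x + 1) * (a / (b * c))"
      if "x \<ge> 0" "b > 0" "c > 0" for x a b c :: real
      using that by (simp add: divide_simps add_nonneg_eq_0_iff)
    from this[of "real m" "2 ^ m" "fact m" "fact (2 * m)", OF of_nat_0_le_iff _ fact_gt_zero] show ?thesis
      by (simp only: of_nat_add of_nat_mult of_nat_numeral of_nat_1 of_nat_fact of_nat_power zero_less_power zero_less_numeral simp_thms if_True)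
  qed
  finally show ?thesis using 1[of m] by (simp add: m)
qed

lemma integral_gauss_monom:
  fixes \<beta> :: "'n::finite \<Rightarrow> nat"
  shows "integral\<^sup>L lborel (\<lambda>x. gauss x *\<^sub>R monom \<beta> x)
          = complex_of_real (\<Prod>k\<in>UNIV. gauss_moment (\<beta> k))"
proof -
  have eq: "gauss x *\<^sub>R monom \<beta> x = (\<Prod>k\<in>UNIV. complex_of_real (std_normal_density (x $ k) * (x $ k) ^ \<beta> k))" for x
    by (simp add: gauss_def monom_def scaleR_conv_of_real prod.distrib)
  have i: "integrable lborel (\<lambda>t. complex_of_real (std_normal_density t * t ^ k))" for k
    using integrable_std_normal_moment[of k] by (rule integrable_of_real)
  show "integral\<^sup>L lborel (\<lambda>x. gauss x *\<^sub>R monom \<beta> x) = complex_of_real (\<Prod>k\<in>UNIV. gauss_moment (\<beta> k))"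
    unfolding eq by (subst integral_lborel_vec_prod[OF i])
      (simp add: gauss_moment_def integral_complex_of_real[symmetric] del: of_real_mult of_real_power integral_complex_of_real)
qed

lemma integrable_gauss: "integrable lborel (gauss :: real^'n \<Rightarrow> real)"
  and integral_gauss: "integral\<^sup>L lborel (gauss :: real^'n \<Rightarrow> real) = 1"
proof -
  have i: "integrable lborel std_normal_density" "integral\<^sup>L lborel std_normal_density = 1"
    using integrable_std_normal_moment[of 0] integral_std_normal_moment_even[of 0] by simp_all
  show "integrable lborel (gauss :: real^'n \<Rightarrow> real)"
    unfolding gauss_def[abs_def] by (rule integrable_lborel_vec_prod) (rule i)
  show "integral\<^sup>L lborel (gauss :: real^'n \<Rightarrow> real) = 1"
    unfolding gauss_def[abs_def] by (subst integral_lborel_vec_prod) (simp_all add: i)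
qed

lemma integral_gauss_cis:
  "integral\<^sup>L lborel (\<lambda>x. gauss x *\<^sub>R cis (z \<bullet> x)) = complex_of_real (exp (- (norm (z::real^'n))\<^sup>2 / 2))"
proof -
  have cs: "cis (sum f A) = (\<Prod>k\<in>A. cis (f k))" if "finite A" for f :: "'n \<Rightarrow> real" and A
    using that by (induction) (auto simp: cis_mult[symmetric])
  have eq: "gauss x *\<^sub>R cis (z \<bullet> x) = (\<Prod>k\<in>UNIV. std_normal_density (x $ k) *\<^sub>R cis (z $ k * (x $ k)))" for x
    by (simp add: gauss_def inner_vec_def scaleR_conv_of_real prod.distrib cs)
  have i: "integrable lborel (\<lambda>t. std_normal_density t *\<^sub>R cis (c * t))" for c
    by (rule Bochner_Integration.integrable_bound[OF integrable_std_normal_moment[of 0]]) (auto simp: cis_conv_exp)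
  have c: "integral\<^sup>L lborel (\<lambda>t. std_normal_density t *\<^sub>R cis (c * t)) = complex_of_real (exp (- c\<^sup>2 / 2))" for c
  proof -
    have "complex_of_real (exp (- c\<^sup>2 / 2)) = char std_normal_distribution c"
      by (simp add: char_std_normal_distribution)
    also have "\<dots> = integral\<^sup>L lborel (\<lambda>t. std_normal_density t *\<^sub>R cis (c * t))"
      unfolding char_def by (subst integral_density) (auto simp: cis_conv_exp)
    finally show ?thesis by simp
  qed
  have "(norm z)\<^sup>2 = (\<Sum>k\<in>UNIV. (z $ k)\<^sup>2)"
    unfolding power2_norm_eq_inner inner_vec_def by (simp add: power2_eq_square)
  then have n: "- (norm z)\<^sup>2 / 2 = (\<Sum>k\<in>UNIV. - (z $ k)\<^sup>2 / 2)"
    by (simp add: sum_negf sum_divide_distrib)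
  show ?thesis
    unfolding eq integral_lborel_vec_prod[OF i] c n exp_sum[OF finite] by simp
qed

section \<open>Homogeneous polynomials\<close>

text \<open>A first-order operator, so that Leibniz rules and commutation can be stated before
  iterating. \<open>partial2\<close> is fixed at second order; \<open>laplacian_hpoly\<close>
  reconciles the two on polynomials.\<close>

definition pd :: "'n \<Rightarrow> (real^'n::finite \<Rightarrow> complex) \<Rightarrow> real^'n \<Rightarrow> complex" where
  "pd i f x = vector_derivative (\<lambda>s. f (x + s *\<^sub>R axis i 1)) (at 0)"

definition lap :: "(real^'n::finite \<Rightarrow> complex) \<Rightarrow> real^'n \<Rightarrow> complex" where
  "lap f x = (\<Sum>i\<in>UNIV. pd i (pd i f) x)"

text \<open>Homogeneous polynomials without coefficients, so that closure properties and Leibniz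
  computations become rule inductions. The zero function belongs to every degree, which makes
  truncated degrees such as \<open>j - 1\<close> harmless.\<close>

inductive hpoly :: "nat \<Rightarrow> (real^'n::finite \<Rightarrow> complex) \<Rightarrow> bool" where
  hpoly_zero: "hpoly j (\<lambda>x. 0)"
| hpoly_const: "hpoly 0 (\<lambda>x. c)"
| hpoly_add: "hpoly j f \<Longrightarrow> hpoly j g \<Longrightarrow> hpoly j (\<lambda>x. f x + g x)"
| hpoly_coord: "hpoly j f \<Longrightarrow> hpoly (Suc j) (\<lambda>x. complex_of_real (x $ i) * f x)"

lemma pdI: "(\<And>x. ((\<lambda>s. f (x + s *\<^sub>R axis i 1)) has_vector_derivative D x) (at 0)) \<Longrightarrow> pd i f = D"
  by (rule ext) (simp add: pd_def vector_derivative_at)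

lemma has_vector_derivative_coord:
  "((\<lambda>s. complex_of_real ((x + s *\<^sub>R axis i 1) $ k)) has_vector_derivative (if i = k then 1 else 0)) (at t)"
  by (auto simp: axis_def intro!: derivative_eq_intros)

lemma hpoly_line_differentiable:
  "hpoly j f \<Longrightarrow> (\<lambda>s. f (x + s *\<^sub>R axis i 1)) differentiable (at t)"
proof (induction rule: hpoly.induct)
  case (hpoly_coord j f k)
  have "(\<lambda>s. complex_of_real ((x + s *\<^sub>R axis i 1) $ k)) differentiable (at t)"
    using has_vector_derivative_coord[of x i k t] by (rule differentiableI_vector)
  then show ?case using hpoly_coord.IH by (rule differentiable_mult)
qed auto

lemma hpoly_pd0:
  "hpoly j f \<Longrightarrow> ((\<lambda>s. f (x + s *\<^sub>R axis i 1)) has_vector_derivative pd i f x) (at 0)"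
  unfolding pd_def using hpoly_line_differentiable vector_derivative_works by blast

text \<open>The inner derivative in \<open>partial2\<close> is taken at every parameter of the line,
  while \<open>pd\<close> looks at 0 only; moving the base point bridges the gap.\<close>

lemma hpoly_pd_at:
  assumes "hpoly j f"
  shows "((\<lambda>s. f (x + s *\<^sub>R axis i 1)) has_vector_derivative pd i f (x + t *\<^sub>R axis i 1)) (at t)"
proof -
  have 1: "((\<lambda>s. s - t) has_vector_derivative 1) (at t)"
    by (auto intro!: derivative_eq_intros)
  have 2: "((\<lambda>s. f ((x + t *\<^sub>R axis i 1) + s *\<^sub>R axis i 1)) has_vector_derivative pd i f (x + t *\<^sub>R axis i 1)) (at (t - t))"
    using hpoly_pd0[OF assms] by simp
  from vector_diff_chain_at[OF 1 2] show ?thesis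
    by (simp add: o_def algebra_simps)
qed

lemma pd_const [simp]: "pd i (\<lambda>x. c) = (\<lambda>x. 0)"
  by (rule pdI) simp

lemma pd_add:
  assumes "hpoly j f" "hpoly l g"
  shows "pd i (\<lambda>x. f x + g x) = (\<lambda>x. pd i f x + pd i g x)"
  by (rule pdI) (intro has_vector_derivative_add hpoly_pd0[OF assms(1)] hpoly_pd0[OF assms(2)])

lemma pd_mult:
  assumes "hpoly j f" "hpoly l g"
  shows "pd i (\<lambda>x. f x * g x) = (\<lambda>x. f x * pd i g x + pd i f x * g x)"
proof (rule pdI)
  fix x :: "real^'a"
  show "((\<lambda>s. f (x + s *\<^sub>R axis i 1) * g (x + s *\<^sub>R axis i 1)) has_vector_derivative
      f x * pd i g x + pd i f x * g x) (at 0)"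
    using has_vector_derivative_mult[OF hpoly_pd0[OF assms(1), of x i] hpoly_pd0[OF assms(2), of x i]] by simp
qed

lemma pd_cmult:
  assumes "hpoly j f"
  shows "pd i (\<lambda>x. c * f x) = (\<lambda>x. c * pd i f x)"
  using pd_mult[OF hpoly_const assms, of i c] by simp

lemma hpoly_coord1: "hpoly (Suc 0) (\<lambda>x. complex_of_real (x $ i))"
  using hpoly_coord[OF hpoly_const, of i 1] by simp

lemma pd_coord1: "pd i (\<lambda>x. complex_of_real (x $ k)) = (\<lambda>x. if i = k then 1 else 0)"
  by (rule pdI) (rule has_vector_derivative_coord)

lemma pd_coord:
  assumes "hpoly j f"
  shows "pd i (\<lambda>x. complex_of_real (x $ k) * f x) = (\<lambda>x. complex_of_real (x $ k) * pd i f x + (if i = k then f x else 0))"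
  by (auto simp: pd_mult[OF hpoly_coord1 assms] pd_coord1 fun_eq_iff)

lemma hpoly_mult: "hpoly j f \<Longrightarrow> hpoly l g \<Longrightarrow> hpoly (j + l) (\<lambda>x. f x * g x)"
proof (induction rule: hpoly.induct)
  case (hpoly_const c)
  show ?case using hpoly_const
  proof (induction rule: hpoly.induct)
    case (hpoly_add j f g)
    then show ?case using hpoly.hpoly_add by (fastforce simp: distrib_left)
  next
    case (hpoly_coord j f i)
    then show ?case using hpoly.hpoly_coord[of j "\<lambda>x. c * f x" i] by (simp add: mult_ac)
  qed (auto intro: hpoly.intros)
next
  case (hpoly_add j f g)
  then show ?case using hpoly.hpoly_add by (fastforce simp: distrib_right)
next
  case (hpoly_coord j f i)
  then show ?case using hpoly.hpoly_coord[of "j + l" "\<lambda>x. f x * g x" i] by (simp add: mult_ac)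
qed (auto intro: hpoly.intros)

lemma hpoly_cmult: "hpoly j f \<Longrightarrow> hpoly j (\<lambda>x. c * f x)"
  using hpoly_mult[OF hpoly_const, of j f c] by simp

lemma hpoly_diff: "hpoly j f \<Longrightarrow> hpoly j g \<Longrightarrow> hpoly j (\<lambda>x. f x - g x)"
  using hpoly_add[of j f "\<lambda>x. (-1) * g x"] hpoly_cmult[of j g "-1"] by simp

lemma hpoly_sum: "(\<And>a. a \<in> A \<Longrightarrow> hpoly j (f a)) \<Longrightarrow> hpoly j (\<lambda>x. \<Sum>a\<in>A. f a x)"
  by (induction A rule: infinite_finite_induct) (auto intro: hpoly.intros)

lemma hpoly_cnj: "hpoly j f \<Longrightarrow> hpoly j (\<lambda>x. cnj (f x))"
  by (induction rule: hpoly.induct) (auto intro: hpoly.intros)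

lemma pd_sum:
  assumes "\<And>a. a \<in> A \<Longrightarrow> hpoly j (f a)"
  shows "pd i (\<lambda>x. \<Sum>a\<in>A. f a x) = (\<lambda>x. \<Sum>a\<in>A. pd i (f a) x)"
  by (rule pdI) (intro has_vector_derivative_sum hpoly_pd0[OF assms])

lemma pd_cnj:
  assumes "hpoly j f"
  shows "pd i (\<lambda>x. cnj (f x)) = (\<lambda>x. cnj (pd i f x))"
  by (rule pdI) (intro has_vector_derivative_cnj hpoly_pd0[OF assms])

lemma hpoly_0_const: "hpoly j f \<Longrightarrow> j = 0 \<Longrightarrow> \<exists>c. f = (\<lambda>x. c)"
  by (induction rule: hpoly.induct) auto

lemma pd_hpoly_0: "hpoly 0 f \<Longrightarrow> pd i f = (\<lambda>x. 0)"
  using hpoly_0_const[of 0 f] by auto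

lemma hpoly_pd: "hpoly j f \<Longrightarrow> hpoly (j - 1) (pd i f)"
proof (induction rule: hpoly.induct)
  case (hpoly_add j f g)
  then show ?case by (simp add: pd_add hpoly.hpoly_add)
next
  case (hpoly_coord j f k)
  have 1: "hpoly j (\<lambda>x. if i = k then f x else 0)"
    using hpoly_coord.hyps by (cases "i = k") (auto intro: hpoly.intros)
  \<comment> \<open>Multiplication by a coordinate leads to degree \<open>Suc (j - 1)\<close>, which
    is \<open>j\<close> only for positive \<open>j\<close>; in degree 0 the derivative is the zero
    function.\<close>
  have 2: "hpoly j (\<lambda>x. complex_of_real (x $ k) * pd i f x)"
  proof (cases j)
    case 0
    then show ?thesis using pd_hpoly_0[of f i] hpoly_coord.hyps by (auto intro: hpoly.intros)
  next
    case (Suc j')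
    then show ?thesis using hpoly.hpoly_coord[OF hpoly_coord.IH, of k] by simp
  qed
  show ?case using hpoly_add[OF 2 1] by (simp add: pd_coord[OF hpoly_coord.hyps])
qed (auto intro: hpoly.intros)

lemma hpoly_pd_Suc: "hpoly (Suc j) f \<Longrightarrow> hpoly j (pd i f)"
  using hpoly_pd[of "Suc j"] by simp

lemma pd_commute: "hpoly j f \<Longrightarrow> pd i (pd k f) = pd k (pd i f)"
proof (induction rule: hpoly.induct)
  case (hpoly_add j f g)
  then show ?case by (simp add: pd_add[of j f j g] pd_add[OF hpoly_pd hpoly_pd])
next
  case (hpoly_coord j f m)
  note h = hpoly_coord.hyps
  have pp: "pd i (pd k (\<lambda>x. complex_of_real (x $ m) * f x)) =
     (\<lambda>x. complex_of_real (x $ m) * pd i (pd k f) x + (if i = m then pd k f x else 0) + (if k = m then pd i f x else 0))" for i k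
  proof -
    have 1: "hpoly j (\<lambda>x. if k = m then f x else 0)"
      using h by (cases "k = m") (auto intro: hpoly.intros)
    have "pd i (\<lambda>x. if k = m then f x else 0) = (\<lambda>x. if k = m then pd i f x else 0)"
      by (cases "k = m") auto
    then show ?thesis
      unfolding pd_coord[OF h] pd_add[OF hpoly.hpoly_coord[OF hpoly_pd[OF h]] 1] pd_coord[OF hpoly_pd[OF h]] by simp
  qed
  show ?case unfolding pp hpoly_coord.IH by (auto simp: fun_eq_iff)
qed auto

lemma hpoly_euler: "hpoly j f \<Longrightarrow> (\<Sum>i\<in>UNIV. complex_of_real (x $ i) * pd i f x) = of_nat j * f x"
proof (induction rule: hpoly.induct)
  case (hpoly_add j f g)
  then show ?case by (simp add: pd_add sum.distrib algebra_simps)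
next
  case (hpoly_coord j f k)
  have "(\<Sum>i\<in>UNIV. complex_of_real (x $ i) * pd i (\<lambda>x. complex_of_real (x $ k) * f x) x)
    = complex_of_real (x $ k) * (\<Sum>i\<in>UNIV. complex_of_real (x $ i) * pd i f x) + (\<Sum>i\<in>UNIV. if i = k then complex_of_real (x $ i) * f x else 0)"
    unfolding pd_coord[OF hpoly_coord.hyps] sum_distrib_left sum.distrib[symmetric]
    by (intro sum.cong) (auto simp: algebra_simps)
  then show ?case using hpoly_coord.IH by (simp add: algebra_simps)
qed auto

lemma hpoly_scaleR: "hpoly j f \<Longrightarrow> f (t *\<^sub>R x) = complex_of_real (t ^ j) * f x"
  by (induction rule: hpoly.induct) (auto simp: algebra_simps)

lemma hpoly_continuous: "hpoly j f \<Longrightarrow> continuous_on UNIV f"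
  by (induction rule: hpoly.induct) (auto intro!: continuous_intros)

lemma hpoly_inner: "hpoly (Suc 0) (\<lambda>u::real^'n. complex_of_real (e \<bullet> u))"
proof -
  have "(\<lambda>u. complex_of_real (e \<bullet> u)) = (\<lambda>u. \<Sum>i\<in>UNIV. complex_of_real (e $ i) * complex_of_real (u $ i))"
    by (simp add: inner_vec_def)
  then show ?thesis by (auto intro!: hpoly_sum hpoly_cmult hpoly_coord1)
qed

lemma pd_inner: "pd i (\<lambda>u::real^'n. complex_of_real (e \<bullet> u)) = (\<lambda>u. complex_of_real (e $ i))"
proof -
  have "(\<lambda>u. complex_of_real (e \<bullet> u)) = (\<lambda>u. \<Sum>i\<in>UNIV. complex_of_real (e $ i) * complex_of_real (u $ i))"
    by (simp add: inner_vec_def)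
  then show ?thesis
    by (simp add: pd_sum[OF hpoly_cmult[OF hpoly_coord1]] pd_cmult[OF hpoly_coord1] pd_coord1 if_distrib if_distribR sum.delta' cong: if_cong)
qed

lemma hpoly_power: "hpoly j f \<Longrightarrow> hpoly (n * j) (\<lambda>x. f x ^ n)"
  by (induction n) (auto intro: hpoly_const hpoly_mult)

lemma pd_power:
  assumes "hpoly j f"
  shows "pd i (\<lambda>x. f x ^ n) = (\<lambda>x. of_nat n * f x ^ (n - 1) * pd i f x)"
proof (induction n)
  case (Suc n)
  show ?case
    unfolding power_Suc pd_mult[OF assms hpoly_power[OF assms]] Suc
    by (cases n) (simp_all add: fun_eq_iff algebra_simps)
qed auto

lemma hpoly_inner_power: "hpoly n (\<lambda>u::real^'n. complex_of_real (e \<bullet> u) ^ n)"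
  using hpoly_power[OF hpoly_inner, of n e] by simp

lemma hpoly_lap: "hpoly j f \<Longrightarrow> hpoly (j - 2) (lap f)"
  unfolding lap_def[abs_def] using hpoly_pd[OF hpoly_pd, of j f]
  by (intro hpoly_sum) (simp add: numeral_2_eq_2)

lemma lap_add:
  assumes "hpoly j f" "hpoly l g"
  shows "lap (\<lambda>x. f x + g x) = (\<lambda>x. lap f x + lap g x)"
  by (simp add: lap_def[abs_def] pd_add[OF assms] pd_add[OF hpoly_pd hpoly_pd, OF assms] sum.distrib)

lemma lap_cmult:
  assumes "hpoly j f"
  shows "lap (\<lambda>x. c * f x) = (\<lambda>x. c * lap f x)"
  by (simp add: lap_def[abs_def] pd_cmult[OF assms] pd_cmult[OF hpoly_pd[OF assms]] sum_distrib_left)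

lemma lap_diff:
  assumes "hpoly j f" "hpoly l g"
  shows "lap (\<lambda>x. f x - g x) = (\<lambda>x. lap f x - lap g x)"
  using lap_add[OF assms(1) hpoly_cmult[OF assms(2), of "-1"]] lap_cmult[OF assms(2), of "-1"] by simp

lemma lap_sum:
  assumes "\<And>a. a \<in> A \<Longrightarrow> hpoly j (f a)"
  shows "lap (\<lambda>x. \<Sum>a\<in>A. f a x) = (\<lambda>x. \<Sum>a\<in>A. lap (f a) x)"
proof -
  have "pd i (pd i (\<lambda>x. \<Sum>a\<in>A. f a x)) = (\<lambda>x. \<Sum>a\<in>A. pd i (pd i (f a)) x)" for i
  proof -
    have "pd i (\<lambda>x. \<Sum>a\<in>A. f a x) = (\<lambda>x. \<Sum>a\<in>A. pd i (f a) x)"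
      by (rule pd_sum) (rule assms)
    moreover have "pd i (\<lambda>x. \<Sum>a\<in>A. pd i (f a) x) = (\<lambda>x. \<Sum>a\<in>A. pd i (pd i (f a)) x)"
      by (rule pd_sum) (rule hpoly_pd[OF assms])
    ultimately show ?thesis by simp
  qed
  then show ?thesis by (auto simp: lap_def fun_eq_iff intro: sum.swap)
qed

lemma lap_cnj:
  assumes "hpoly j f"
  shows "lap (\<lambda>x. cnj (f x)) = (\<lambda>x. cnj (lap f x))"
  by (simp add: lap_def[abs_def] pd_cnj[OF assms] pd_cnj[OF hpoly_pd[OF assms]])

lemma lap_pd:
  assumes "hpoly j f"
  shows "lap (pd i f) = pd i (lap f)"
proof -
  have "pd i (\<lambda>x. \<Sum>k\<in>UNIV. pd k (pd k f) x) = (\<lambda>x. \<Sum>k\<in>UNIV. pd i (pd k (pd k f)) x)"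
    by (rule pd_sum[OF hpoly_pd[OF hpoly_pd[OF assms]]])
  then show ?thesis
    by (simp add: lap_def[abs_def] pd_commute[OF assms, of _ i] pd_commute[OF hpoly_pd[OF assms], of _ i])
qed

text \<open>The mixed gradient term drives two later inductions: in the orthogonality of harmonics
  it lowers both degrees, and in the Funk-Hecke formula it replaces \<open>p\<close> by a
  directional derivative.\<close>

lemma lap_mult:
  assumes "hpoly j f" "hpoly l g"
  shows "lap (\<lambda>x. f x * g x) = (\<lambda>x. f x * lap g x + 2 * (\<Sum>i\<in>UNIV. pd i f x * pd i g x) + lap f x * g x)"
proof -
  note f = assms(1) and g = assms(2)
  have "pd i (pd i (\<lambda>x. f x * g x)) = (\<lambda>x. f x * pd i (pd i g) x + 2 * (pd i f x * pd i g x) + pd i (pd i f) x * g x)" for i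
    unfolding pd_mult[OF f g]
      pd_add[OF hpoly_mult[OF f hpoly_pd[OF g, of i]] hpoly_mult[OF hpoly_pd[OF f, of i] g]]
      pd_mult[OF f hpoly_pd[OF g]] pd_mult[OF hpoly_pd[OF f] g]
    by (simp add: fun_eq_iff)
  then show ?thesis
    by (simp add: lap_def[abs_def] sum.distrib sum_distrib_left sum_distrib_right)
qed

lemma laplacian_hpoly:
  assumes "hpoly j f"
  shows "laplacian f = lap f"
proof
  fix x
  have "partial2 f i x = pd i (pd i f) x" for i
  proof -
    have "vector_derivative (\<lambda>s. f (x + s *\<^sub>R axis i 1)) (at t) = pd i f (x + t *\<^sub>R axis i 1)" for t
      by (rule vector_derivative_at[OF hpoly_pd_at[OF assms]])
    then show ?thesis by (simp add: partial2_def pd_def[of i "pd i f"])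
  qed
  then show "laplacian f x = lap f x" by (simp add: laplacian_def lap_def)
qed

section \<open>Homogeneous polynomials as combinations of monomials\<close>

lemma finite_multi_index: "finite {\<beta> :: 'n::finite \<Rightarrow> nat. sum \<beta> UNIV = j}"
proof (rule finite_subset)
  show "{\<beta> :: 'n \<Rightarrow> nat. sum \<beta> UNIV = j} \<subseteq> PiE UNIV (\<lambda>_. {..j})"
    by (auto simp: PiE_def intro: member_le_sum)
  show "finite (PiE (UNIV :: 'n set) (\<lambda>_. {..j}))" by (intro finite_PiE) auto
qed

lemma coord_monom: "complex_of_real (x $ i) * monom \<beta> x = monom (\<beta>(i := Suc (\<beta> i))) x"
proof -
  have "monom (\<beta>(i := Suc (\<beta> i))) x = complex_of_real ((x $ i) ^ Suc (\<beta> i)) * (\<Prod>k\<in>UNIV - {i}. complex_of_real ((x $ k) ^ \<beta> k))"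
    unfolding monom_def by (subst prod.remove[of UNIV i]) (auto intro!: prod.cong)
  moreover have "monom \<beta> x = complex_of_real ((x $ i) ^ \<beta> i) * (\<Prod>k\<in>UNIV - {i}. complex_of_real ((x $ k) ^ \<beta> k))"
    unfolding monom_def by (subst prod.remove[of UNIV i]) auto
  ultimately show ?thesis by simp
qed

lemma sum_fun_upd_Suc: "sum (\<beta>(i := Suc (\<beta> i))) UNIV = Suc (sum \<beta> (UNIV :: 'n::finite set))"
  by (simp add: sum.remove[of UNIV i])

lemma hpoly_monom: "sum \<beta> UNIV = j \<Longrightarrow> hpoly j (monom \<beta>)"
proof (induction j arbitrary: \<beta>)
  case 0
  then have "monom \<beta> = (\<lambda>x. 1)" by (simp add: monom_def fun_eq_iff)
  then show ?case by (simp add: hpoly_const)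
next
  case (Suc j)
  then obtain i where i: "\<beta> i > 0" by (metis gr0I nat.simps(3) sum.neutral)
  define \<gamma> where "\<gamma> = \<beta>(i := \<beta> i - 1)"
  have b: "\<beta> = \<gamma>(i := Suc (\<gamma> i))" using i by (auto simp: \<gamma>_def)
  have "sum \<gamma> UNIV = j" using Suc.prems sum_fun_upd_Suc[of \<gamma> i] b by simp
  from hpoly_coord[OF Suc.IH[OF this], of i] show ?case
    by (subst b) (simp add: coord_monom)
qed

lemma hpoly_hom_poly: "hpoly j (hom_poly j c)"
  unfolding hom_poly_def[abs_def] by (intro hpoly_sum hpoly_cmult hpoly_monom) auto

lemma hpoly_imp_hom_poly: "hpoly j f \<Longrightarrow> \<exists>c. f = hom_poly j c"
proof (induction rule: hpoly.induct)
  case (hpoly_zero j)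
  show ?case by (intro exI[of _ "\<lambda>_. 0"]) (simp add: hom_poly_def fun_eq_iff)
next
  case (hpoly_const c)
  have "{\<beta> :: 'a \<Rightarrow> nat. sum \<beta> UNIV = 0} = {\<lambda>_. 0}" by (auto simp: fun_eq_iff)
  then show ?case by (intro exI[of _ "\<lambda>_. c"]) (simp add: hom_poly_def fun_eq_iff monom_def)
next
  case (hpoly_add j f g)
  then obtain c d where "f = hom_poly j c" "g = hom_poly j d" by auto
  then show ?case
    by (intro exI[of _ "\<lambda>\<beta>. c \<beta> + d \<beta>"]) (simp add: hom_poly_def fun_eq_iff sum.distrib distrib_right)
next
  case (hpoly_coord j f i)
  then obtain c where f: "f = hom_poly j c" by auto
  \<comment> \<open>\<open>up\<close> and \<open>dn\<close> shift the exponent of coordinate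
    \<open>i\<close> and are mutually inverse between all multi-indices and those with positive
    \<open>i\<close>-th entry; \<open>c'\<close> vanishes on the others.\<close>
  define up where "up \<beta> = \<beta>(i := Suc (\<beta> i))" for \<beta> :: "'a \<Rightarrow> nat"
  define dn where "dn \<beta> = \<beta>(i := \<beta> i - 1)" for \<beta> :: "'a \<Rightarrow> nat"
  define c' where "c' \<beta> = (if \<beta> i > 0 then c (dn \<beta>) else 0)" for \<beta>
  have du: "dn (up \<beta>) = \<beta>" for \<beta> by (simp add: dn_def up_def)
  have ud: "up (dn \<beta>) = \<beta>" if "\<beta> i > 0" for \<beta> using that by (auto simp: dn_def up_def)
  have su: "sum (up \<beta>) UNIV = Suc (sum \<beta> UNIV)" for \<beta> unfolding up_def by (rule sum_fun_upd_Suc)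
  have "complex_of_real (x $ i) * f x = hom_poly (Suc j) c' x" for x
  proof -
    have "hom_poly (Suc j) c' x = (\<Sum>\<beta>\<in>{\<beta>. sum \<beta> UNIV = Suc j \<and> \<beta> i > 0}. c' \<beta> * monom \<beta> x)"
      unfolding hom_poly_def by (rule sum.mono_neutral_right[OF finite_multi_index]) (auto simp: c'_def)
    also have "\<dots> = (\<Sum>\<beta>\<in>{\<beta>. sum \<beta> UNIV = j}. c \<beta> * monom (up \<beta>) x)"
    proof (rule sum.reindex_bij_witness[of _ up dn])
      fix a assume a: "a \<in> {\<beta> :: 'a \<Rightarrow> nat. sum \<beta> UNIV = Suc j \<and> \<beta> i > 0}"
      then show "up (dn a) = a" using ud by auto
      then show "dn a \<in> {\<beta>. sum \<beta> UNIV = j}" using a su[of "dn a"] by simp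
      show "c (dn a) * monom (up (dn a)) x = c' a * monom a x"
        using a ud by (auto simp: c'_def)
    next
      fix b assume b: "b \<in> {\<beta> :: 'a \<Rightarrow> nat. sum \<beta> UNIV = j}"
      then show "dn (up b) = b" by (simp add: du)
      show "up b \<in> {\<beta>. sum \<beta> UNIV = Suc j \<and> \<beta> i > 0}" using b su[of b] by (simp add: up_def)
    qed
    also have "\<dots> = complex_of_real (x $ i) * f x"
      by (simp add: f hom_poly_def sum_distrib_left up_def coord_monom[symmetric] mult_ac)
    finally show ?thesis by simp
  qed
  then show ?case by (intro exI[of _ c']) auto
qed

lemma harm_iff: "h \<in> harm j \<longleftrightarrow> hpoly j h \<and> lap h = (\<lambda>x. 0)"
proof -
  have "(\<exists>c. h = hom_poly j c) \<longleftrightarrow> hpoly j h"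
    using hpoly_imp_hom_poly[of j h] hpoly_hom_poly by auto
  then show ?thesis using laplacian_hpoly[of j h] by (auto simp: harm_def fun_eq_iff)
qed

text \<open>Linear identities then need checking on monomials only, where Gaussian integrals factor
  into one-dimensional moments.\<close>

lemma hpoly_monom_induct [consumes 1, case_names zero monom add]:
  assumes "hpoly j f" and zero: "P (\<lambda>x. 0)"
    and mon: "\<And>\<beta> c. sum \<beta> UNIV = j \<Longrightarrow> P (\<lambda>x. c * monom \<beta> x)"
    and add: "\<And>f g. hpoly j f \<Longrightarrow> hpoly j g \<Longrightarrow> P f \<Longrightarrow> P g \<Longrightarrow> P (\<lambda>x. f x + g x)"
  shows "P f"
proof -
  obtain c where f: "f = hom_poly j c" using hpoly_imp_hom_poly[OF assms(1)] by auto
  have "hpoly j (\<lambda>x. \<Sum>\<beta>\<in>A. c \<beta> * monom \<beta> x) \<and> P (\<lambda>x. \<Sum>\<beta>\<in>A. c \<beta> * monom \<beta> x)"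
    if "finite A" "A \<subseteq> {\<beta>. sum \<beta> UNIV = j}" for A
    using that
  proof (induction)
    case (insert b A)
    then have 1: "hpoly j (\<lambda>x. c b * monom b x)" "P (\<lambda>x. c b * monom b x)"
      by (auto intro: mon hpoly_cmult hpoly_monom)
    show ?case using insert 1 by (auto intro: add hpoly_add)
  qed (auto intro: zero hpoly_zero)
  from this[OF finite_multi_index subset_refl] show ?thesis
    by (simp add: f hom_poly_def[abs_def])
qed

section \<open>Integrals of polynomials over the sphere\<close>

abbreviation sphint :: "(real^'n::finite \<Rightarrow> 'b::{banach, second_countable_topology}) \<Rightarrow> 'b" where
  "sphint f \<equiv> integral\<^sup>L sphere_measure f"

lemma continuous_integrable_sphere:
  fixes f :: "real^'n \<Rightarrow> 'b::{banach, second_countable_topology}"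
  assumes f: "continuous_on UNIV f"
  shows "integrable sphere_measure f"
proof -
  have "bounded (f ` sphere 0 1)"
    by (intro compact_imp_bounded compact_continuous_image continuous_on_subset[OF f]) auto
  then obtain B where B: "\<And>x. x \<in> sphere 0 1 \<Longrightarrow> norm (f x) \<le> B"
    unfolding bounded_iff by blast
  show ?thesis
  proof (rule sph.integrable_const_bound)
    show "AE x in sphere_measure. norm (f x) \<le> B" using B by (intro AE_I2) auto
    show "f \<in> borel_measurable sphere_measure"
      by (intro borel_measurable_sphere_measure borel_measurable_continuous_onI f)
  qed
qed

lemma hpoly_integrable_sphere: "hpoly j f \<Longrightarrow> integrable sphere_measure f"
  by (intro continuous_integrable_sphere hpoly_continuous)

lemma AE_radial_pos: "AE r in radial_measure k. r > 0"
  unfolding radial_measure_def by (subst AE_density) (auto split: split_indicator)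

text \<open>The integral of \<open>r ^ l\<close> times the Gaussian profile against
  \<open>r ^ (d - 1)\<close>, that is, the ratio of Gaussian to spherical integral for polynomials
  of degree \<open>l\<close>. The closed form is the Gamma integral with exponent 2 and rate
  \<open>1 / 2\<close>.\<close>

definition gauss_radial :: "nat \<Rightarrow> nat \<Rightarrow> real" where
  "gauss_radial d l = (1 / sqrt (2 * pi)) ^ d * (Gamma ((real l + real d) / 2) / (2 * (1 / 2) powr ((real l + real d) / 2)))"

lemma gauss_radial_pos: "d > 0 \<Longrightarrow> gauss_radial d l > 0"
  by (auto simp: gauss_radial_def intro!: mult_pos_pos divide_pos_pos Gamma_real_pos)

text \<open>The functional equation of Gamma. The Laplacian lowers the degree by 2, so this ratio
  supplies the factor \<open>l + d - 2\<close> in \<open>sphint_lap\<close>.\<close>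

lemma gauss_radial_rec: "d > 0 \<Longrightarrow> gauss_radial d (l + 2) = (real l + real d) * gauss_radial d l"
proof -
  assume "d > 0"
  define e where "e = (real l + real d) / 2"
  have e: "e > 0" using \<open>d > 0\<close> by (simp add: e_def)
  have "(real (l + 2) + real d) / 2 = e + 1" by (simp add: e_def field_simps)
  moreover have "Gamma (e + 1) = e * Gamma e" using e by (intro Gamma_plus1) (auto dest: nonpos_Ints_nonpos)
  moreover have "(1 / 2 :: real) powr (e + 1) = (1 / 2) powr e / 2" by (simp add: powr_add)
  ultimately show ?thesis
    unfolding gauss_radial_def e_def[symmetric] by (simp only:) (simp add: e_def)
qed

lemma has_bochner_integral_radial_gauss:
  "has_bochner_integral (radial_measure k) (\<lambda>r. r ^ l * exp (- r\<^sup>2 / 2))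
     (Gamma ((real l + real (Suc k)) / 2) / (2 * (1 / 2) powr ((real l + real (Suc k)) / 2)))"
proof -
  have "has_bochner_integral (radial_measure k) (\<lambda>r. r powr real l * exp (- (1 / 2) * r powr 2))
     (Gamma ((real l + real k + 1) / 2) / (2 * (1 / 2) powr ((real l + real k + 1) / 2)))"
    by (rule has_bochner_integral_radial_powr_exp) auto
  moreover have "AE r in radial_measure k. r powr real l * exp (- (1 / 2) * r powr 2) = r ^ l * exp (- r\<^sup>2 / 2)"
    using AE_radial_pos by eventually_elim (simp add: powr_realpow)
  ultimately show ?thesis
    by (subst has_bochner_integral_cong_AE[where g="\<lambda>r. r powr real l * exp (- (1 / 2) * r powr 2)"]) (auto simp: add_ac)
qed

lemma
  fixes q :: "real^'n \<Rightarrow> complex"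
  assumes q: "hpoly l q"
  shows integrable_gauss_hpoly: "integrable lborel (\<lambda>x. gauss x *\<^sub>R q x)"
    and integral_gauss_hpoly: "integral\<^sup>L lborel (\<lambda>x. gauss x *\<^sub>R q x) = gauss_radial CARD('n) l *\<^sub>R sphint q"
proof -
  define h where "h r = (1 / sqrt (2 * pi)) ^ CARD('n) * (r ^ l * exp (- r\<^sup>2 / 2))" for r :: real
  have eq: "gauss x *\<^sub>R q x = h (norm x) *\<^sub>R q (dir x)" for x
  proof -
    have "q x = q (norm x *\<^sub>R dir x)" by simp
    also have "\<dots> = complex_of_real (norm x ^ l) * q (dir x)" by (rule hpoly_scaleR[OF q])
    finally show ?thesis by (simp add: gauss_eq h_def scaleR_conv_of_real)
  qed
  have S: "Suc (CARD('n) - 1) = CARD('n)" by simp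
  have hb: "has_bochner_integral (radial_measure (CARD('n) - 1)) h (gauss_radial CARD('n) l)"
    unfolding h_def gauss_radial_def
    by (intro has_bochner_integral_mult_right has_bochner_integral_radial_gauss[of "CARD('n) - 1" l, unfolded S])
  note h = hb[THEN integrable.intros] hb[THEN has_bochner_integral_integral_eq]
  show "integrable lborel (\<lambda>x. gauss x *\<^sub>R q x)"
    unfolding eq by (rule integral_polar_product(1)[OF h(1) hpoly_integrable_sphere[OF q]])
  show "integral\<^sup>L lborel (\<lambda>x. gauss x *\<^sub>R q x) = gauss_radial CARD('n) l *\<^sub>R sphint q"
    unfolding eq integral_polar_product(2)[OF h(1) hpoly_integrable_sphere[OF q]] h(2) ..
qed

lemma pd_monom: "pd i (monom \<beta>) = (\<lambda>x. of_nat (\<beta> i) * monom (\<beta>(i := \<beta> i - 1)) x)"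
proof (rule pdI)
  fix x :: "real^'a"
  let ?c = "\<Prod>k\<in>UNIV - {i}. complex_of_real ((x $ k) ^ \<beta> k)"
  have 1: "monom \<beta> (x + s *\<^sub>R axis i 1) = complex_of_real ((x $ i + s) ^ \<beta> i) * ?c" for s
    unfolding monom_def by (subst prod.remove[of UNIV i]) (auto simp: axis_def intro!: prod.cong)
  have 2: "monom (\<beta>(i := \<beta> i - 1)) x = complex_of_real ((x $ i) ^ (\<beta> i - 1)) * ?c"
    unfolding monom_def by (subst prod.remove[of UNIV i]) (auto intro!: prod.cong)
  have 3: "((\<lambda>s. (x $ i + s) ^ \<beta> i) has_real_derivative (of_nat (\<beta> i) * (x $ i) ^ (\<beta> i - 1))) (at 0)"
    by (auto intro!: derivative_eq_intros)
  have "((\<lambda>s. complex_of_real ((x $ i + s) ^ \<beta> i)) has_vector_derivative complex_of_real (of_nat (\<beta> i) * (x $ i) ^ (\<beta> i - 1))) (at 0)"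
    using 3 by (rule has_vector_derivative_of_real)
  from has_vector_derivative_mult_left[OF this, of ?c]
  show "((\<lambda>s. monom \<beta> (x + s *\<^sub>R axis i 1)) has_vector_derivative of_nat (\<beta> i) * monom (\<beta>(i := \<beta> i - 1)) x) (at 0)"
    unfolding 1 2 by (simp add: mult.assoc)
qed

lemma gauss_integral_cmult:
  fixes f :: "real^'n \<Rightarrow> complex"
  shows "integral\<^sup>L lborel (\<lambda>x. gauss x *\<^sub>R (c * f x)) = c * integral\<^sup>L lborel (\<lambda>x. gauss x *\<^sub>R f x)"
  by (simp only: mult_scaleR_right[symmetric] integral_mult_right_zero)

text \<open>On a monomial only the factor belonging to coordinate \<open>i\<close> changes, and
  there the identity is \<open>gauss_moment_rec\<close>.\<close>

lemma gauss_integral_pd: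
  "hpoly j q \<Longrightarrow> integral\<^sup>L lborel (\<lambda>x. gauss x *\<^sub>R pd i q x) = integral\<^sup>L lborel (\<lambda>x. gauss x *\<^sub>R (complex_of_real (x $ i) * q x))"
proof (induction rule: hpoly_monom_induct)
  case (monom \<beta> c)
  have pr: "(\<Prod>k\<in>UNIV. gauss_moment ((\<beta>(i := v)) k)) = gauss_moment v * (\<Prod>k\<in>UNIV - {i}. gauss_moment (\<beta> k))" for v
    by (subst prod.remove[of UNIV i]) (auto intro!: prod.cong)
  have "integral\<^sup>L lborel (\<lambda>x. gauss x *\<^sub>R pd i (\<lambda>x. c * monom \<beta> x) x)
      = integral\<^sup>L lborel (\<lambda>x. gauss x *\<^sub>R (c * of_nat (\<beta> i) * monom (\<beta>(i := \<beta> i - 1)) x))"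
    by (simp only: pd_cmult[OF hpoly_monom[OF monom]] pd_monom mult.assoc)
  also have "\<dots> = c * complex_of_real (real (\<beta> i) * gauss_moment (\<beta> i - 1) * (\<Prod>k\<in>UNIV - {i}. gauss_moment (\<beta> k)))"
    by (simp only: gauss_integral_cmult integral_gauss_monom pr of_real_mult of_real_of_nat_eq mult.assoc)
  also have "\<dots> = c * complex_of_real (\<Prod>k\<in>UNIV. gauss_moment ((\<beta>(i := Suc (\<beta> i))) k))"
    unfolding pr gauss_moment_rec ..
  also have "\<dots> = integral\<^sup>L lborel (\<lambda>x. gauss x *\<^sub>R (c * monom (\<beta>(i := Suc (\<beta> i))) x))"
    by (simp only: gauss_integral_cmult integral_gauss_monom)
  also have "\<dots> = integral\<^sup>L lborel (\<lambda>x. gauss x *\<^sub>R (complex_of_real (x $ i) * (c * monom \<beta> x)))"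
    by (simp only: coord_monom[symmetric] mult.left_commute)
  finally show ?case .
next
  case (add f g)
  have "integral\<^sup>L lborel (\<lambda>x. gauss x *\<^sub>R pd i (\<lambda>x. f x + g x) x) = integral\<^sup>L lborel (\<lambda>x. gauss x *\<^sub>R pd i f x) + integral\<^sup>L lborel (\<lambda>x. gauss x *\<^sub>R pd i g x)"
    unfolding pd_add[OF add(1,2)] scaleR_add_right
    by (intro Bochner_Integration.integral_add integrable_gauss_hpoly[OF hpoly_pd[OF add(1)]] integrable_gauss_hpoly[OF hpoly_pd[OF add(2)]])
  also have "\<dots> = integral\<^sup>L lborel (\<lambda>x. gauss x *\<^sub>R (complex_of_real (x $ i) * f x)) + integral\<^sup>L lborel (\<lambda>x. gauss x *\<^sub>R (complex_of_real (x $ i) * g x))"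
    by (simp add: add)
  also have "\<dots> = integral\<^sup>L lborel (\<lambda>x. gauss x *\<^sub>R (complex_of_real (x $ i) * (f x + g x)))"
    unfolding scaleR_add_right distrib_left
    by (intro Bochner_Integration.integral_add[symmetric] integrable_gauss_hpoly[OF hpoly_coord[OF add(1)]] integrable_gauss_hpoly[OF hpoly_coord[OF add(2)]])
  finally show ?case .
qed auto

text \<open>Apply Gaussian integration by parts twice and then Euler's identity.\<close>

lemma sphint_lap:
  fixes q :: "real^'n \<Rightarrow> complex"
  assumes q: "hpoly l q" and d: "CARD('n) \<ge> 2"
  shows "sphint (lap q) = of_real (real l * (real l + real CARD('n) - 2)) * sphint q"
proof -
  let ?E = "\<lambda>f. integral\<^sup>L lborel (\<lambda>x::real^'n. gauss x *\<^sub>R f x)"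
  have d0: "CARD('n) > 0" by simp
  have "?E (lap q) = (\<Sum>i\<in>UNIV. ?E (pd i (pd i q)))"
    unfolding lap_def[abs_def] scaleR_sum_right
    by (intro Bochner_Integration.integral_sum integrable_gauss_hpoly[OF hpoly_pd[OF hpoly_pd[OF q]]])
  also have "\<dots> = (\<Sum>i\<in>UNIV. ?E (\<lambda>x. complex_of_real (x $ i) * pd i q x))"
    by (simp only: gauss_integral_pd[OF hpoly_pd[OF q]])
  also have "\<dots> = ?E (\<lambda>x. \<Sum>i\<in>UNIV. complex_of_real (x $ i) * pd i q x)"
    unfolding scaleR_sum_right
    by (intro Bochner_Integration.integral_sum[symmetric] integrable_gauss_hpoly[OF hpoly_coord[OF hpoly_pd[OF q]]])
  also have "\<dots> = of_nat l * ?E q"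
    by (simp only: hpoly_euler[OF q] gauss_integral_cmult)
  finally have E: "?E (lap q) = of_nat l * ?E q" .
  \<comment> \<open>The degree \<open>l - 2\<close> of the Laplacian is truncated, so comparing
    radial factors makes sense from degree 2 on. In degrees 0 and 1 the Laplacian is zero, and in
    degree 1 the Gaussian identity forces the integral of \<open>q\<close> to vanish as
    well.\<close>
  consider "l = 0" | "l = 1" | m where "l = m + 2" by (metis One_nat_def add_2_eq_Suc' not0_implies_Suc)
  then show ?thesis
  proof cases
    case 1
    then have "lap q = (\<lambda>x. 0)" using q by (simp add: lap_def[abs_def] pd_hpoly_0)
    then show ?thesis by (simp add: 1)
  next
    case 2
    then have "hpoly 0 (pd i q)" for i using hpoly_pd[OF q, of i] by simp
    then have 0: "lap q = (\<lambda>x. 0)" by (simp add: lap_def[abs_def] pd_hpoly_0)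
    then have "?E q = 0" using E 2 by simp
    then have "sphint q = 0"
      using integral_gauss_hpoly[OF q] gauss_radial_pos[OF d0, of l] by simp
    then show ?thesis using 0 by simp
  next
    case 3
    have lq: "hpoly m (lap q)" using hpoly_lap[OF q] 3 by simp
    have "gauss_radial CARD('n) m *\<^sub>R sphint (lap q) = of_nat l * gauss_radial CARD('n) (m + 2) *\<^sub>R sphint q"
      using E integral_gauss_hpoly[OF q] integral_gauss_hpoly[OF lq] 3 by simp
    also have "\<dots> = gauss_radial CARD('n) m *\<^sub>R (of_real (real l * (real m + real CARD('n))) * sphint q)"
      unfolding gauss_radial_rec[OF d0] by (simp add: scaleR_conv_of_real mult_ac)
    finally show ?thesis using gauss_radial_pos[OF d0, of m] 3 by simp
  qed
qed

section \<open>The Funk--Hecke formula for powers\<close>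

text \<open>The eigenvalue of the kernel \<open>(x \<bullet> u) ^ n\<close> on spherical harmonics
  of degree \<open>j\<close> in dimension \<open>d\<close>. In particular
  \<open>fh_coeff d 0 0\<close> is the surface area
  \<open>2 * pi powr (d / 2) / Gamma (d / 2)\<close>.\<close>

definition fh_coeff :: "nat \<Rightarrow> nat \<Rightarrow> nat \<Rightarrow> real" where
  "fh_coeff d n j = (if j \<le> n \<and> even (n - j)
     then fact n * pi powr (real d / 2) * 2 / (2 ^ n * fact ((n - j) div 2) * Gamma ((real n + real j + real d) / 2))
     else 0)"

lemma Gamma_half_Suc: "x > 0 \<Longrightarrow> Gamma ((x + 2) / 2) = x / 2 * Gamma (x / 2 :: real)"
  using Gamma_plus1[of "x / 2"] nonpos_Ints_nonpos[of "x / 2"] by (auto simp: add_divide_distrib)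

lemma fh_coeff_step2:
  assumes "d > 0"
  shows "real (n + 2) * real (n + 1) * fh_coeff d n j = (real n + 2 - real j) * (real n + real j + real d) * fh_coeff d (n + 2) j"
proof (cases "j \<le> n \<and> even (n - j)")
  case True
  then obtain m where m: "n = j + 2 * m" by (metis dvdE le_add_diff_inverse)
  have G: "Gamma ((real (n + 2) + real j + real d) / 2) = (real n + real j + real d) / 2 * Gamma ((real n + real j + real d) / 2)"
    using Gamma_half_Suc[of "real n + real j + real d"] assms by (simp add: algebra_simps)
  have Gp: "Gamma ((real n + real j + real d) / 2) > 0" using assms by (intro Gamma_real_pos) auto
  have 1: "fh_coeff d (n + 2) j = real (n + 2) * real (n + 1) * fact n * pi powr (real d / 2) * 2
      / (4 * 2 ^ n * (real (m + 1) * fact m) * ((real n + real j + real d) / 2 * Gamma ((real n + real j + real d) / 2)))"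
    unfolding fh_coeff_def G using m by (simp add: algebra_simps)
  have 2: "fh_coeff d n j = fact n * pi powr (real d / 2) * 2 / (2 ^ n * fact m * Gamma ((real n + real j + real d) / 2))"
    unfolding fh_coeff_def using m by simp
  have "a * b * (F * P * 2 / (T * M * G)) = (2 * m1) * e * (a * b * F * P * 2 / (4 * T * (m1 * M) * (e / 2 * G)))"
    if "m1 > 0" "e > 0" "G > 0" "T > 0" "M > 0" for a b F P T M G m1 e :: real
    using that by (simp add: field_simps)
  from this[of "real (m + 1)" "real n + real j + real d" "Gamma ((real n + real j + real d) / 2)" "2 ^ n" "fact m"
      "real (n + 2)" "real (n + 1)" "fact n" "pi powr (real d / 2)"]
  have "real (n + 2) * real (n + 1) * fh_coeff d n j = (2 * real (m + 1)) * (real n + real j + real d) * fh_coeff d (n + 2) j"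
    unfolding 1 2 using Gp assms by simp
  also have "2 * real (m + 1) = real n + 2 - real j" by (simp add: m)
  finally show ?thesis .
next
  case False
  then have 1: "fh_coeff d n j = 0" by (auto simp: fh_coeff_def)
  have 2: "real n + 2 - real j = 0 \<or> fh_coeff d (n + 2) j = 0"
  proof (cases "j = n + 2")
    case False
    have "\<not> (j \<le> n + 2 \<and> even (n + 2 - j))"
    proof
      assume h: "j \<le> n + 2 \<and> even (n + 2 - j)"
      then have "j \<noteq> n + 1" by auto
      then have "j \<le> n" using h False by auto
      then show False using h \<open>\<not> (j \<le> n \<and> even (n - j))\<close> by (simp add: Suc_diff_le)
    qed
    then show ?thesis by (auto simp: fh_coeff_def)
  qed simp
  show ?thesis using 1 2 by auto
qed

lemma fh_coeff_step1:
  assumes "d > 0"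
  shows "(real n + real j + real d) * fh_coeff d (Suc n) (Suc j) = real (Suc n) * fh_coeff d n j"
proof (cases "j \<le> n \<and> even (n - j)")
  case True
  have G: "Gamma ((real (Suc n) + real (Suc j) + real d) / 2) = (real n + real j + real d) / 2 * Gamma ((real n + real j + real d) / 2)"
    using Gamma_half_Suc[of "real n + real j + real d"] assms by (simp add: algebra_simps)
  have Gp: "Gamma ((real n + real j + real d) / 2) > 0" using assms by (intro Gamma_real_pos) auto
  have "e * (s * F * P * 2 / (2 * T * M * (e / 2 * G))) = s * (F * P * 2 / (T * M * G))"
    if "e > 0" "G > 0" "T > 0" "M > 0" for F P T M G s e :: real
    using that by (simp add: field_simps)
  from this[of "real n + real j + real d" "Gamma ((real n + real j + real d) / 2)" "2 ^ n" "fact ((n - j) div 2)" "real (Suc n)" "fact n" "pi powr (real d / 2)"]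
  show ?thesis unfolding fh_coeff_def G using True Gp assms by (simp del: of_nat_Suc)
qed (auto simp: fh_coeff_def)

text \<open>The same factors appear when the Laplacian acts on \<open>(e \<bullet> u) ^ n\<close>
  times a harmonic and on \<open>norm_sq ^ m\<close> times a harmonic of degree
  \<open>j = n - 2 * m\<close>; this is why the decomposition of moments closes up. For
  \<open>n < 2\<close> both sides vanish, so truncation is harmless.\<close>

lemma fh_coeff_down2:
  assumes "d > 0"
  shows "real n * (real n - 1) * fh_coeff d (n - 2) j = (real n - real j) * (real n + real j + real d - 2) * fh_coeff d n j"
proof -
  consider "n = 0" | "n = 1" | m where "n = m + 2" by (metis One_nat_def add_2_eq_Suc' not0_implies_Suc)
  then show ?thesis
  proof cases
    case 3
    have "real n - 1 = real (m + 1)" "real n - real j = real m + 2 - real j"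
      "real n + real j + real d - 2 = real m + real j + real d" using 3 by auto
    then show ?thesis using fh_coeff_step2[OF assms, of m j] 3 by (simp only: diff_add_inverse2)
  qed (auto simp: fh_coeff_def le_Suc_eq)
qed

lemma fh_coeff_down1:
  assumes "d > 0"
  shows "real n * real j * fh_coeff d (n - 1) (j - 1) = real j * (real n + real j + real d - 2) * fh_coeff d n j"
proof (cases n; cases j)
  fix n' j' assume "n = Suc n'" "j = Suc j'"
  then have "real n * fh_coeff d (n - 1) (j - 1) = (real n + real j + real d - 2) * fh_coeff d n j"
    using fh_coeff_step1[OF assms, of n' j'] by (simp add: algebra_simps)
  then show ?thesis by (metis mult.assoc mult.commute)
qed (auto simp: fh_coeff_def)

lemma fh_coeff_diag_pos: "d > 0 \<Longrightarrow> fh_coeff d n n > 0"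
  by (auto simp: fh_coeff_def intro!: divide_pos_pos mult_pos_pos Gamma_real_pos)

text \<open>Recovering a harmonic from its own moment divides by \<open>fh_coeff d j j\<close>; this
  bounds the loss. Consecutive diagonal values have ratio \<open>(j + 1) / (2 * j + d)\<close>,
  which is at least \<open>1 / d\<close> once \<open>d \<ge> 2\<close>.\<close>

lemma fh_coeff_diag_ge:
  assumes "d \<ge> 2"
  shows "fh_coeff d 0 0 \<le> real d ^ j * fh_coeff d j j"
proof (induction j)
  case (Suc j)
  have d: "d > 0" using assms by simp
  have "real (Suc j) * fh_coeff d 0 0 \<le> real d ^ j * (real (Suc j) * fh_coeff d j j)"
    using Suc mult_left_mono[OF Suc, of "real (Suc j)"] by (simp add: mult_ac)
  also have "\<dots> = real d ^ j * ((real j + real j + real d) * fh_coeff d (Suc j) (Suc j))"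
    using fh_coeff_step1[OF d, of j j] by simp
  also have "\<dots> \<le> real d ^ j * ((real d * real (Suc j)) * fh_coeff d (Suc j) (Suc j))"
  proof -
    have "real j + real j + real d \<le> real d * real (Suc j)"
      using mult_right_mono[of 2 "real d" "real j"] assms by (simp add: algebra_simps)
    then show ?thesis using fh_coeff_diag_pos[OF d, of "Suc j"]
      by (intro mult_left_mono mult_right_mono) auto
  qed
  also have "\<dots> = real (Suc j) * (real d ^ Suc j * fh_coeff d (Suc j) (Suc j))" by (simp add: mult_ac)
  finally show ?case by (subst (asm) mult_le_cancel_left_pos) auto
qed simp

text \<open>The total Gaussian mass is 1, so the surface area is the reciprocal of
  \<open>gauss_radial d 0\<close>.\<close>

lemma sphint_const:
  fixes c :: complex
  shows "(sphint (\<lambda>u::real^'n. c)) = complex_of_real (fh_coeff CARD('n) 0 0) * c"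
proof -
  have "integral\<^sup>L lborel (\<lambda>x::real^'n. gauss x *\<^sub>R (1::complex)) = 1"
    using integral_gauss[where 'n='n] by (simp add: scaleR_conv_of_real)
  then have "gauss_radial CARD('n) 0 *\<^sub>R sphint (\<lambda>u::real^'n. 1::complex) = 1"
    using integral_gauss_hpoly[OF hpoly_const[of 1]] by metis
  moreover have "gauss_radial CARD('n) 0 * fh_coeff CARD('n) 0 0 = 1"
  proof -
    define d where "d = real CARD('n)"
    have "(1 / sqrt (2 * pi)) ^ CARD('n) = 1 / ((2 * pi) powr (1/2)) powr d"
      by (simp add: d_def powr_realpow power_one_over powr_half_sqrt)
    also have "\<dots> = 1 / ((2 powr (d / 2)) * (pi powr (d / 2)))"
      by (simp add: powr_powr powr_mult)
    finally have 1: "(1 / sqrt (2 * pi)) ^ CARD('n) = 1 / ((2 powr (d / 2)) * (pi powr (d / 2)))" .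
    have 2: "(1 / 2) powr (d / 2) = 1 / 2 powr (d / 2)" by (simp add: powr_divide)
    have "Gamma (d / 2) > 0" by (intro Gamma_real_pos) (simp add: d_def)
    then show ?thesis
      unfolding gauss_radial_def fh_coeff_def 1 d_def[symmetric] by (simp add: 2)
  qed
  ultimately have "sphint (\<lambda>u::real^'n. 1::complex) = complex_of_real (fh_coeff CARD('n) 0 0)"
  proof -
    assume a: "gauss_radial CARD('n) 0 *\<^sub>R sphint (\<lambda>u::real^'n. 1::complex) = 1"
      and b: "gauss_radial CARD('n) 0 * fh_coeff CARD('n) 0 0 = 1"
    have "sphint (\<lambda>u::real^'n. 1::complex) = (fh_coeff CARD('n) 0 0 * gauss_radial CARD('n) 0) *\<^sub>R sphint (\<lambda>u::real^'n. 1)"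
      using b by (simp only: mult.commute scaleR_one)
    also have "\<dots> = fh_coeff CARD('n) 0 0 *\<^sub>R 1"
      unfolding scaleR_scaleR[symmetric] a ..
    finally show ?thesis by (simp only: of_real_def)
  qed
  moreover have "sphint (\<lambda>u::real^'n. c) = c * sphint (\<lambda>u::real^'n. 1)"
    by (subst integral_mult_right_zero[symmetric]) simp
  ultimately show ?thesis by simp
qed

lemma measure_sphere: "measure sphere_measure (sphere (0::real^'n) 1) = fh_coeff CARD('n) 0 0"
proof -
  have "complex_of_real (measure sphere_measure (sphere (0::real^'n) 1)) = complex_of_real (fh_coeff CARD('n) 0 0)"
    using sphint_const[of 1, where 'n='n] by (simp add: scaleR_conv_of_real)
  then show ?thesis by (simp only: of_real_eq_iff)
qed

text \<open>Put \<open>N = n + j\<close> and let \<open>q\<close> be the integrand. By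
  \<open>sphint_lap\<close> the integral of \<open>lap q\<close> is \<open>N * (N + d - 2)\<close>
  times the unknown. Since \<open>p\<close> is harmonic, \<open>lap q\<close> has two terms only:
  one with \<open>n\<close> lowered by 2, and one with both \<open>n\<close> and \<open>j\<close>
  lowered by 1. The induction on \<open>n + j\<close> evaluates both, and their coefficients combine
  through \<open>(n - j) + 2 * j = N\<close>.\<close>

theorem funk_hecke_power:
  fixes p :: "real^'n \<Rightarrow> complex"
  assumes d: "CARD('n) \<ge> 2" and p: "hpoly j p" "lap p = (\<lambda>x. 0)"
  shows "sphint (\<lambda>u. complex_of_real (e \<bullet> u) ^ n * p u) = complex_of_real (fh_coeff CARD('n) n j * norm e ^ (n - j)) * p e"
  using p
proof (induction "n + j" arbitrary: n j p rule: less_induct)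
  case less
  note p = less.prems
  let ?d = "CARD('n)"
  have d0: "?d > 0" by simp
  \<comment> \<open>The derivative of \<open>p\<close> in direction \<open>e\<close> is again
    harmonic, of degree \<open>j - 1\<close>, and Euler's identity gives its value at
    \<open>e\<close> as \<open>j * p e\<close>.\<close>
  define De where "De u = (\<Sum>i\<in>UNIV. complex_of_real (e $ i) * pd i p u)" for u
  have De: "hpoly (j - 1) De" unfolding De_def[abs_def]
    by (intro hpoly_sum hpoly_cmult hpoly_pd p)
  have lapDe: "lap De = (\<lambda>x. 0)"
  proof -
    have "lap De = (\<lambda>x. \<Sum>i\<in>UNIV. lap (\<lambda>u. complex_of_real (e $ i) * pd i p u) x)"
      unfolding De_def[abs_def] by (rule lap_sum[where j="j - 1"]) (intro hpoly_cmult hpoly_pd p)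
    then show ?thesis by (simp add: lap_cmult[OF hpoly_pd[OF p(1)]] lap_pd[OF p(1)] p(2))
  qed
  have Dee: "De e = of_nat j * p e" unfolding De_def by (rule hpoly_euler[OF p(1)])
  note ip = hpoly_inner_power[of _ e]
  have pdi: "pd i (\<lambda>u. complex_of_real (e \<bullet> u) ^ n) = (\<lambda>u. of_nat n * complex_of_real (e $ i) * complex_of_real (e \<bullet> u) ^ (n - 1))" for n i
    unfolding pd_power[OF hpoly_inner] pd_inner by (simp add: mult_ac)
  have lapi: "lap (\<lambda>u. complex_of_real (e \<bullet> u) ^ n) = (\<lambda>u. of_nat n * of_nat (n - 1) * complex_of_real ((norm e)\<^sup>2) * complex_of_real (e \<bullet> u) ^ (n - 2))"
  proof -
    have "(norm e)\<^sup>2 = (\<Sum>k\<in>UNIV. e $ k * e $ k)" unfolding power2_norm_eq_inner inner_vec_def by simp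
    then have ne: "complex_of_real ((norm e)\<^sup>2) = (\<Sum>k\<in>UNIV. complex_of_real (e $ k) * complex_of_real (e $ k))" by simp
    have "pd i (pd i (\<lambda>u. complex_of_real (e \<bullet> u) ^ n)) = (\<lambda>u. (complex_of_real (e $ i) * complex_of_real (e $ i)) * (of_nat n * of_nat (n - 1) * complex_of_real (e \<bullet> u) ^ (n - 2)))" for i
      unfolding pdi pd_cmult[OF ip] by (simp add: fun_eq_iff numeral_2_eq_2)
    then show ?thesis unfolding lap_def[abs_def] ne by (simp add: sum_distrib_left sum_distrib_right mult_ac)
  qed
  define q where "q u = complex_of_real (e \<bullet> u) ^ n * p u" for u
  have q: "hpoly (n + j) q" unfolding q_def[abs_def] by (rule hpoly_mult[OF ip p(1)])
  have lapq: "lap q = (\<lambda>u. of_nat n * of_nat (n - 1) * complex_of_real ((norm e)\<^sup>2) * (complex_of_real (e \<bullet> u) ^ (n - 2) * p u)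
      + 2 * of_nat n * (complex_of_real (e \<bullet> u) ^ (n - 1) * De u))"
    unfolding q_def[abs_def] lap_mult[OF ip p(1)] lapi p(2) pdi De_def
    by (simp add: fun_eq_iff sum_distrib_left mult_ac)
  have i1: "integrable sphere_measure (\<lambda>u. complex_of_real (e \<bullet> u) ^ (n - 2) * p u)"
    by (rule hpoly_integrable_sphere[OF hpoly_mult[OF ip p(1)]])
  have i2: "integrable sphere_measure (\<lambda>u. complex_of_real (e \<bullet> u) ^ (n - 1) * De u)"
    by (rule hpoly_integrable_sphere[OF hpoly_mult[OF ip De]])
  show ?case
  proof (cases "n + j = 0")
    case True
    then obtain c where "p = (\<lambda>x. c)" using hpoly_0_const[OF p(1)] by auto
    then show ?thesis using True sphint_const[of c, where 'n='n] by simp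
  next
    case False
    let ?N = "real n + real j" and ?D = "real ?d"
    have "of_real (?N * (?N + ?D - 2)) * sphint q = sphint (lap q)"
      using sphint_lap[OF q d] by simp
    also have "\<dots> = of_nat n * of_nat (n - 1) * complex_of_real ((norm e)\<^sup>2) * sphint (\<lambda>u. complex_of_real (e \<bullet> u) ^ (n - 2) * p u)
        + 2 * of_nat n * sphint (\<lambda>u. complex_of_real (e \<bullet> u) ^ (n - 1) * De u)"
      unfolding lapq using i1 i2 by simp
    also have "of_nat n * of_nat (n - 1) * complex_of_real ((norm e)\<^sup>2) * sphint (\<lambda>u. complex_of_real (e \<bullet> u) ^ (n - 2) * p u)
      = complex_of_real ((real n - real j) * (?N + ?D - 2) * fh_coeff ?d n j * norm e ^ (n - j)) * p e"
    proof (cases "n \<ge> 2")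
      case True
      have "sphint (\<lambda>u. complex_of_real (e \<bullet> u) ^ (n - 2) * p u) = complex_of_real (fh_coeff ?d (n - 2) j * norm e ^ (n - 2 - j)) * p e"
        using True p by (intro less.hyps) auto
      moreover have "real n * (real n - 1) * (norm e)\<^sup>2 * (fh_coeff ?d (n - 2) j * norm e ^ (n - 2 - j)) =
          (real n - real j) * (?N + ?D - 2) * fh_coeff ?d n j * norm e ^ (n - j)"
      proof (cases "j \<le> n - 2")
        case True
        then have "n - j = 2 + (n - 2 - j)" using \<open>n \<ge> 2\<close> by simp
        then have "norm e ^ (n - j) = (norm e)\<^sup>2 * norm e ^ (n - 2 - j)"
          by (simp only: power_add)
        then have "real n * (real n - 1) * (norm e)\<^sup>2 * (fh_coeff ?d (n - 2) j * norm e ^ (n - 2 - j))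
            = real n * (real n - 1) * fh_coeff ?d (n - 2) j * norm e ^ (n - j)" by simp
        then show ?thesis unfolding fh_coeff_down2[OF d0, of n j] .
      next
        case False
        \<comment> \<open>Here \<open>n - 2 - j\<close> may be truncated and the powers of
          \<open>norm e\<close> need not match; the recursion shows that both sides are 0.\<close>
        then have "fh_coeff ?d (n - 2) j = 0" by (simp add: fh_coeff_def)
        then show ?thesis using fh_coeff_down2[OF d0, of n j] by simp
      qed
      moreover have "of_nat n * of_nat (n - 1) * complex_of_real ((norm e)\<^sup>2) * (complex_of_real A * c)
          = complex_of_real (real n * (real n - 1) * (norm e)\<^sup>2 * A) * c" for A c
        using True by (simp add: of_nat_diff)
      ultimately show ?thesis by (simp only:)
    next
      case False
      then have "n = 0 \<or> n = 1" by auto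
      then have "real n * (real n - 1) = 0" by auto
      then have z: "(real n - real j) * (?N + ?D - 2) * fh_coeff ?d n j = 0"
        unfolding fh_coeff_down2[OF d0, of n j, symmetric] by simp
      show ?thesis unfolding z using \<open>n = 0 \<or> n = 1\<close> by auto
    qed
    also have "2 * of_nat n * sphint (\<lambda>u. complex_of_real (e \<bullet> u) ^ (n - 1) * De u)
      = complex_of_real (2 * real j * (?N + ?D - 2) * fh_coeff ?d n j * norm e ^ (n - j)) * p e"
    proof (cases "n = 0 \<or> j = 0")
      case True
      then show ?thesis
      proof
        assume "j = 0"
        then have "De = (\<lambda>u. 0)" using p(1) by (simp add: De_def[abs_def] pd_hpoly_0)
        then show ?thesis using \<open>j = 0\<close> by simp
      qed (use False in \<open>simp add: fh_coeff_def\<close>)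
    next
      case nj: False
      have "sphint (\<lambda>u. complex_of_real (e \<bullet> u) ^ (n - 1) * De u)
          = complex_of_real (fh_coeff ?d (n - 1) (j - 1) * norm e ^ (n - 1 - (j - 1))) * De e"
        using nj De lapDe by (intro less.hyps) auto
      moreover have "n - 1 - (j - 1) = n - j" using nj by auto
      moreover have "2 * real n * (fh_coeff ?d (n - 1) (j - 1) * norm e ^ (n - j)) * real j
         = 2 * real j * (?N + ?D - 2) * fh_coeff ?d n j * norm e ^ (n - j)"
      proof -
        have "2 * real n * (fh_coeff ?d (n - 1) (j - 1) * norm e ^ (n - j)) * real j
          = 2 * (real n * real j * fh_coeff ?d (n - 1) (j - 1)) * norm e ^ (n - j)" by simp
        then show ?thesis unfolding fh_coeff_down1[OF d0, of n j] by simp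
      qed
      moreover have "2 * of_nat n * (complex_of_real A * (of_nat j * c)) = complex_of_real (2 * real n * A * real j) * c" for A c
        by simp
      ultimately show ?thesis unfolding Dee by (simp only:)
    qed
    also have "complex_of_real ((real n - real j) * (?N + ?D - 2) * fh_coeff ?d n j * norm e ^ (n - j)) * p e
       + complex_of_real (2 * real j * (?N + ?D - 2) * fh_coeff ?d n j * norm e ^ (n - j)) * p e
      = complex_of_real (?N * (?N + ?D - 2)) * (complex_of_real (fh_coeff ?d n j * norm e ^ (n - j)) * p e)"
      unfolding mult.assoc[symmetric] of_real_mult[symmetric] distrib_right[symmetric] of_real_add[symmetric]
      by (simp add: algebra_simps)
    finally have "complex_of_real (?N * (?N + ?D - 2)) * sphint q =
       complex_of_real (?N * (?N + ?D - 2)) * (complex_of_real (fh_coeff ?d n j * norm e ^ (n - j)) * p e)" .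
    \<comment> \<open>Positivity of this factor, from \<open>N \<ge> 1\<close> and
      \<open>d \<ge> 2\<close>, is what allows the unknown integral to be isolated.\<close>
    moreover have "?N * (?N + ?D - 2) > 0"
    proof -
      have "?N \<ge> 1" using False by (metis One_nat_def Suc_leI neq0_conv of_nat_1 of_nat_add of_nat_le_iff)
      moreover have "?D \<ge> 2" using d by simp
      ultimately show ?thesis by (intro mult_pos_pos) linarith+
    qed
    ultimately have "sphint q = complex_of_real (fh_coeff ?d n j * norm e ^ (n - j)) * p e"
      by (metis mult_cancel_left of_real_eq_0_iff less_irrefl)
    then show ?thesis by (simp add: q_def[abs_def])
  qed
qed

section \<open>Projection onto spherical harmonics\<close>

text \<open>For harmonic factors the Laplacian of \<open>p * q\<close> is twice the sum of the
  products of partial derivatives, which are harmonic with both degrees lowered by 1. By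
  \<open>sphint_lap\<close> the claim is inherited from them, until one factor is constant. The
  pairing is bilinear; conjugation enters through \<open>harm_cnj\<close>.\<close>

lemma sphint_harmonic_orthogonal:
  fixes p q :: "real^'n \<Rightarrow> complex"
  assumes d: "CARD('n) \<ge> 2"
    and "hpoly j p" "lap p = (\<lambda>x. 0)" "hpoly l q" "lap q = (\<lambda>x. 0)" "j \<noteq> l"
  shows "sphint (\<lambda>u. p u * q u) = 0"
  using assms(2-)
proof (induction j arbitrary: l p q)
  have step: "sphint (\<lambda>u. p u * q u) = 0"
    if p: "hpoly j p" "lap p = (\<lambda>x. 0)" and q: "hpoly l q" "lap q = (\<lambda>x. 0)" and jl: "j \<noteq> l"
      and z: "\<And>i. sphint (\<lambda>u. pd i p u * pd i q u) = 0" for j l and p q :: "real^'n \<Rightarrow> complex"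
  proof -
    have "sphint (lap (\<lambda>u. p u * q u)) = sphint (\<lambda>u. 2 * (\<Sum>i\<in>UNIV. pd i p u * pd i q u))"
      by (simp add: lap_mult[OF p(1) q(1)] p(2) q(2))
    also have "\<dots> = 2 * (\<Sum>i\<in>UNIV. sphint (\<lambda>u. pd i p u * pd i q u))"
      by (subst integral_mult_right_zero, subst Bochner_Integration.integral_sum)
         (auto intro!: hpoly_integrable_sphere[OF hpoly_mult[OF hpoly_pd[OF p(1)] hpoly_pd[OF q(1)]]])
    finally have "of_real (real (j + l) * (real (j + l) + real CARD('n) - 2)) * sphint (\<lambda>u. p u * q u) = 0"
      using sphint_lap[OF hpoly_mult[OF p(1) q(1)] d] z by simp
    moreover have "real (j + l) * (real (j + l) + real CARD('n) - 2) > 0"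
    proof -
      have "real (j + l) \<ge> 1" using jl by linarith
      moreover have "real CARD('n) \<ge> 2" using d by simp
      ultimately show ?thesis by (intro mult_pos_pos) linarith+
    qed
    ultimately show ?thesis by (metis mult_eq_0_iff of_real_eq_0_iff less_irrefl)
  qed
  {
    case 0
    then show ?case by (intro step[of 0 p l q]) (auto simp: pd_hpoly_0)
  next
    case (Suc j)
    show ?case
    proof (cases l)
      case 0
      then show ?thesis using Suc.prems by (intro step[of "Suc j" p l q]) (auto simp: pd_hpoly_0)
    next
      case l: (Suc l')
      show ?thesis
      proof (rule step)
        fix i
        show "sphint (\<lambda>u. pd i p u * pd i q u) = 0"
          using Suc.prems l by (intro Suc.IH[of _ l'])
            (auto simp: lap_pd[OF Suc.prems(1)] lap_pd[OF Suc.prems(3)] intro: hpoly_pd_Suc)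
      qed (use Suc.prems in auto)
    qed
  }
qed

lemma continuous_AE_zero_imp_zero:
  fixes f :: "'a::euclidean_space \<Rightarrow> 'b::real_normed_vector"
  assumes f: "continuous_on UNIV f" and ae: "AE x in lborel. f x = 0"
  shows "f x = 0"
proof -
  have op: "open {x. f x \<noteq> 0}"
    using f by (intro open_Collect_neq) auto
  have "{x. f x \<noteq> 0} \<in> null_sets lborel"
    using ae op by (subst (asm) AE_iff_null) auto
  then have "negligible {x. f x \<noteq> 0}"
    using null_sets_completionI negligible_iff_null_sets by blast
  then have "{x. f x \<noteq> 0} = {}" using op open_not_negligible by blast
  then show ?thesis by blast
qed

text \<open>The Gaussian weight turns the sphere integral into an integral over all of space, where
  a continuous function that vanishes almost everywhere vanishes.\<close>

lemma hpoly_sphint_norm_zero: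
  fixes h :: "real^'n \<Rightarrow> complex"
  assumes h: "hpoly j h" and z: "sphint (\<lambda>u. h u * cnj (h u)) = 0"
  shows "h = (\<lambda>x. 0)"
proof -
  note hh = hpoly_mult[OF h hpoly_cnj[OF h]]
  have eq: "gauss x *\<^sub>R (h x * cnj (h x)) = complex_of_real (gauss x * (cmod (h x))\<^sup>2)" for x
    by (simp only: scaleR_conv_of_real of_real_mult complex_norm_square)
  have i: "integrable lborel (\<lambda>x. complex_of_real (gauss x * (cmod (h x))\<^sup>2))"
    using integrable_gauss_hpoly[OF hh] unfolding eq .
  then have i': "integrable lborel (\<lambda>x. gauss x * (cmod (h x))\<^sup>2)"
    by (rule complex_of_real_integrable_eq[THEN iffD1])
  have "integral\<^sup>L lborel (\<lambda>x. complex_of_real (gauss x * (cmod (h x))\<^sup>2)) = 0"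
    using integral_gauss_hpoly[OF hh] z unfolding eq by simp
  then have "integral\<^sup>L lborel (\<lambda>x. gauss x * (cmod (h x))\<^sup>2) = 0"
    by (simp only: integral_complex_of_real of_real_eq_0_iff)
  then have "AE x in lborel. gauss x * (cmod (h x))\<^sup>2 = 0"
    using integral_nonneg_eq_0_iff_AE[OF i'] by simp
  then have "AE x in lborel. h x = 0"
    by eventually_elim (use gauss_pos in \<open>auto simp: less_le\<close>)
  then show ?thesis using continuous_AE_zero_imp_zero[OF hpoly_continuous[OF h]] by blast
qed

lemma harm_cnj: "p \<in> harm j \<Longrightarrow> (\<lambda>x. cnj (p x)) \<in> harm j"
  by (auto simp: harm_iff hpoly_cnj lap_cnj)

text \<open>This resolves the definite description: the difference of two candidates lies in
  \<open>harm j\<close> and is orthogonal to itself.\<close>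

lemma sh_proj_eqI:
  fixes f :: "real^'n \<Rightarrow> complex"
  assumes f: "continuous_on UNIV f" and p: "p \<in> harm j"
    and orth: "\<And>q. q \<in> harm j \<Longrightarrow> sphint (\<lambda>u. (f u - p u) * cnj (q u)) = 0"
  shows "sh_proj j f = p"
  unfolding sh_proj_def
proof (rule the_equality)
  show "p \<in> harm j \<and> (\<forall>q\<in>harm j. sphint (\<lambda>u. (f u - p u) * cnj (q u)) = 0)" using p orth by blast
next
  fix h assume h: "h \<in> harm j \<and> (\<forall>q\<in>harm j. sphint (\<lambda>u. (f u - h u) * cnj (q u)) = 0)"
  define r where "r x = h x - p x" for x
  have hp: "hpoly j h" "hpoly j p" "lap h = (\<lambda>x. 0)" "lap p = (\<lambda>x. 0)" using h p by (auto simp: harm_iff)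
  have r: "r \<in> harm j"
    unfolding harm_iff r_def[abs_def] using hp by (auto intro: hpoly_diff simp: lap_diff[OF hp(1,2)])
  then have rp: "hpoly j r" by (simp add: harm_iff)
  have c: "continuous_on UNIV (\<lambda>u. (f u - g u) * cnj (r u))" if "hpoly j g" for g
    by (intro continuous_intros f hpoly_continuous[OF rp] hpoly_continuous[OF that])
  have "sphint (\<lambda>u. r u * cnj (r u)) = sphint (\<lambda>u. (f u - p u) * cnj (r u) - (f u - h u) * cnj (r u))"
    by (simp add: r_def algebra_simps)
  also have "\<dots> = sphint (\<lambda>u. (f u - p u) * cnj (r u)) - sphint (\<lambda>u. (f u - h u) * cnj (r u))"
    by (intro Bochner_Integration.integral_diff continuous_integrable_sphere c hp)
  also have "\<dots> = 0" using h orth r by simp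
  finally have "r = (\<lambda>x. 0)" by (rule hpoly_sphint_norm_zero[OF rp])
  then show "h = p" by (simp add: r_def[abs_def] fun_eq_iff)
qed

section \<open>Spherical moments as homogeneous polynomials\<close>

definition power_transform :: "(real^'n::finite \<Rightarrow> complex) \<Rightarrow> nat \<Rightarrow> real^'n \<Rightarrow> complex" where
  "power_transform f n x = sphint (\<lambda>u. complex_of_real (x \<bullet> u) ^ n * f u)"

lemma continuous_coord_mult:
  "continuous_on UNIV f \<Longrightarrow> continuous_on UNIV (\<lambda>u::real^'n. complex_of_real (u $ i) * f u)"
  by (intro continuous_intros)

text \<open>Splitting off one factor \<open>x \<bullet> u\<close> leads to moments of the coordinate
  multiples of \<open>f\<close>. With \<open>f\<close> generalised, induction on \<open>n\<close>
  then gives polynomiality and all derivatives, without differentiating under the integral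
  sign.\<close>

lemma power_transform_Suc:
  fixes f :: "real^'n \<Rightarrow> complex"
  assumes f: "continuous_on UNIV f"
  shows "power_transform f (Suc n) x = (\<Sum>i\<in>UNIV. complex_of_real (x $ i) * power_transform (\<lambda>u. complex_of_real (u $ i) * f u) n x)"
proof -
  have eq: "complex_of_real (x \<bullet> u) ^ Suc n * f u =
      (\<Sum>i\<in>UNIV. complex_of_real (x $ i) * (complex_of_real (x \<bullet> u) ^ n * (complex_of_real (u $ i) * f u)))" for u
  proof -
    have "complex_of_real (x \<bullet> u) = (\<Sum>i\<in>UNIV. complex_of_real (x $ i) * complex_of_real (u $ i))"
      by (simp add: inner_vec_def)
    then have "complex_of_real (x \<bullet> u) * (complex_of_real (x \<bullet> u) ^ n * f u)
        = (\<Sum>i\<in>UNIV. complex_of_real (x $ i) * complex_of_real (u $ i)) * (complex_of_real (x \<bullet> u) ^ n * f u)"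
      by (simp only:)
    also have "\<dots> = (\<Sum>i\<in>UNIV. complex_of_real (x $ i) * (complex_of_real (x \<bullet> u) ^ n * (complex_of_real (u $ i) * f u)))"
      unfolding sum_distrib_right by (intro sum.cong) (simp_all add: mult_ac)
    finally show ?thesis by (simp only: power_Suc mult.assoc)
  qed
  have i: "integrable sphere_measure (\<lambda>u. complex_of_real (x $ i) * (complex_of_real (x \<bullet> u) ^ n * (complex_of_real (u $ i) * f u)))" for i
    by (intro continuous_integrable_sphere continuous_intros f)
  show ?thesis
    unfolding power_transform_def eq by (subst Bochner_Integration.integral_sum[OF i]) simp
qed

lemma power_transform_0: "power_transform f 0 = (\<lambda>x. sphint f)"
  by (simp add: power_transform_def fun_eq_iff)

lemma hpoly_power_transform: "continuous_on UNIV f \<Longrightarrow> hpoly n (power_transform f n)"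
proof (induction n arbitrary: f)
  case 0
  then show ?case by (simp add: power_transform_0 hpoly_const)
next
  case (Suc n)
  show ?case unfolding power_transform_Suc[OF Suc.prems, abs_def]
    by (intro hpoly_sum hpoly_coord Suc.IH continuous_coord_mult Suc.prems)
qed

lemma pd_power_transform:
  "continuous_on UNIV f \<Longrightarrow> pd i (power_transform f n) = (\<lambda>x. of_nat n * power_transform (\<lambda>u. complex_of_real (u $ i) * f u) (n - 1) x)"
proof (induction n arbitrary: f)
  case 0
  then show ?case by (simp add: power_transform_0)
next
  case (Suc n)
  note f = Suc.prems
  let ?m = "\<lambda>k f. \<lambda>u::real^'a. complex_of_real (u $ k) * f u"
  note fk = continuous_coord_mult[OF f]
  have h: "hpoly (Suc n) (\<lambda>x. complex_of_real (x $ k) * power_transform (?m k f) n x)" for k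
    by (intro hpoly_coord hpoly_power_transform fk)
  have "pd i (power_transform f (Suc n)) = pd i (\<lambda>x. \<Sum>k\<in>UNIV. complex_of_real (x $ k) * power_transform (?m k f) n x)"
    unfolding power_transform_Suc[OF f, abs_def] ..
  also have "\<dots> = (\<lambda>x. \<Sum>k\<in>UNIV. pd i (\<lambda>x. complex_of_real (x $ k) * power_transform (?m k f) n x) x)"
    by (rule pd_sum[OF h])
  also have "\<dots> = (\<lambda>x. \<Sum>k\<in>UNIV. complex_of_real (x $ k) * (of_nat n * power_transform (?m i (?m k f)) (n - 1) x) + (if i = k then power_transform (?m k f) n x else 0))"
    unfolding pd_coord[OF hpoly_power_transform[OF fk]] Suc.IH[OF fk] ..
  also have "\<dots> = (\<lambda>x. of_nat n * (\<Sum>k\<in>UNIV. complex_of_real (x $ k) * power_transform (?m k (?m i f)) (n - 1) x) + power_transform (?m i f) n x)"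
    by (simp add: sum.distrib sum_distrib_left mult_ac)
  also have "\<dots> = (\<lambda>x. of_nat (Suc n) * power_transform (?m i f) n x)"
  proof (cases n)
    case (Suc m)
    show ?thesis unfolding Suc using power_transform_Suc[OF fk[of i], of m] by (simp add: fun_eq_iff algebra_simps)
  qed simp
  finally show ?case by simp
qed

text \<open>Differentiating twice brings out the square of a coordinate of \<open>u\<close>; summed
  over the coordinates these squares give 1 on the sphere.\<close>

lemma lap_power_transform:
  fixes f :: "real^'n \<Rightarrow> complex"
  assumes f: "continuous_on UNIV f"
  shows "lap (power_transform f n) = (\<lambda>x. of_nat n * of_nat (n - 1) * power_transform f (n - 2) x)"
proof
  fix x
  let ?m = "\<lambda>k f. \<lambda>u::real^'n. complex_of_real (u $ k) * f u"
  note fk = continuous_coord_mult[OF f]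
  have pp: "pd i (pd i (power_transform f n)) = (\<lambda>x. of_nat n * of_nat (n - 1) * power_transform (?m i (?m i f)) (n - 2) x)" for i
    unfolding pd_power_transform[OF f] pd_cmult[OF hpoly_power_transform[OF fk]] pd_power_transform[OF fk]
    by (simp add: numeral_2_eq_2 mult.assoc)
  have i: "integrable sphere_measure (\<lambda>u. complex_of_real (x \<bullet> u) ^ (n - 2) * ?m i (?m i f) u)" for i
    by (intro continuous_integrable_sphere continuous_intros f)
  have "(\<Sum>i\<in>UNIV. power_transform (?m i (?m i f)) (n - 2) x) = sphint (\<lambda>u. \<Sum>i\<in>UNIV. complex_of_real (x \<bullet> u) ^ (n - 2) * ?m i (?m i f) u)"
    unfolding power_transform_def by (rule Bochner_Integration.integral_sum[OF i, symmetric])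
  also have "\<dots> = power_transform f (n - 2) x"
    unfolding power_transform_def
  proof (rule Bochner_Integration.integral_cong[OF refl])
    fix u :: "real^'n" assume "u \<in> space sphere_measure"
    then have "norm u = 1" by simp
    then have "(\<Sum>i\<in>UNIV. u $ i * u $ i) = 1"
      using power2_norm_eq_inner[of u] unfolding inner_vec_def by simp
    then have 1: "(\<Sum>i\<in>UNIV. complex_of_real (u $ i) * complex_of_real (u $ i)) = 1"
      by (simp flip: of_real_mult of_real_sum)
    have "(\<Sum>i\<in>UNIV. complex_of_real (x \<bullet> u) ^ (n - 2) * ?m i (?m i f) u)
        = (\<Sum>i\<in>UNIV. complex_of_real (u $ i) * complex_of_real (u $ i)) * (complex_of_real (x \<bullet> u) ^ (n - 2) * f u)"
      unfolding sum_distrib_right by (intro sum.cong) (simp_all add: mult_ac)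
    then show "(\<Sum>i\<in>UNIV. complex_of_real (x \<bullet> u) ^ (n - 2) * ?m i (?m i f) u) = complex_of_real (x \<bullet> u) ^ (n - 2) * f u"
      unfolding 1 by simp
  qed
  finally show "lap (power_transform f n) x = of_nat n * of_nat (n - 1) * power_transform f (n - 2) x"
    unfolding lap_def pp by (simp add: sum_distrib_left[symmetric])
qed

section \<open>Powers of the squared norm times a harmonic polynomial\<close>

definition norm_sq :: "real^'n::finite \<Rightarrow> complex" where
  "norm_sq x = complex_of_real ((norm x)\<^sup>2)"

lemma norm_sq_sum: "norm_sq x = (\<Sum>k\<in>UNIV. complex_of_real (x $ k) * complex_of_real (x $ k))"
  unfolding norm_sq_def power2_norm_eq_inner inner_vec_def by simp

lemma hpoly_norm_sq: "hpoly 2 norm_sq"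
proof -
  have "hpoly (Suc (Suc 0)) (\<lambda>x. \<Sum>k\<in>UNIV. complex_of_real (x $ k) * complex_of_real (x $ k))"
    by (intro hpoly_sum hpoly_coord hpoly_coord1)
  then show ?thesis by (simp add: norm_sq_sum[abs_def] numeral_2_eq_2)
qed

lemma pd_norm_sq: "pd i norm_sq = (\<lambda>x. 2 * complex_of_real (x $ i))"
  unfolding norm_sq_sum[abs_def]
  by (simp add: pd_sum[OF hpoly_coord[OF hpoly_coord1]] pd_coord[OF hpoly_coord1] pd_coord1 if_distrib sum.distrib cong: if_cong)

lemma lap_norm_sq: "lap norm_sq = (\<lambda>x::real^'n. complex_of_real (2 * real CARD('n)))"
  by (simp add: lap_def[abs_def] pd_norm_sq pd_cmult[OF hpoly_coord1] pd_coord1 mult.commute)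

lemma hpoly_norm_sq_power_mult: "hpoly j p \<Longrightarrow> hpoly (2 * m + j) (\<lambda>x. norm_sq x ^ m * p x)"
  using hpoly_mult[OF hpoly_power[OF hpoly_norm_sq]] by (simp add: mult.commute)

text \<open>With \<open>n = j + 2 * m\<close> the constant equals
  \<open>(n - j) * (n + j + d - 2)\<close>, exactly the right-hand factor in
  \<open>fh_coeff_down2\<close>.\<close>

lemma lap_norm_sq_power_mult:
  fixes p :: "real^'n \<Rightarrow> complex"
  assumes p: "hpoly j p" "lap p = (\<lambda>x. 0)"
  shows "lap (\<lambda>x. norm_sq x ^ m * p x)
     = (\<lambda>x. complex_of_real (2 * real m * (2 * real m + real CARD('n) - 2 + 2 * real j)) * (norm_sq x ^ (m - 1) * p x))"
proof (induction m)
  case 0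
  then show ?case using p by simp
next
  case (Suc m)
  define q where "q x = norm_sq x ^ m * p x" for x
  have q: "hpoly (2 * m + j) q" unfolding q_def[abs_def] by (rule hpoly_norm_sq_power_mult[OF p(1)])
  have "(\<lambda>x. norm_sq x ^ Suc m * p x) = (\<lambda>x. norm_sq x * q x)" by (simp add: q_def mult.assoc)
  then have "lap (\<lambda>x. norm_sq x ^ Suc m * p x) = (\<lambda>x. norm_sq x * lap q x + 2 * (\<Sum>i\<in>UNIV. 2 * complex_of_real (x $ i) * pd i q x) + complex_of_real (2 * real CARD('n)) * q x)"
    by (simp only: lap_mult[OF hpoly_norm_sq q] lap_norm_sq pd_norm_sq)
  also have "\<dots> = (\<lambda>x. norm_sq x * lap q x + (4 * of_nat (2 * m + j) + complex_of_real (2 * real CARD('n))) * q x)"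
    using hpoly_euler[OF q] by (simp add: sum_distrib_left[symmetric] mult.assoc fun_eq_iff distrib_right)
  also have "\<dots> = (\<lambda>x. complex_of_real (2 * real m * (2 * real m + real CARD('n) - 2 + 2 * real j)) * q x + (4 * of_nat (2 * m + j) + complex_of_real (2 * real CARD('n))) * q x)"
  proof
    fix x
    have "norm_sq x * lap q x = complex_of_real (2 * real m * (2 * real m + real CARD('n) - 2 + 2 * real j)) * q x"
      using fun_cong[OF Suc.IH, of x] by (cases m) (simp_all add: q_def[abs_def] mult_ac p(2))
    then show "norm_sq x * lap q x + (4 * of_nat (2 * m + j) + complex_of_real (2 * real CARD('n))) * q x
       = complex_of_real (2 * real m * (2 * real m + real CARD('n) - 2 + 2 * real j)) * q x + (4 * of_nat (2 * m + j) + complex_of_real (2 * real CARD('n))) * q x"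
      by (simp only:)
  qed
  also have "\<dots> = (\<lambda>x. complex_of_real (2 * real (Suc m) * (2 * real (Suc m) + real CARD('n) - 2 + 2 * real j)) * (norm_sq x ^ (Suc m - 1) * p x))"
    by (simp add: q_def fun_eq_iff algebra_simps)
  finally show ?case .
qed

lemma sphint_swap:
  fixes k :: "real^'n \<Rightarrow> real^'n \<Rightarrow> complex"
  assumes c: "continuous_on UNIV (\<lambda>(x, u). k x u)"
  shows "sphint (\<lambda>x. sphint (\<lambda>u. k x u)) = sphint (\<lambda>u. sphint (\<lambda>x. k x u))"
proof -
  interpret P: pair_sigma_finite "sphere_measure :: (real^'n) measure" "sphere_measure :: (real^'n) measure" ..
  interpret F: finite_measure "(sphere_measure :: (real^'n) measure) \<Otimes>\<^sub>M (sphere_measure :: (real^'n) measure)"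
    by (intro finite_measure_pair_measure sph.finite_measure_axioms)
  have "bounded ((\<lambda>(x, u). k x u) ` (sphere 0 1 \<times> sphere 0 1))"
    by (intro compact_imp_bounded compact_continuous_image continuous_on_subset[OF c] compact_Times) auto
  then obtain B where B: "\<And>y. y \<in> sphere 0 1 \<times> sphere 0 1 \<Longrightarrow> norm ((\<lambda>(x, u). k x u) y) \<le> B"
    unfolding bounded_iff by blast
  have m: "(\<lambda>(x, u). k x u) \<in> borel_measurable (borel \<Otimes>\<^sub>M borel)"
    unfolding borel_prod by (rule borel_measurable_continuous_onI[OF c])
  have id: "(\<lambda>y. (fst y, snd y)) \<in> measurable (sphere_measure \<Otimes>\<^sub>M sphere_measure) (borel \<Otimes>\<^sub>M (borel :: (real^'n) measure))"
    by (intro measurable_Pair measurable_compose[OF measurable_fst ident_sphere_measure] measurable_compose[OF measurable_snd ident_sphere_measure])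
  have "integrable (sphere_measure \<Otimes>\<^sub>M sphere_measure) (\<lambda>(x, u). k x u)"
  proof (rule F.integrable_const_bound)
    show "AE y in sphere_measure \<Otimes>\<^sub>M sphere_measure. norm ((\<lambda>(x, u). k x u) y) \<le> B"
      using B by (intro AE_I2) (simp add: space_pair_measure)
    show "(\<lambda>(x, u). k x u) \<in> borel_measurable (sphere_measure \<Otimes>\<^sub>M sphere_measure)"
      using measurable_compose[OF id m] by (simp add: split_beta)
  qed
  from P.Fubini_integral[OF this] show ?thesis by simp
qed

text \<open>The three claims depend on each other: the projections of lower degree may be subtracted
  only once they are known to be harmonic, and the remainder \<open>E\<close> is harmonic only
  because the decomposition holds in degree \<open>n - 2\<close>. Dividing \<open>E\<close> by the
  diagonal coefficient produces the projection in degree \<open>n\<close>.\<close>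

lemma sh_proj_properties:
  fixes f :: "real^'n \<Rightarrow> complex"
  assumes d: "CARD('n) \<ge> 2" and f: "continuous_on UNIV f"
  shows "sh_proj n f \<in> harm n
    \<and> (\<forall>q\<in>harm n. sphint (\<lambda>u. (f u - sh_proj n f u) * cnj (q u)) = 0)
    \<and> (\<forall>x. power_transform f n x = (\<Sum>m\<le>n div 2.
      complex_of_real (fh_coeff CARD('n) n (n - 2 * m) * norm x ^ (2 * m)) * sh_proj (n - 2 * m) f x))"
proof (induction n rule: less_induct)
  case (less n)
  let ?d = "CARD('n)"
  let ?c = "\<lambda>m. complex_of_real (fh_coeff ?d n (n - 2 * m))"
  have d0: "?d > 0" by simp
  define c where "c = complex_of_real (fh_coeff ?d n n)"
  have c0: "c \<noteq> 0" using fh_coeff_diag_pos[OF d0, of n] by (simp add: c_def)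
  define t where "t m x = ?c m * (norm_sq x ^ m * sh_proj (n - 2 * m) f x)" for m x
  define E where "E x = power_transform f n x - (\<Sum>m\<in>{1..n div 2}. t m x)" for x
  have P: "hpoly (n - 2 * m) (sh_proj (n - 2 * m) f)" "lap (sh_proj (n - 2 * m) f) = (\<lambda>x. 0)" if "m \<in> {1..n div 2}" for m
    using less.IH[of "n - 2 * m"] that by (auto simp: harm_iff)
  have nm: "2 * m + (n - 2 * m) = n" if "m \<in> {1..n div 2}" for m using that by auto
  have t': "hpoly n (\<lambda>x. norm_sq x ^ m * sh_proj (n - 2 * m) f x)" if "m \<in> {1..n div 2}" for m
    using hpoly_norm_sq_power_mult[OF P(1)[OF that], of m] nm[OF that] by simp
  have t: "hpoly n (t m)" if "m \<in> {1..n div 2}" for m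
    unfolding t_def[abs_def] using t'[OF that] by (rule hpoly_cmult)
  have E: "hpoly n E" unfolding E_def[abs_def]
    by (intro hpoly_diff hpoly_power_transform f hpoly_sum t)
  have lapE: "lap E x = 0" for x
  proof -
    have hs: "hpoly n (\<lambda>x. \<Sum>m\<in>{1..n div 2}. t m x)" by (rule hpoly_sum) (rule t)
    have ls: "lap (\<lambda>x. \<Sum>m\<in>{1..n div 2}. t m x) = (\<lambda>x. \<Sum>m\<in>{1..n div 2}. lap (t m) x)"
      by (rule lap_sum) (rule t)
    have "lap E = (\<lambda>x. of_nat n * of_nat (n - 1) * power_transform f (n - 2) x - (\<Sum>m\<in>{1..n div 2}. lap (t m) x))"
      unfolding E_def[abs_def] lap_diff[OF hpoly_power_transform[OF f] hs] lap_power_transform[OF f] ls ..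
    moreover have "of_nat n * of_nat (n - 1) * power_transform f (n - 2) x = (\<Sum>m\<in>{1..n div 2}. lap (t m) x)"
    proof (cases "n \<ge> 2")
      case True
      then have lt: "n - 2 < n" by simp
      \<comment> \<open>Shifting \<open>m\<close> by one pairs the Laplacian of each subtracted term
        with one term of the decomposition in degree \<open>n - 2\<close>;
        \<open>fh_coeff_down2\<close> matches the coefficients.\<close>
      have img: "{1..n div 2} = Suc ` {..(n - 2) div 2}"
        using True by (auto simp: image_iff Suc_le_eq gr0_conv_Suc)
      have "(\<Sum>m\<in>{1..n div 2}. lap (t m) x) = (\<Sum>m\<le>(n - 2) div 2. lap (t (Suc m)) x)"
        unfolding img by (subst sum.reindex) auto
      also have "\<dots> = (\<Sum>m\<le>(n - 2) div 2. of_nat n * of_nat (n - 1) *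
          (complex_of_real (fh_coeff ?d (n - 2) (n - 2 - 2 * m) * norm x ^ (2 * m)) * sh_proj (n - 2 - 2 * m) f x))"
      proof (rule sum.cong[OF refl])
        fix m assume "m \<in> {..(n - 2) div 2}"
        then have m: "Suc m \<in> {1..n div 2}" using True by auto
        define j where "j = n - 2 * Suc m"
        have j: "n - 2 - 2 * m = j" "n - 2 * Suc m = j" "real n = real j + 2 * real m + 2"
          using m by (auto simp: j_def)
        have 1: "norm_sq x ^ m = complex_of_real (norm x ^ (2 * m))"
          by (simp add: norm_sq_def power_mult)
        have "lap (t (Suc m)) x = complex_of_real (fh_coeff ?d n j) * (complex_of_real (2 * real (Suc m) * (2 * real (Suc m) + real ?d - 2 + 2 * real j)) * (norm_sq x ^ m * sh_proj j f x))"
          unfolding t_def[abs_def] lap_cmult[OF t'[OF m]] using P[OF m]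
          by (simp only: j lap_norm_sq_power_mult) simp
        also have "\<dots> = complex_of_real ((real n - real j) * (real n + real j + real ?d - 2) * fh_coeff ?d n j) * (norm_sq x ^ m * sh_proj j f x)"
          by (simp add: j(3) algebra_simps)
        also have "\<dots> = complex_of_real (real n * (real n - 1) * fh_coeff ?d (n - 2) j) * (norm_sq x ^ m * sh_proj j f x)"
          unfolding fh_coeff_down2[OF d0] ..
        also have "\<dots> = of_nat n * of_nat (n - 1) * (complex_of_real (fh_coeff ?d (n - 2) j * norm x ^ (2 * m)) * sh_proj j f x)"
          unfolding 1 using True by (simp add: of_nat_diff)
        finally show "lap (t (Suc m)) x = of_nat n * of_nat (n - 1) * (complex_of_real (fh_coeff ?d (n - 2) (n - 2 - 2 * m) * norm x ^ (2 * m)) * sh_proj (n - 2 - 2 * m) f x)"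
          unfolding j(1) .
      qed
      also have "\<dots> = of_nat n * of_nat (n - 1) * power_transform f (n - 2) x"
        using less.IH[OF lt] by (simp add: sum_distrib_left)
      finally show ?thesis by simp
    next
      case False
      then have "n = 0 \<or> n = 1" by auto
      then show ?thesis by auto
    qed
    ultimately show ?thesis by simp
  qed
  define p where "p x = inverse c * E x" for x
  have p: "p \<in> harm n"
    unfolding harm_iff p_def[abs_def] using lapE by (auto intro: hpoly_cmult[OF E] simp: lap_cmult[OF E])
  then have php: "hpoly n p" by (simp add: harm_iff)
  have orth: "sphint (\<lambda>u. (f u - p u) * cnj (q u)) = 0" if q: "q \<in> harm n" for q
  proof -
    have q': "hpoly n (\<lambda>x. cnj (q x))" "lap (\<lambda>x. cnj (q x)) = (\<lambda>x. 0)"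
      using harm_cnj[OF q] by (auto simp: harm_iff)
    have qc: "continuous_on UNIV (\<lambda>x. cnj (q x))" using q'(1) by (rule hpoly_continuous)
    have it: "integrable sphere_measure (\<lambda>x. t m x * cnj (q x))" if "m \<in> {1..n div 2}" for m
      by (rule hpoly_integrable_sphere[OF hpoly_mult[OF t[OF that] q'(1)]])
    have t0: "sphint (\<lambda>x. t m x * cnj (q x)) = 0" if m: "m \<in> {1..n div 2}" for m
    proof -
      \<comment> \<open>\<open>norm_sq\<close> is 1 on the sphere, so what remains is a pairing of
        harmonics of different degrees.\<close>
      have "sphint (\<lambda>x. t m x * cnj (q x)) = sphint (\<lambda>x. ?c m * (sh_proj (n - 2 * m) f x * cnj (q x)))"
        by (rule Bochner_Integration.integral_cong) (auto simp: t_def norm_sq_def)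
      also have "\<dots> = 0"
        using sphint_harmonic_orthogonal[OF d P[OF m] q'] nm[OF m] m by (auto simp del: le_div_geq)
      finally show ?thesis .
    qed
    have "sphint (\<lambda>x. E x * cnj (q x)) = sphint (\<lambda>x. power_transform f n x * cnj (q x) - (\<Sum>m\<in>{1..n div 2}. t m x * cnj (q x)))"
      by (simp add: E_def left_diff_distrib sum_distrib_right)
    also have "\<dots> = sphint (\<lambda>x. power_transform f n x * cnj (q x)) - (\<Sum>m\<in>{1..n div 2}. sphint (\<lambda>x. t m x * cnj (q x)))"
      by (subst Bochner_Integration.integral_diff)
         (auto intro!: it hpoly_integrable_sphere[OF hpoly_mult[OF hpoly_power_transform[OF f] q'(1)]] Bochner_Integration.integral_sum
            Bochner_Integration.integrable_sum)
    also have "\<dots> = sphint (\<lambda>x. power_transform f n x * cnj (q x))" by (simp add: t0)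
    also have "\<dots> = sphint (\<lambda>x. sphint (\<lambda>u. complex_of_real (x \<bullet> u) ^ n * f u * cnj (q x)))"
      unfolding power_transform_def by simp
    also have "\<dots> = sphint (\<lambda>u. sphint (\<lambda>x. complex_of_real (x \<bullet> u) ^ n * f u * cnj (q x)))"
    proof (rule sphint_swap)
      have "continuous_on UNIV (\<lambda>y :: (real^'n) \<times> (real^'n). complex_of_real (fst y \<bullet> snd y) ^ n * f (snd y) * cnj (q (fst y)))"
        by (intro continuous_intros continuous_on_compose2[OF f] continuous_on_compose2[OF qc]) auto
      then show "continuous_on UNIV (\<lambda>(x, u). complex_of_real (x \<bullet> u) ^ n * f u * cnj (q x))"
        by (simp add: split_beta)
    qed
    also have "\<dots> = sphint (\<lambda>u. f u * sphint (\<lambda>x. complex_of_real (u \<bullet> x) ^ n * cnj (q x)))"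
      by (simp only: integral_mult_right_zero[symmetric]) (simp add: mult_ac inner_commute)
    also have "\<dots> = sphint (\<lambda>u. c * (f u * cnj (q u)))"
      unfolding funk_hecke_power[OF d q'] by (simp add: c_def mult_ac)
    finally have Eq: "sphint (\<lambda>x. E x * cnj (q x)) = c * sphint (\<lambda>u. f u * cnj (q u))" by simp
    have "sphint (\<lambda>u. (f u - p u) * cnj (q u)) = sphint (\<lambda>u. f u * cnj (q u) - inverse c * (E u * cnj (q u)))"
      by (simp add: p_def algebra_simps)
    also have "\<dots> = sphint (\<lambda>u. f u * cnj (q u)) - sphint (\<lambda>u. inverse c * (E u * cnj (q u)))"
      by (intro Bochner_Integration.integral_diff continuous_integrable_sphere continuous_intros f qc hpoly_continuous[OF E])
    also have "\<dots> = 0" using c0 by (simp add: Eq)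
    finally show ?thesis .
  qed
  have sp: "sh_proj n f = p" by (rule sh_proj_eqI[OF f p orth])
  have "power_transform f n x = (\<Sum>m\<le>n div 2. complex_of_real (fh_coeff ?d n (n - 2 * m) * norm x ^ (2 * m)) * sh_proj (n - 2 * m) f x)" for x
  proof -
    have "power_transform f n x = c * p x + (\<Sum>m\<in>{1..n div 2}. t m x)"
      using c0 by (simp add: p_def E_def mult.assoc[symmetric])
    also have "c * p x = t 0 x" by (simp add: t_def c_def sp)
    also have "t 0 x + (\<Sum>m\<in>{1..n div 2}. t m x) = (\<Sum>m\<le>n div 2. t m x)"
      by (simp add: atMost_atLeast0 sum.atLeast_Suc_atMost)
    also have "\<dots> = (\<Sum>m\<le>n div 2. complex_of_real (fh_coeff ?d n (n - 2 * m) * norm x ^ (2 * m)) * sh_proj (n - 2 * m) f x)"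
      by (simp add: t_def norm_sq_def power_mult mult.assoc)
    finally show ?thesis .
  qed
  then show ?case using p orth sp by blast
qed

theorem
  fixes f :: "real^'n \<Rightarrow> complex"
  assumes d: "CARD('n) \<ge> 2" and f: "continuous_on UNIV f"
  shows sh_proj_harm: "sh_proj n f \<in> harm n"
    and sh_proj_orth: "q \<in> harm n \<Longrightarrow> sphint (\<lambda>u. (f u - sh_proj n f u) * cnj (q u)) = 0"
    and power_transform_decomposition: "power_transform f n x = (\<Sum>m\<le>n div 2.
      complex_of_real (fh_coeff CARD('n) n (n - 2 * m) * norm x ^ (2 * m)) * sh_proj (n - 2 * m) f x)"
  using sh_proj_properties[OF d f, of n] by blast+

text \<open>Funk-Hecke with \<open>n = j\<close> is a reproducing formula: \<open>p y\<close> is an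
  integral of \<open>p\<close> itself, so a bound on the integral of \<open>cmod p\<close> is
  enough. Orthogonality provides it, since the integral of \<open>(cmod p)\<^sup>2\<close> equals
  that of \<open>f * cnj p\<close>. Points inside the ball are included so that \<open>sgn x\<close>
  at \<open>x = 0\<close> is covered.\<close>

lemma sh_proj_bound:
  fixes f :: "real^'n \<Rightarrow> complex"
  assumes d: "CARD('n) \<ge> 2" and f: "continuous_on UNIV f"
    and B: "B > 0" "\<And>u. norm u = 1 \<Longrightarrow> cmod (f u) \<le> B" and y: "norm y \<le> 1"
  shows "cmod (sh_proj j f y) \<le> real CARD('n) ^ j * B"
proof -
  let ?d = "CARD('n)"
  have d0: "?d > 0" by simp
  define p where "p = sh_proj j f"
  have p: "hpoly j p" "lap p = (\<lambda>x. 0)" "p \<in> harm j" using sh_proj_harm[OF d f, of j] by (auto simp: p_def harm_iff)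
  note pc = hpoly_continuous[OF p(1)]
  define w where "w = fh_coeff ?d 0 0"
  define I where "I = sphint (\<lambda>u. cmod (p u))"
  have i1: "integrable sphere_measure (\<lambda>u. cmod (p u))"
    by (intro continuous_integrable_sphere continuous_intros pc)
  have i2: "integrable sphere_measure (\<lambda>u. (cmod (p u))\<^sup>2)"
    by (intro continuous_integrable_sphere continuous_intros pc)
  have ifp: "integrable sphere_measure (\<lambda>u. f u * cnj (p u))"
    by (intro continuous_integrable_sphere continuous_intros pc f)
  have ipp: "integrable sphere_measure (\<lambda>u. p u * cnj (p u))"
    by (intro continuous_integrable_sphere continuous_intros pc f)
  have "sphint (\<lambda>u. f u * cnj (p u)) - sphint (\<lambda>u. p u * cnj (p u)) = sphint (\<lambda>u. (f u - p u) * cnj (p u))"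
    by (subst Bochner_Integration.integral_diff[OF ifp ipp, symmetric]) (simp add: left_diff_distrib)
  also have "\<dots> = 0" using sh_proj_orth[OF d f p(3)] by (simp add: p_def)
  finally have "sphint (\<lambda>u. complex_of_real ((cmod (p u))\<^sup>2)) = sphint (\<lambda>u. f u * cnj (p u))"
    by (simp only: complex_norm_square right_minus_eq)
  then have "complex_of_real (sphint (\<lambda>u. (cmod (p u))\<^sup>2)) = sphint (\<lambda>u. f u * cnj (p u))"
    by (simp only: integral_complex_of_real)
  then have "\<bar>sphint (\<lambda>u. (cmod (p u))\<^sup>2)\<bar> = cmod (sphint (\<lambda>u. f u * cnj (p u)))"
    by (metis norm_of_real)
  also have "\<dots> \<le> sphint (\<lambda>u. cmod (f u * cnj (p u)))" by (rule integral_norm_bound)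
  also have "\<dots> \<le> sphint (\<lambda>u. B * cmod (p u))"
    by (intro integral_mono integrable_norm ifp integrable_mult_right i1) (auto simp: norm_mult intro!: mult_right_mono B)
  also have "\<dots> = B * I" by (simp add: I_def)
  finally have 1: "sphint (\<lambda>u. (cmod (p u))\<^sup>2) \<le> B * I" by simp
  \<comment> \<open>Together with the previous bound this replaces the Cauchy--Schwarz inequality.\<close>
  have "0 \<le> sphint (\<lambda>u. (cmod (p u) - B)\<^sup>2)" by (rule integral_nonneg_AE) simp
  also have "\<dots> = sphint (\<lambda>u. (cmod (p u))\<^sup>2 - 2 * B * cmod (p u) + B\<^sup>2)"
    by (simp add: power2_diff algebra_simps)
  also have "\<dots> = sphint (\<lambda>u. (cmod (p u))\<^sup>2) - 2 * B * I + B\<^sup>2 * w"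
    using i1 i2 hpoly_integrable_sphere[OF p(1)] measure_sphere[where 'n='n] by (simp add: I_def w_def)
  finally have "B * I \<le> B * (B * w)" using 1 by (simp add: power2_eq_square)
  then have I: "I \<le> B * w" using B by simp
  have "fh_coeff ?d j j * cmod (p y) = cmod (sphint (\<lambda>u. complex_of_real (y \<bullet> u) ^ j * p u))"
    unfolding funk_hecke_power[OF d p(1,2)] using fh_coeff_diag_pos[OF d0, of j] by (simp add: norm_mult)
  also have "\<dots> \<le> sphint (\<lambda>u. cmod (complex_of_real (y \<bullet> u) ^ j * p u))" by (rule integral_norm_bound)
  also have "\<dots> \<le> I" unfolding I_def
  proof (intro integral_mono integrable_norm i1)
    show "integrable sphere_measure (\<lambda>u. complex_of_real (y \<bullet> u) ^ j * p u)"
      by (intro continuous_integrable_sphere continuous_intros pc)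
    fix u :: "real^'n" assume "u \<in> space sphere_measure"
    then have "\<bar>y \<bullet> u\<bar> \<le> 1" using Cauchy_Schwarz_ineq2[of y u] y by simp
    then have "\<bar>y \<bullet> u\<bar> ^ j \<le> 1" by (intro power_le_one) auto
    then show "cmod (complex_of_real (y \<bullet> u) ^ j * p u) \<le> cmod (p u)"
      by (simp add: norm_mult norm_power mult_left_le_one_le)
  qed (rule hpoly_integrable_sphere[OF p(1)])
  also have "\<dots> \<le> B * (real ?d ^ j * fh_coeff ?d j j)"
  proof -
    have "B * w \<le> B * (real ?d ^ j * fh_coeff ?d j j)"
      unfolding w_def using fh_coeff_diag_ge[OF d, of j] B by (intro mult_left_mono) auto
    then show ?thesis using I by linarith
  qed
  finally have "fh_coeff ?d j j * cmod (p y) \<le> fh_coeff ?d j j * (real ?d ^ j * B)" by (simp add: mult_ac)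
  then show ?thesis using fh_coeff_diag_pos[OF d0, of j] by (simp add: p_def)
qed

section \<open>Fourier inversion\<close>

lemma integral_lborel_affine:
  fixes f :: "'a::euclidean_space \<Rightarrow> 'b::{banach, second_countable_topology}"
  assumes [measurable]: "f \<in> borel_measurable borel" and c: "c \<noteq> 0"
  shows "integral\<^sup>L lborel f = \<bar>c\<bar> ^ DIM('a) *\<^sub>R integral\<^sup>L lborel (\<lambda>x. f (t + c *\<^sub>R x))"
proof -
  have "integral\<^sup>L lborel f = integral\<^sup>L (density (distr lborel borel (\<lambda>x. t + c *\<^sub>R x)) (\<lambda>_. ennreal (\<bar>c\<bar> ^ DIM('a)))) f"
    using lborel_affine[OF c, of t] by simp
  also have "\<dots> = integral\<^sup>L (distr lborel borel (\<lambda>x. t + c *\<^sub>R x)) (\<lambda>x. \<bar>c\<bar> ^ DIM('a) *\<^sub>R f x)"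
    by (rule integral_density) auto
  also have "\<dots> = integral\<^sup>L lborel (\<lambda>x. \<bar>c\<bar> ^ DIM('a) *\<^sub>R f (t + c *\<^sub>R x))"
    by (rule integral_distr) auto
  finally show ?thesis by simp
qed

text \<open>Open boxes already generate the Borel sets and are stable under intersection.
  Boundedness is kept because indicators of bounded open sets are limits of integrable continuous
  functions.\<close>

lemma measure_eqI_bounded_open:
  fixes M N :: "'a::euclidean_space measure"
  assumes "finite_measure M" and sets: "sets M = sets borel" "sets N = sets borel"
    and eq: "\<And>U. open U \<Longrightarrow> bounded U \<Longrightarrow> emeasure M U = emeasure N U"
  shows "M = N"
proof -
  interpret finite_measure M by fact
  let ?E = "range (\<lambda>(a, b). box a b :: 'a set)"
  show ?thesis
  proof (rule measure_eqI_generator_eq[where E="?E" and \<Omega>=UNIV and A="\<lambda>n::nat. box (- (real n *\<^sub>R One)) (real n *\<^sub>R One)"])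
    show "Int_stable ?E" by (auto simp: Int_stable_def box_Int_box)
    show "sets M = sigma_sets UNIV ?E" "sets N = sigma_sets UNIV ?E"
      by (simp_all add: borel_eq_box sets)
    show "(\<Union>n::nat. box (- (real n *\<^sub>R One)) (real n *\<^sub>R One)) = (UNIV :: 'a set)"
      unfolding UN_box_eq_UNIV ..
  qed (auto intro!: eq simp: emeasure_finite)
qed

text \<open>Integrability of the characteristic function is the only analytic assumption; the
  density is an outcome.\<close>

locale fourier_pair = prob_space \<mu> for \<mu> :: "(real^'n::finite) measure" +
  fixes \<phi> :: "real^'n \<Rightarrow> complex"
  assumes sets_mu [measurable_cong, simp]: "sets \<mu> = sets borel"
    and phi: "\<And>z. \<phi> z = integral\<^sup>L \<mu> (\<lambda>x. cis (z \<bullet> x))"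
    and phi_int: "integrable lborel \<phi>"
begin

definition inv_transform :: "real^'n \<Rightarrow> complex" where
  "inv_transform x = complex_of_real (1 / (2 * pi) ^ CARD('n)) * integral\<^sup>L lborel (\<lambda>z. cis (- (x \<bullet> z)) * \<phi> z)"

text \<open>The Gaussian factor makes the double integral over \<open>z\<close> and \<mu> absolutely
  convergent when \<phi> is written out; it tends to 1 as \<open>s\<close> tends to 0.\<close>

definition smoothed :: "real \<Rightarrow> real^'n \<Rightarrow> complex" where
  "smoothed s x = complex_of_real (1 / (2 * pi) ^ CARD('n)) *
     integral\<^sup>L lborel (\<lambda>z. exp (- (norm (s *\<^sub>R z))\<^sup>2 / 2) *\<^sub>R (cis (- (x \<bullet> z)) * \<phi> z))"

text \<open>The density of a centred Gaussian vector with standard deviation \<open>s\<close> in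
  each coordinate.\<close>

definition kernel :: "real \<Rightarrow> real^'n \<Rightarrow> real" where
  "kernel s w = gauss ((1 / s) *\<^sub>R w) / s ^ CARD('n)"

lemma [measurable]: "\<phi> \<in> borel_measurable borel"
  using borel_measurable_integrable[OF phi_int] by simp

lemma cis_measurable [measurable]: "cis \<in> borel_measurable borel"
  by (rule borel_measurable_continuous_onI) (rule continuous_on_cis[OF continuous_on_id])

lemma mu_measurable: "f \<in> borel_measurable borel \<Longrightarrow> f \<in> borel_measurable \<mu>"
  unfolding measurable_cong_sets[OF sets_mu refl] .

lemma pair_mu_measurable:
  "f \<in> borel_measurable (borel \<Otimes>\<^sub>M borel) \<Longrightarrow> f \<in> borel_measurable (lborel \<Otimes>\<^sub>M \<mu>)"
  unfolding measurable_cong_sets[OF sets_pair_measure_cong[OF sets_lborel sets_mu] refl] .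

lemma kernel_measurable [measurable]: "kernel s \<in> borel_measurable borel"
  unfolding kernel_def[abs_def] by (intro borel_measurable_divide measurable_compose[OF _ gauss_measurable]) simp_all

lemma kernel_nonneg: "s > 0 \<Longrightarrow> kernel s w \<ge> 0"
  by (simp add: kernel_def)

lemma kernel_le: "s > 0 \<Longrightarrow> kernel s w \<le> (1 / sqrt (2 * pi)) ^ CARD('n) / s ^ CARD('n)"
  unfolding kernel_def gauss_eq by (intro divide_right_mono mult_right_le_one_le) simp_all

lemma exp_norm_eq_gauss: "exp (- (norm v)\<^sup>2 / 2) = sqrt (2 * pi) ^ CARD('n) * gauss (v :: real^'n)"
proof -
  have "sqrt (2 * pi) ^ CARD('n) * (1 / sqrt (2 * pi)) ^ CARD('n) = 1"
    by (subst power_mult_distrib[symmetric]) simp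
  then show ?thesis unfolding gauss_eq mult.assoc[symmetric] by (simp only: mult_1)
qed

lemma sqrt_2pi_power: "sqrt (2 * pi) ^ k * sqrt (2 * pi) ^ k = (2 * pi) ^ k"
  by (subst power_mult_distrib[symmetric]) simp

lemma integrable_exp_norm: "s > 0 \<Longrightarrow> integrable lborel (\<lambda>z::real^'n. exp (- (norm (s *\<^sub>R z))\<^sup>2 / 2))"
proof -
  assume s: "s > 0"
  have "integrable lborel (\<lambda>z::real^'n. gauss (0 + s *\<^sub>R z))"
  proof (rule integrableI_nonneg)
    have "\<infinity> > (\<integral>\<^sup>+x. ennreal (gauss (x::real^'n)) \<partial>lborel)"
      using integrable_gauss[where 'n='n] by (simp add: integrable_iff_bounded)
    also have "(\<integral>\<^sup>+x. ennreal (gauss (x::real^'n)) \<partial>lborel) = ennreal (s ^ CARD('n)) * (\<integral>\<^sup>+x. ennreal (gauss (0 + s *\<^sub>R (x::real^'n))) \<partial>lborel)"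
      using s by (subst lborel_affine[of s "0::real^'n"]) (simp_all add: nn_integral_density nn_integral_distr nn_integral_cmult)
    finally show "(\<integral>\<^sup>+x. ennreal (gauss (0 + s *\<^sub>R (x::real^'n))) \<partial>lborel) < \<infinity>"
      using s by (auto simp: ennreal_mult_less_top)
  qed auto
  then show ?thesis unfolding exp_norm_eq_gauss by simp
qed

lemma gauss_transform:
  assumes s: "s > 0"
  shows "integral\<^sup>L lborel (\<lambda>z::real^'n. exp (- (norm (s *\<^sub>R z))\<^sup>2 / 2) *\<^sub>R cis (z \<bullet> w)) = complex_of_real ((2 * pi) ^ CARD('n) * kernel s w)"
proof -
  have "integral\<^sup>L lborel (\<lambda>z::real^'n. gauss z *\<^sub>R cis (z \<bullet> ((1 / s) *\<^sub>R w)))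
     = \<bar>s\<bar> ^ DIM(real^'n) *\<^sub>R integral\<^sup>L lborel (\<lambda>z::real^'n. gauss (0 + s *\<^sub>R z) *\<^sub>R cis ((0 + s *\<^sub>R z) \<bullet> ((1 / s) *\<^sub>R w)))"
    using s by (intro integral_lborel_affine) auto
  then have 1: "integral\<^sup>L lborel (\<lambda>z::real^'n. gauss z *\<^sub>R cis (((1 / s) *\<^sub>R w) \<bullet> z))
     = s ^ CARD('n) *\<^sub>R integral\<^sup>L lborel (\<lambda>z::real^'n. gauss (s *\<^sub>R z) *\<^sub>R cis (z \<bullet> w))"
    using s by (simp add: inner_commute)
  have "integral\<^sup>L lborel (\<lambda>z::real^'n. exp (- (norm (s *\<^sub>R z))\<^sup>2 / 2) *\<^sub>R cis (z \<bullet> w))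
     = sqrt (2 * pi) ^ CARD('n) *\<^sub>R integral\<^sup>L lborel (\<lambda>z::real^'n. gauss (s *\<^sub>R z) *\<^sub>R cis (z \<bullet> w))"
    unfolding exp_norm_eq_gauss by (simp only: scaleR_scaleR[symmetric] integral_scaleR_right)
  also have "\<dots> = (sqrt (2 * pi) ^ CARD('n) / s ^ CARD('n)) *\<^sub>R (s ^ CARD('n) *\<^sub>R integral\<^sup>L lborel (\<lambda>z::real^'n. gauss (s *\<^sub>R z) *\<^sub>R cis (z \<bullet> w)))"
    using s by simp
  also have "\<dots> = complex_of_real (sqrt (2 * pi) ^ CARD('n) / s ^ CARD('n) * (sqrt (2 * pi) ^ CARD('n) * gauss ((1 / s) *\<^sub>R w)))"
    unfolding 1[symmetric] integral_gauss_cis exp_norm_eq_gauss by (simp add: scaleR_conv_of_real)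
  also have "sqrt (2 * pi) ^ CARD('n) / s ^ CARD('n) * (sqrt (2 * pi) ^ CARD('n) * gauss ((1 / s) *\<^sub>R w))
     = (2 * pi) ^ CARD('n) * kernel s w"
    unfolding kernel_def sqrt_2pi_power[symmetric] by simp
  finally show ?thesis .
qed

text \<open>The smoothed integral is the density of the convolution of \<mu> with a Gaussian. Being
  an average of a nonnegative kernel, it passes reality and nonnegativity on to its limit
  \<open>inv_transform\<close>.\<close>

lemma smoothed_eq:
  assumes s: "s > 0"
  shows "smoothed s x = complex_of_real (integral\<^sup>L \<mu> (\<lambda>y. kernel s (y - x)))"
proof -
  interpret P: pair_sigma_finite "lborel :: (real^'n) measure" \<mu> ..
  let ?h = "\<lambda>z y. exp (- (norm (s *\<^sub>R z))\<^sup>2 / 2) *\<^sub>R cis (z \<bullet> (y - x))"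
  have i: "integrable (lborel \<Otimes>\<^sub>M \<mu>) (\<lambda>(z, y). ?h z y)"
  proof (rule P.Fubini_integrable)
    show "integrable lborel (\<lambda>z. \<integral>y. norm (case (z, y) of (z, y) \<Rightarrow> ?h z y) \<partial>\<mu>)"
      using integrable_exp_norm[OF s] by (simp add: prob_space)
    show "AE z in lborel. integrable \<mu> (\<lambda>y. case (z, y) of (z, y) \<Rightarrow> ?h z y)"
    proof (rule AE_I2)
      fix z
      have "(\<lambda>y. ?h z y) \<in> borel_measurable \<mu>" by (rule mu_measurable) measurable
      then show "integrable \<mu> (\<lambda>y. case (z, y) of (z, y) \<Rightarrow> ?h z y)"
        by (intro integrable_const_bound[where B=1]) auto
    qed
  qed (rule pair_mu_measurable, measurable)
  have "integral\<^sup>L lborel (\<lambda>z. exp (- (norm (s *\<^sub>R z))\<^sup>2 / 2) *\<^sub>R (cis (- (x \<bullet> z)) * \<phi> z)) = (\<integral>z. \<integral>y. ?h z y \<partial>\<mu> \<partial>lborel)"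
  proof (rule Bochner_Integration.integral_cong[OF refl])
    fix z :: "real^'n"
    have "cis (- (x \<bullet> z)) * \<phi> z = (\<integral>y. cis (- (x \<bullet> z)) * cis (z \<bullet> y) \<partial>\<mu>)"
      unfolding phi by simp
    also have "\<dots> = (\<integral>y. cis (z \<bullet> (y - x)) \<partial>\<mu>)"
      by (simp add: cis_mult inner_diff_right inner_commute)
    finally show "exp (- (norm (s *\<^sub>R z))\<^sup>2 / 2) *\<^sub>R (cis (- (x \<bullet> z)) * \<phi> z) = (\<integral>y. ?h z y \<partial>\<mu>)"
      by simp
  qed
  also have "\<dots> = (\<integral>y. \<integral>z. ?h z y \<partial>lborel \<partial>\<mu>)"
    using P.Fubini_integral[OF i] by simp
  also have "\<dots> = (\<integral>y. complex_of_real ((2 * pi) ^ CARD('n) * kernel s (y - x)) \<partial>\<mu>)"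
    by (simp only: gauss_transform[OF s])
  also have "\<dots> = complex_of_real ((2 * pi) ^ CARD('n) * integral\<^sup>L \<mu> (\<lambda>y. kernel s (y - x)))"
    by (simp only: integral_complex_of_real integral_mult_right_zero)
  finally show ?thesis unfolding smoothed_def by simp
qed

lemma norm_smoothed_le:
  "norm (smoothed s x) \<le> 1 / (2 * pi) ^ CARD('n) * integral\<^sup>L lborel (\<lambda>z. norm (\<phi> z))"
proof -
  have "norm (smoothed s x) \<le> 1 / (2 * pi) ^ CARD('n) * norm (integral\<^sup>L lborel (\<lambda>z. exp (- (norm (s *\<^sub>R z))\<^sup>2 / 2) *\<^sub>R (cis (- (x \<bullet> z)) * \<phi> z)))"
    unfolding smoothed_def norm_mult norm_of_real by simp
  also have "\<dots> \<le> 1 / (2 * pi) ^ CARD('n) * integral\<^sup>L lborel (\<lambda>z. norm (\<phi> z))"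
  proof (intro mult_left_mono)
    show "norm (integral\<^sup>L lborel (\<lambda>z. exp (- (norm (s *\<^sub>R z))\<^sup>2 / 2) *\<^sub>R (cis (- (x \<bullet> z)) * \<phi> z))) \<le> integral\<^sup>L lborel (\<lambda>z. norm (\<phi> z))"
      by (rule Bochner_Integration.integral_norm_bound_integral)
         (auto intro!: Bochner_Integration.integrable_bound[OF phi_int] phi_int integrable_norm simp: norm_mult mult_left_le_one_le)
  qed simp
  finally show ?thesis .
qed

definition step :: "nat \<Rightarrow> real" where "step k = inverse (real (Suc k))"

lemma step_pos: "step k > 0" by (simp add: step_def)

lemma step_lim: "step \<longlonglongrightarrow> 0" unfolding step_def[abs_def] by (rule LIMSEQ_inverse_real_of_nat)

lemma smoothed_lim: "(\<lambda>k. smoothed (step k) x) \<longlonglongrightarrow> inv_transform x"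
  unfolding smoothed_def inv_transform_def
proof (intro tendsto_mult tendsto_const integral_dominated_convergence[where w="\<lambda>z. norm (\<phi> z)"])
  show "AE z in lborel. (\<lambda>k. exp (- (norm (step k *\<^sub>R z))\<^sup>2 / 2) *\<^sub>R (cis (- (x \<bullet> z)) * \<phi> z)) \<longlonglongrightarrow> cis (- (x \<bullet> z)) * \<phi> z"
  proof (rule AE_I2)
    fix z :: "real^'n"
    have "(\<lambda>k. exp (- (norm (step k *\<^sub>R z))\<^sup>2 / 2) *\<^sub>R (cis (- (x \<bullet> z)) * \<phi> z)) \<longlonglongrightarrow> exp (- (norm (0 *\<^sub>R z))\<^sup>2 / 2) *\<^sub>R (cis (- (x \<bullet> z)) * \<phi> z)"
      by (intro tendsto_intros step_lim) auto
    then show "(\<lambda>k. exp (- (norm (step k *\<^sub>R z))\<^sup>2 / 2) *\<^sub>R (cis (- (x \<bullet> z)) * \<phi> z)) \<longlonglongrightarrow> cis (- (x \<bullet> z)) * \<phi> z" by simp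
  qed
  show "AE z in lborel. norm (exp (- (norm (step k *\<^sub>R z))\<^sup>2 / 2) *\<^sub>R (cis (- (x \<bullet> z)) * \<phi> z)) \<le> norm (\<phi> z)" for k
    by (auto simp: norm_mult mult_left_le_one_le)
qed (auto intro: phi_int)

lemma inv_transform_real: "Im (inv_transform x) = 0" and inv_transform_nonneg: "Re (inv_transform x) \<ge> 0"
proof -
  have "(\<lambda>k. Im (smoothed (step k) x)) \<longlonglongrightarrow> Im (inv_transform x)"
    by (intro tendsto_intros smoothed_lim)
  moreover have "Im (smoothed (step k) x) = 0" for k by (simp add: smoothed_eq[OF step_pos])
  ultimately show "Im (inv_transform x) = 0" by (simp add: LIMSEQ_const_iff)
  have "(\<lambda>k. Re (smoothed (step k) x)) \<longlonglongrightarrow> Re (inv_transform x)"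
    by (intro tendsto_intros smoothed_lim)
  moreover have "Re (smoothed (step k) x) \<ge> 0" for k
    by (simp add: smoothed_eq[OF step_pos] kernel_nonneg[OF step_pos] integral_nonneg_AE)
  ultimately show "Re (inv_transform x) \<ge> 0" by (intro LIMSEQ_le_const) auto
qed

lemma inv_transform_measurable [measurable]: "inv_transform \<in> borel_measurable borel"
proof -
  have "(\<lambda>x. integral\<^sup>L lborel (\<lambda>z. cis (- (x \<bullet> z)) * \<phi> z)) \<in> borel_measurable borel"
    by (rule sigma_finite_measure.borel_measurable_lebesgue_integral[OF sigma_finite_lborel]) measurable
  then show ?thesis unfolding inv_transform_def[abs_def] by measurable
qed

lemma smoothed_measurable [measurable]: "smoothed s \<in> borel_measurable borel"
proof -
  have "(\<lambda>x. integral\<^sup>L lborel (\<lambda>z. exp (- (norm (s *\<^sub>R z))\<^sup>2 / 2) *\<^sub>R (cis (- (x \<bullet> z)) * \<phi> z))) \<in> borel_measurable borel"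
    by (rule sigma_finite_measure.borel_measurable_lebesgue_integral[OF sigma_finite_lborel]) measurable
  then show ?thesis unfolding smoothed_def[abs_def] by measurable
qed

text \<open>Fubini moves the smoothing from \<mu> to the test function, which is then averaged over
  a Gaussian neighbourhood of \<open>y\<close>.\<close>

lemma integral_smoothed:
  assumes s: "s > 0" and f: "integrable lborel f"
  shows "integral\<^sup>L lborel (\<lambda>x. f x * Re (smoothed s x)) = (\<integral>y. integral\<^sup>L lborel (\<lambda>v. f (y + s *\<^sub>R v) * gauss v) \<partial>\<mu>)"
proof -
  interpret P: pair_sigma_finite "lborel :: (real^'n) measure" \<mu> ..
  have [measurable]: "f \<in> borel_measurable borel" using borel_measurable_integrable[OF f] by simp
  let ?B = "(1 / sqrt (2 * pi)) ^ CARD('n) / s ^ CARD('n)"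
  have ik: "integrable \<mu> (\<lambda>y. kernel s (y - x))" for x
  proof (rule integrable_const_bound[where B="?B"])
    show "(\<lambda>y. kernel s (y - x)) \<in> borel_measurable \<mu>" by (rule mu_measurable) measurable
  qed (auto simp: kernel_nonneg[OF s] kernel_le[OF s])
  have kle: "(\<integral>y. kernel s (y - x) \<partial>\<mu>) \<le> ?B" for x
    by (rule integral_le_const[OF ik]) (auto simp: kernel_le[OF s])
  have kge: "(\<integral>y. kernel s (y - x) \<partial>\<mu>) \<ge> 0" for x
    by (rule integral_nonneg_AE) (simp add: kernel_nonneg[OF s])
  have i: "integrable (lborel \<Otimes>\<^sub>M \<mu>) (\<lambda>(x, y). f x * kernel s (y - x))"
  proof (rule P.Fubini_integrable)
    have "integrable lborel (\<lambda>x. norm (f x) * (\<integral>y. kernel s (y - x) \<partial>\<mu>))"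
    proof (rule Bochner_Integration.integrable_bound[where f="\<lambda>x. norm (f x) * ?B"])
      show "AE x in lborel. norm (norm (f x) * (\<integral>y. kernel s (y - x) \<partial>\<mu>)) \<le> norm (norm (f x) * ?B)"
      proof (rule AE_I2)
        fix x
        have "norm (f x) * (\<integral>y. kernel s (y - x) \<partial>\<mu>) \<le> norm (f x) * ?B"
          by (intro mult_left_mono kle) simp
        then show "norm (norm (f x) * (\<integral>y. kernel s (y - x) \<partial>\<mu>)) \<le> norm (norm (f x) * ?B)"
          unfolding real_norm_def[of "_ * _"] using kge[of x] s by (subst abs_of_nonneg) (auto intro: order_trans[OF _ abs_ge_self])
      qed
      show "integrable lborel (\<lambda>x. norm (f x) * ?B)"
        by (intro integrable_mult_left integrable_norm f)
      have "(\<lambda>x. \<integral>y. kernel s (y - x) \<partial>\<mu>) \<in> borel_measurable borel"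
        by (rule borel_measurable_lebesgue_integral) measurable
      then show "(\<lambda>x. norm (f x) * (\<integral>y. kernel s (y - x) \<partial>\<mu>)) \<in> borel_measurable lborel"
        by simp
    qed
    then show "integrable lborel (\<lambda>x. \<integral>y. norm (case (x, y) of (x, y) \<Rightarrow> f x * kernel s (y - x)) \<partial>\<mu>)"
      by (simp add: abs_mult kernel_nonneg[OF s])
    show "AE x in lborel. integrable \<mu> (\<lambda>y. case (x, y) of (x, y) \<Rightarrow> f x * kernel s (y - x))"
      using ik by simp
  qed (rule pair_mu_measurable, measurable)
  have "integral\<^sup>L lborel (\<lambda>x. f x * Re (smoothed s x)) = (\<integral>x. \<integral>y. f x * kernel s (y - x) \<partial>\<mu> \<partial>lborel)"
    by (simp add: smoothed_eq[OF s])
  also have "\<dots> = (\<integral>y. \<integral>x. f x * kernel s (y - x) \<partial>lborel \<partial>\<mu>)"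
    using P.Fubini_integral[OF i] by simp
  also have "\<dots> = (\<integral>y. integral\<^sup>L lborel (\<lambda>v. f (y + s *\<^sub>R v) * gauss v) \<partial>\<mu>)"
  proof (rule Bochner_Integration.integral_cong[OF refl])
    fix y :: "real^'n"
    have "(\<integral>x. f x * kernel s (y - x) \<partial>lborel) = \<bar>s\<bar> ^ DIM(real^'n) *\<^sub>R (\<integral>v. f (y + s *\<^sub>R v) * kernel s (y - (y + s *\<^sub>R v)) \<partial>lborel)"
      using s by (intro integral_lborel_affine) auto
    also have "\<dots> = (\<integral>v. s ^ CARD('n) * (f (y + s *\<^sub>R v) * kernel s (y - (y + s *\<^sub>R v))) \<partial>lborel)"
      using s by simp
    also have "\<dots> = (\<integral>v. f (y + s *\<^sub>R v) * gauss v \<partial>lborel)"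
      using s by (intro Bochner_Integration.integral_cong) (auto simp: kernel_def gauss_eq)
    finally show "(\<integral>x. f x * kernel s (y - x) \<partial>lborel) = (\<integral>v. f (y + s *\<^sub>R v) * gauss v \<partial>lborel)" .
  qed
  finally show ?thesis .
qed

text \<open>Both sides are limits of the same sequence. Before the smoothing is moved, the uniform
  bound on \<open>smoothed\<close> allows dominated convergence; afterwards the bound on
  \<open>f\<close> does.\<close>

lemma integral_inv_transform:
  assumes c: "continuous_on UNIV f" and f: "integrable lborel f" and B: "\<And>x. \<bar>f x\<bar> \<le> B"
  shows "integral\<^sup>L lborel (\<lambda>x. f x * Re (inv_transform x)) = integral\<^sup>L \<mu> f"
proof (rule LIMSEQ_unique)
  have [measurable]: "f \<in> borel_measurable borel" using borel_measurable_integrable[OF f] by simp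
  define C where "C = 1 / (2 * pi) ^ CARD('n) * integral\<^sup>L lborel (\<lambda>z. norm (\<phi> z))"
  show "(\<lambda>k. integral\<^sup>L lborel (\<lambda>x. f x * Re (smoothed (step k) x))) \<longlonglongrightarrow> integral\<^sup>L lborel (\<lambda>x. f x * Re (inv_transform x))"
  proof (rule integral_dominated_convergence[where w="\<lambda>x. \<bar>f x\<bar> * C"])
    show "AE x in lborel. (\<lambda>k. f x * Re (smoothed (step k) x)) \<longlonglongrightarrow> f x * Re (inv_transform x)"
      by (intro AE_I2 tendsto_intros smoothed_lim)
    show "AE x in lborel. norm (f x * Re (smoothed (step k) x)) \<le> \<bar>f x\<bar> * C" for k
    proof (rule AE_I2)
      fix x
      have "\<bar>Re (smoothed (step k) x)\<bar> \<le> C"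
        using abs_Re_le_cmod[of "smoothed (step k) x"] norm_smoothed_le[of "step k" x] by (simp add: C_def)
      then show "norm (f x * Re (smoothed (step k) x)) \<le> \<bar>f x\<bar> * C"
        by (simp add: abs_mult mult_left_mono)
    qed
  qed (use f in auto)
  have B0: "B \<ge> 0" using B[of 0] by linarith
  have ibd: "norm (integral\<^sup>L lborel (\<lambda>v. f (y + s *\<^sub>R v) * gauss v)) \<le> B" for y s
  proof -
    have "norm (integral\<^sup>L lborel (\<lambda>v. f (y + s *\<^sub>R v) * gauss v)) \<le> integral\<^sup>L lborel (\<lambda>v::real^'n. B * gauss v)"
      by (rule Bochner_Integration.integral_norm_bound_integral)
         (auto intro!: Bochner_Integration.integrable_bound[where f="\<lambda>v. B * gauss v"] integrable_mult_right integrable_gauss mult_right_mono B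
            simp: abs_mult B0)
    then show ?thesis by (simp add: integral_gauss)
  qed
  show "(\<lambda>k. integral\<^sup>L lborel (\<lambda>x. f x * Re (smoothed (step k) x))) \<longlonglongrightarrow> integral\<^sup>L \<mu> f"
    unfolding integral_smoothed[OF step_pos f]
  proof (rule integral_dominated_convergence[where w="\<lambda>_. B"])
    show "AE y in \<mu>. (\<lambda>k. integral\<^sup>L lborel (\<lambda>v. f (y + step k *\<^sub>R v) * gauss v)) \<longlonglongrightarrow> f y"
    proof (rule AE_I2)
      fix y :: "real^'n"
      have "(\<lambda>k. integral\<^sup>L lborel (\<lambda>v. f (y + step k *\<^sub>R v) * gauss v)) \<longlonglongrightarrow> integral\<^sup>L lborel (\<lambda>v::real^'n. f y * gauss v)"
      proof (rule integral_dominated_convergence[where w="\<lambda>v. B * gauss v"])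
        show "AE v in lborel. (\<lambda>k. f (y + step k *\<^sub>R v) * gauss v) \<longlonglongrightarrow> f y * gauss v"
        proof (rule AE_I2)
          fix v :: "real^'n"
          have "(\<lambda>k. y + step k *\<^sub>R v) \<longlonglongrightarrow> y + 0 *\<^sub>R v" by (intro tendsto_intros step_lim)
          then have "(\<lambda>k. f (y + step k *\<^sub>R v)) \<longlonglongrightarrow> f (y + 0 *\<^sub>R v)"
            by (intro continuous_on_tendsto_compose[OF c]) auto
          then show "(\<lambda>k. f (y + step k *\<^sub>R v) * gauss v) \<longlonglongrightarrow> f y * gauss v"
            by (intro tendsto_intros) simp
        qed
        show "AE v in lborel. norm (f (y + step k *\<^sub>R v) * gauss v) \<le> B * gauss v" for k
          by (auto simp: abs_mult intro!: mult_right_mono B)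
      qed (use integrable_gauss in auto)
      then show "(\<lambda>k. integral\<^sup>L lborel (\<lambda>v. f (y + step k *\<^sub>R v) * gauss v)) \<longlonglongrightarrow> f y"
        by (simp add: integral_gauss)
    qed
    show "AE y in \<mu>. norm (integral\<^sup>L lborel (\<lambda>v. f (y + step k *\<^sub>R v) * gauss v)) \<le> B" for k
      using ibd by (intro AE_I2) blast
    show "(\<lambda>y. integral\<^sup>L lborel (\<lambda>v. f (y + step k *\<^sub>R v) * gauss v)) \<in> borel_measurable \<mu>" for k
      by (rule sigma_finite_measure.borel_measurable_lebesgue_integral[OF sigma_finite_lborel]) measurable
  qed (use mu_measurable[of f] in auto)
qed

theorem inversion: "\<mu> = density lborel (\<lambda>x. ennreal (Re (inv_transform x)))"
proof (rule measure_eqI_bounded_open)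
  show "finite_measure \<mu>" by unfold_locales
  fix U :: "(real^'n) set" assume U: "open U" "bounded U"
  then have [measurable]: "U \<in> sets borel" by simp
  \<comment> \<open>Continuous functions supported in \<open>U\<close> that converge pointwise to
    its indicator. Distance to an empty set is 0 by convention, so the complement has to be
    nonempty; boundedness of \<open>U\<close> guarantees this.\<close>
  define f where "f k x = min 1 (real k * infdist x (- U))" for k and x :: "real^'n"
  have ne: "- U \<noteq> {}" using U(2) not_bounded_UNIV[where 'a="real^'n"] by (metis Compl_empty_eq double_compl)
  have cl: "closed (- U)" using U(1) by (rule closed_Compl)
  have f0: "f k x = 0" if "x \<notin> U" for k x using that ne cl by (simp add: f_def infdist_zero)
  have f1: "0 \<le> f k x" "f k x \<le> 1" for k x by (auto simp: f_def infdist_nonneg)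
  have fU: "\<bar>f k x\<bar> \<le> indicator U x" for k x using f0[of x k] f1[of k x] by (auto split: split_indicator)
  have flim: "(\<lambda>k. f k x) \<longlonglongrightarrow> indicator U x" for x
  proof (cases "x \<in> U")
    case True
    then have pos: "infdist x (- U) > 0" using ne cl by (metis ComplD in_closed_iff_infdist_zero infdist_nonneg less_le)
    have "\<forall>\<^sub>F k in sequentially. f k x = 1"
    proof (rule eventually_sequentiallyI)
      fix k assume "k \<ge> nat \<lceil>1 / infdist x (- U)\<rceil>"
      then have "1 / infdist x (- U) \<le> real k" by linarith
      then show "f k x = 1" using pos by (simp add: f_def field_simps)
    qed
    then show ?thesis using True by (simp add: tendsto_eventually)
  qed (simp add: f0)
  have fc: "continuous_on UNIV (f k)" for k unfolding f_def[abs_def] by (intro continuous_intros)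
  then have [measurable]: "f k \<in> borel_measurable borel" for k by (rule borel_measurable_continuous_onI)
  have Ufin: "emeasure lborel U < \<infinity>" by (rule emeasure_bounded_finite[OF U(2)])
  have iU: "integrable lborel (indicator U :: _ \<Rightarrow> real)"
    using Ufin by (simp add: integrable_indicator_iff)
  have fi: "integrable lborel (f k)" for k
    by (rule Bochner_Integration.integrable_bound[OF iU]) (use fU in \<open>auto intro!: AE_I2\<close>)
  define C where "C = 1 / (2 * pi) ^ CARD('n) * integral\<^sup>L lborel (\<lambda>z. norm (\<phi> z))"
  have gC: "\<bar>Re (inv_transform x)\<bar> \<le> C" for x
  proof -
    have "norm (inv_transform x) \<le> C"
      by (rule LIMSEQ_le_const2[OF tendsto_norm[OF smoothed_lim]]) (use norm_smoothed_le in \<open>auto simp only: C_def\<close>)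
    then show ?thesis using abs_Re_le_cmod order_trans by blast
  qed
  have iUg: "integrable lborel (\<lambda>x. indicator U x * Re (inv_transform x))"
    by (rule Bochner_Integration.integrable_bound[where f="\<lambda>x. indicator U x * C"])
       (use iU gC in \<open>auto intro!: AE_I2 integrable_mult_left simp: abs_mult intro: order_trans[OF _ abs_ge_self] split: split_indicator\<close>)
  have "(\<lambda>k. integral\<^sup>L lborel (\<lambda>x. f k x * Re (inv_transform x))) \<longlonglongrightarrow> integral\<^sup>L lborel (\<lambda>x. indicator U x * Re (inv_transform x))"
  proof (rule integral_dominated_convergence[where w="\<lambda>x. indicator U x * C"])
    show "AE x in lborel. (\<lambda>k. f k x * Re (inv_transform x)) \<longlonglongrightarrow> indicator U x * Re (inv_transform x)"
      by (intro AE_I2 tendsto_intros flim)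
    show "AE x in lborel. norm (f k x * Re (inv_transform x)) \<le> indicator U x * C" for k
      using fU gC by (intro AE_I2) (auto simp: abs_mult intro!: mult_mono)
  qed (use iU in auto)
  moreover have "(\<lambda>k. integral\<^sup>L \<mu> (f k)) \<longlonglongrightarrow> integral\<^sup>L \<mu> (indicator U)"
    by (rule integral_dominated_convergence[where w="\<lambda>_. 1"]) (use flim f1 in \<open>auto intro!: AE_I2 mu_measurable\<close>)
  moreover have "integral\<^sup>L lborel (\<lambda>x. f k x * Re (inv_transform x)) = integral\<^sup>L \<mu> (f k)" for k
    by (rule integral_inv_transform[OF fc fi, of k 1]) (use f1 in auto)
  ultimately have eq: "integral\<^sup>L \<mu> (indicator U) = integral\<^sup>L lborel (\<lambda>x. indicator U x * Re (inv_transform x))"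
    using LIMSEQ_unique by simp blast
  have "emeasure (density lborel (\<lambda>x. ennreal (Re (inv_transform x)))) U = (\<integral>\<^sup>+x. ennreal (indicator U x * Re (inv_transform x)) \<partial>lborel)"
    by (subst emeasure_density) (auto intro!: nn_integral_cong split: split_indicator)
  also have "\<dots> = ennreal (integral\<^sup>L lborel (\<lambda>x. indicator U x * Re (inv_transform x)))"
    by (rule nn_integral_eq_integral[OF iUg]) (simp add: inv_transform_nonneg)
  also have "\<dots> = emeasure \<mu> U"
    unfolding eq[symmetric] by (simp add: emeasure_eq_measure)
  finally show "emeasure \<mu> U = emeasure (density lborel (\<lambda>x. ennreal (Re (inv_transform x)))) U" by simp
qed simp_all

end

section \<open>The characteristic exponent\<close>

definition stable_kernel :: "real \<Rightarrow> real \<Rightarrow> complex" where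
  "stable_kernel \<alpha> t = complex_of_real (\<bar>t\<bar> powr \<alpha>) * (1 - \<i> * complex_of_real (tan (pi * \<alpha> / 2)) * complex_of_real (sgn t))"

lemma stable_V_eq: "stable_V \<alpha> lam u = integral\<^sup>L lam (\<lambda>v. stable_kernel \<alpha> (u \<bullet> v))"
  by (simp add: stable_V_def stable_kernel_def)

text \<open>Absorbing the sign into \<open>t * \<bar>t\<bar> powr (\<alpha> - 1)\<close> removes the
  apparent jump at 0, so continuity for \<open>\<alpha> > 1\<close> becomes visible.\<close>

lemma stable_kernel_alt:
  "stable_kernel \<alpha> t = complex_of_real (\<bar>t\<bar> powr \<alpha>) - \<i> * complex_of_real (tan (pi * \<alpha> / 2)) * complex_of_real (t * \<bar>t\<bar> powr (\<alpha> - 1))"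
proof -
  have "\<bar>t\<bar> powr \<alpha> * sgn t = t * \<bar>t\<bar> powr (\<alpha> - 1)"
  proof (cases "t = 0")
    case False
    then have "\<bar>t\<bar> powr \<alpha> = \<bar>t\<bar> * \<bar>t\<bar> powr (\<alpha> - 1)" by (simp add: powr_diff)
    then show ?thesis using False by (simp add: sgn_if)
  qed simp
  then have "complex_of_real (\<bar>t\<bar> powr \<alpha>) * complex_of_real (sgn t) = complex_of_real (t * \<bar>t\<bar> powr (\<alpha> - 1))"
    by (simp flip: of_real_mult)
  then show ?thesis
    unfolding stable_kernel_def right_diff_distrib by (simp add: mult_ac)
qed

lemma continuous_stable_kernel: "\<alpha> > 1 \<Longrightarrow> continuous_on UNIV (stable_kernel \<alpha>)"
  unfolding stable_kernel_alt[abs_def] by (intro continuous_intros continuous_on_powr') auto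

lemma norm_stable_kernel_le: "norm (stable_kernel \<alpha> t) \<le> \<bar>t\<bar> powr \<alpha> * (1 + \<bar>tan (pi * \<alpha> / 2)\<bar>)"
proof -
  have "norm (1 - \<i> * complex_of_real (tan (pi * \<alpha> / 2)) * complex_of_real (sgn t)) \<le> 1 + \<bar>tan (pi * \<alpha> / 2)\<bar> * \<bar>sgn t\<bar>"
    by (rule order_trans[OF norm_triangle_ineq4]) (simp add: norm_mult)
  also have "\<dots> \<le> 1 + \<bar>tan (pi * \<alpha> / 2)\<bar>" by (simp add: abs_sgn_eq)
  finally show ?thesis unfolding stable_kernel_def norm_mult by (simp add: mult_left_mono)
qed

section \<open>Bounds on the exponent from nondegeneracy and the choice of R\<close>

locale stable_law =
  fixes \<mu> lam :: "(real^'n::finite) measure" and \<alpha> R :: real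
  assumes d2: "CARD('n) \<ge> 2"
    and alpha: "1 < \<alpha>"
    and lam: "finite_measure lam" "sets lam = sets (restrict_space borel (sphere (0::real^'n) 1))"
    and mu: "prob_space \<mu>" "sets \<mu> = sets borel"
    and charf: "\<forall>z. integral\<^sup>L \<mu> (\<lambda>x. cis (z \<bullet> x))
                   = exp (- complex_of_real (norm z powr \<alpha>) * stable_V \<alpha> lam (sgn z))"
    and nondeg: "nondegenerate \<mu>"
    and R: "R > rho0 \<alpha> lam"
begin

interpretation L: finite_measure lam by (rule lam)
interpretation M: prob_space \<mu> by (rule mu)

abbreviation "V \<equiv> stable_V \<alpha> lam"
abbreviation "Vs \<equiv> Vstar \<alpha> lam R"

lemma space_lam: "space lam = sphere 0 1"
  using sets_eq_imp_space_eq[OF lam(2)] by (simp add: space_restrict_space)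

lemma lam_measurable: "f \<in> borel_measurable borel \<Longrightarrow> f \<in> borel_measurable lam"
  unfolding measurable_cong_sets[OF lam(2) refl] by (rule measurable_restrict_space1)

lemma kernel_lam_measurable: "(\<lambda>v. stable_kernel \<alpha> (u \<bullet> v)) \<in> borel_measurable lam"
  by (intro lam_measurable borel_measurable_continuous_onI continuous_on_compose2[OF continuous_stable_kernel[OF alpha]] continuous_intros) auto

lemma norm_kernel_lam:
  assumes "v \<in> space lam" "norm u \<le> K"
  shows "norm (stable_kernel \<alpha> (u \<bullet> v)) \<le> K powr \<alpha> * (1 + \<bar>tan (pi * \<alpha> / 2)\<bar>)"
proof -
  have "\<bar>u \<bullet> v\<bar> \<le> K" using Cauchy_Schwarz_ineq2[of u v] assms by (simp add: space_lam)
  then have "\<bar>u \<bullet> v\<bar> powr \<alpha> \<le> K powr \<alpha>" using alpha by (intro powr_mono2) auto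
  then have "\<bar>u \<bullet> v\<bar> powr \<alpha> * (1 + \<bar>tan (pi * \<alpha> / 2)\<bar>) \<le> K powr \<alpha> * (1 + \<bar>tan (pi * \<alpha> / 2)\<bar>)"
    by (intro mult_right_mono) auto
  then show ?thesis using norm_stable_kernel_le order_trans by blast
qed

lemma kernel_lam_integrable: "integrable lam (\<lambda>v. stable_kernel \<alpha> (u \<bullet> v))"
  by (rule L.integrable_const_bound[OF _ kernel_lam_measurable, where B="norm u powr \<alpha> * (1 + \<bar>tan (pi * \<alpha> / 2)\<bar>)"])
     (intro AE_I2 norm_kernel_lam, auto)

lemma continuous_V: "continuous_on UNIV V"
  unfolding continuous_on_sequentially
proof (intro allI ballI impI)
  fix x :: "nat \<Rightarrow> real^'n" and a assume "(\<forall>n. x n \<in> UNIV) \<and> x \<longlonglongrightarrow> a"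
  then have x: "x \<longlonglongrightarrow> a" by simp
  then have "Bseq x" by (intro convergent_imp_Bseq convergentI)
  then obtain K where K: "\<And>n. norm (x n) \<le> K" by (auto simp: Bseq_def)
  show "(V \<circ> x) \<longlonglongrightarrow> V a"
    unfolding stable_V_eq o_def
  proof (rule integral_dominated_convergence[where w="\<lambda>_. K powr \<alpha> * (1 + \<bar>tan (pi * \<alpha> / 2)\<bar>)"])
    show "AE v in lam. (\<lambda>i. stable_kernel \<alpha> (x i \<bullet> v)) \<longlonglongrightarrow> stable_kernel \<alpha> (a \<bullet> v)"
      by (intro AE_I2 continuous_on_tendsto_compose[OF continuous_stable_kernel[OF alpha]] tendsto_intros x) auto
    show "AE v in lam. norm (stable_kernel \<alpha> (x i \<bullet> v)) \<le> K powr \<alpha> * (1 + \<bar>tan (pi * \<alpha> / 2)\<bar>)" for i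
      by (intro AE_I2 norm_kernel_lam K)
  qed (auto intro: kernel_lam_measurable)
qed

lemma Re_V: "Re (V u) = integral\<^sup>L lam (\<lambda>v. \<bar>u \<bullet> v\<bar> powr \<alpha>)"
  unfolding stable_V_eq by (subst integral_Re[OF kernel_lam_integrable, symmetric]) (simp add: stable_kernel_def)

lemma Re_V_nonneg: "Re (V u) \<ge> 0"
  unfolding Re_V by (rule integral_nonneg_AE) simp

text \<open>If \<open>Re (V u) = 0\<close>, then \<open>lam\<close> is carried by the hyperplane
  orthogonal to \<open>u\<close>, so \<open>V\<close> vanishes along the line through
  \<open>u\<close>. The characteristic function of \<open>u \<bullet> X\<close> is then constantly
  1, and \<open>X\<close> is confined to that hyperplane, contrary to nondegeneracy.\<close>

lemma Re_V_pos:
  assumes u: "norm u = 1"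
  shows "Re (V u) > 0"
proof (rule ccontr)
  assume "\<not> Re (V u) > 0"
  then have z: "Re (V u) = 0" using Re_V_nonneg[of u] by simp
  have i: "integrable lam (\<lambda>v. \<bar>u \<bullet> v\<bar> powr \<alpha>)"
    using integrable_Re[OF kernel_lam_integrable[of u]] by (simp add: stable_kernel_def)
  have "AE v in lam. \<bar>u \<bullet> v\<bar> powr \<alpha> = 0"
    using z unfolding Re_V by (subst (asm) integral_nonneg_eq_0_iff_AE[OF i]) auto
  then have ae: "AE v in lam. u \<bullet> v = 0" by eventually_elim simp
  have V0: "V (c *\<^sub>R u) = 0" for c
  proof -
    have "AE v in lam. stable_kernel \<alpha> ((c *\<^sub>R u) \<bullet> v) = 0"
      using ae by eventually_elim (simp add: stable_kernel_def)
    then have "V (c *\<^sub>R u) = integral\<^sup>L lam (\<lambda>v. 0)"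
      unfolding stable_V_eq by (intro integral_cong_AE kernel_lam_measurable borel_measurable_const)
    then show ?thesis by simp
  qed
  have ch: "integral\<^sup>L \<mu> (\<lambda>x. cis (t * (u \<bullet> x))) = 1" for t
  proof -
    have "sgn (t *\<^sub>R u) = sgn t *\<^sub>R u" using u by (simp add: sgn_scaleR sgn_div_norm[of u])
    then show ?thesis using charf[rule_format, of "t *\<^sub>R u"] V0[of "sgn t"] by simp
  qed
  have m: "(\<lambda>x. u \<bullet> x) \<in> borel_measurable \<mu>"
    unfolding measurable_cong_sets[OF mu(2) refl] by simp
  define D where "D = distr \<mu> borel (\<lambda>x. u \<bullet> x)"
  interpret D: prob_space D unfolding D_def by (rule M.prob_space_distr[OF m])
  interpret Z: prob_space "return borel (0::real)" by (rule prob_space_return) simp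
  have "D = return borel 0"
  proof (rule Levy_uniqueness)
    show "real_distribution D" unfolding D_def by (intro M.real_distribution_distr m)
    show "real_distribution (return borel 0)"
      by unfold_locales auto
    have "char D t = 1" for t
      unfolding char_def D_def using ch[of t] by (subst integral_distr[OF m]) (auto simp: cis_conv_exp)
    moreover have "char (return borel 0) t = 1" for t
      unfolding char_def by (subst integral_return) auto
    ultimately show "char D = char (return borel 0)" by auto
  qed
  then have "emeasure D (- {0}) = 0" by (simp add: indicator_def)
  moreover have "(\<lambda>x. u \<bullet> x) -` (- {0}) \<inter> space \<mu> = {x. u \<bullet> x \<noteq> 0}"
    using sets_eq_imp_space_eq[OF mu(2)] by auto
  ultimately have null: "emeasure \<mu> {x. u \<bullet> x \<noteq> 0} = 0"
    unfolding D_def using emeasure_distr[OF m, of "- {0}"] by simp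
  have "measure_support \<mu> \<subseteq> {x. u \<bullet> x = 0}"
  proof (rule subsetI, rule ccontr)
    fix x assume x: "x \<in> measure_support \<mu>" and "x \<notin> {x. u \<bullet> x = 0}"
    then have e: "\<bar>u \<bullet> x\<bar> > 0" by simp
    \<comment> \<open>The functional \<open>u \<bullet> y\<close> is 1-Lipschitz in
      \<open>y\<close>, so this ball around a point off the hyperplane misses it and is therefore
      null.\<close>
    have "ball x \<bar>u \<bullet> x\<bar> \<subseteq> {x. u \<bullet> x \<noteq> 0}"
    proof
      fix y assume "y \<in> ball x \<bar>u \<bullet> x\<bar>"
      then have "\<bar>u \<bullet> (x - y)\<bar> < \<bar>u \<bullet> x\<bar>"
        using Cauchy_Schwarz_ineq2[of u "x - y"] u by (simp add: dist_norm)
      then show "y \<in> {x. u \<bullet> x \<noteq> 0}" by (auto simp: inner_diff_right)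
    qed
    then have "emeasure \<mu> (ball x \<bar>u \<bullet> x\<bar>) \<le> emeasure \<mu> {x. u \<bullet> x \<noteq> 0}"
      by (rule emeasure_mono) (simp add: mu(2))
    moreover have "0 < emeasure \<mu> (ball x \<bar>u \<bullet> x\<bar>)"
      using x e by (simp only: measure_support_def mem_Collect_eq)
    ultimately show False using null by (simp only: not_le[symmetric]) simp
  qed
  moreover have "affine {x. u \<bullet> x = 0}" by (rule affine_hyperplane)
  moreover have "{x. u \<bullet> x = 0} \<noteq> UNIV"
  proof
    assume "{x. u \<bullet> x = 0} = UNIV"
    then have "u \<bullet> u = 0" by blast
    then show False using u by simp
  qed
  ultimately show False using nondeg unfolding nondegenerate_def by blast
qed

lemma sphere_nonempty: "sphere (0::real^'n) 1 \<noteq> {}"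
  using norm_dir[of "0::real^'n"] by force

lemma Re_V_lower: "\<exists>c>0. \<forall>u. norm u = 1 \<longrightarrow> Re (V u) \<ge> c"
proof -
  have "continuous_on (sphere 0 1) (\<lambda>u. Re (V u))"
    by (intro continuous_intros continuous_on_subset[OF continuous_V]) auto
  then obtain u where u: "u \<in> sphere 0 1" "\<forall>y\<in>sphere 0 1. Re (V u) \<le> Re (V y)"
    using continuous_attains_inf[OF compact_sphere sphere_nonempty] by blast
  then show ?thesis using Re_V_pos[of u] by (intro exI[of _ "Re (V u)"]) auto
qed

text \<open>A supremum of reals bounds its terms only if the set is bounded above. Compactness of
  the sphere and a nonvanishing denominator give that, so \<open>R > rho0\<close> can be used
  pointwise.\<close>

lemma R_bound:
  assumes u: "norm u = 1"
  shows "(cmod (V u))\<^sup>2 < 2 * R * Re (V u)" "R > 0"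
proof -
  let ?f = "\<lambda>u. (cmod (V u))\<^sup>2 / (2 * Re (V u))"
  have "continuous_on (sphere 0 1) ?f"
  proof -
    have "2 * Re (V u) \<noteq> 0" if "u \<in> sphere 0 1" for u
      using Re_V_pos[of u] that by simp
    then show ?thesis by (intro continuous_intros continuous_on_subset[OF continuous_V] ballI) simp_all
  qed
  then have "bounded (?f ` sphere 0 1)"
    by (intro compact_imp_bounded compact_continuous_image) auto
  then have bdd: "bdd_above (?f ` sphere 0 1)" by (rule bounded_imp_bdd_above)
  have "?f u \<le> rho0 \<alpha> lam" unfolding rho0_def using u by (intro cSUP_upper bdd) simp
  then have fu: "?f u < R" using R by linarith
  then show "(cmod (V u))\<^sup>2 < 2 * R * Re (V u)" using Re_V_pos[OF u] by (simp add: divide_less_eq mult_ac)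
  have "0 \<le> ?f u" using Re_V_pos[OF u] by simp
  then show "R > 0" using fu by linarith
qed

lemma R_pos: "R > 0"
  using R_bound(2)[OF norm_dir[of 0]] .

lemma continuous_Vs: "continuous_on UNIV Vs"
  unfolding Vstar_def[abs_def] by (intro continuous_intros continuous_V)

text \<open>The square of \<open>cmod (R - V)\<close> is
  \<open>R\<^sup>2 - 2 * R * Re V + (cmod V)\<^sup>2\<close>, and \<open>R_bound\<close> says that
  this is below \<open>R\<^sup>2\<close>. Attaining the maximum on the sphere makes the gap
  uniform.\<close>

lemma Vs_bound: "\<exists>q. 0 < q \<and> q < R \<and> (\<forall>u. norm u = 1 \<longrightarrow> cmod (Vs u) \<le> q)"
proof -
  have "continuous_on (sphere 0 1) (\<lambda>u. cmod (Vs u))"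
    by (intro continuous_intros continuous_on_subset[OF continuous_Vs]) auto
  then obtain u where u: "u \<in> sphere 0 1" "\<forall>y\<in>sphere 0 1. cmod (Vs y) \<le> cmod (Vs u)"
    using continuous_attains_sup[OF compact_sphere sphere_nonempty] by blast
  have u1: "norm u = 1" using u(1) by simp
  define a b where "a = Re (V u)" and "b = Im (V u)"
  have "(cmod (Vs u))\<^sup>2 = (R - a)\<^sup>2 + b\<^sup>2"
    by (simp add: Vstar_def cmod_power2 a_def b_def)
  also have "\<dots> = R\<^sup>2 - 2 * R * a + (a\<^sup>2 + b\<^sup>2)"
    by (simp add: power2_diff)
  also have "a\<^sup>2 + b\<^sup>2 = (cmod (V u))\<^sup>2"
    by (simp add: cmod_power2 a_def b_def)
  also have "R\<^sup>2 - 2 * R * a + (cmod (V u))\<^sup>2 < R\<^sup>2"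
    using R_bound(1)[OF u1] by (simp add: a_def)
  finally have lt: "cmod (Vs u) < R" using R_pos by (intro power2_less_imp_less[of _ R]) linarith+
  show ?thesis
  \<comment> \<open>The maximum with \<open>R / 2\<close> keeps \<open>q\<close> positive even where
    \<open>Vstar\<close> is identically 0.\<close>
  proof (intro exI[of _ "max (cmod (Vs u)) (R / 2)"] conjI allI impI)
    show "0 < max (cmod (Vs u)) (R / 2)" using R_pos by linarith
    show "max (cmod (Vs u)) (R / 2) < R" using R_pos lt by linarith
    fix y :: "real^'n" assume "norm y = 1"
    then have "cmod (Vs y) \<le> cmod (Vs u)" using u(2) by simp
    then show "cmod (Vs y) \<le> max (cmod (Vs u)) (R / 2)" by linarith
  qed
qed

end

section \<open>Double series\<close>

text \<open>The series of the theorem are iterated sums, whereas the analysis uses unordered sums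
  over pairs; this converts the latter into the former.\<close>

lemma
  fixes f :: "nat \<Rightarrow> nat \<Rightarrow> 'a::banach"
  assumes "((\<lambda>(n, k). f n k) has_sum S) UNIV"
  shows summable_has_sum_nat_product: "summable (f n)"
    and sums_has_sum_nat_product: "(\<lambda>n. \<Sum>k. f n k) sums S"
proof -
  have S: "((\<lambda>(n, k). f n k) has_sum S) (Sigma UNIV (\<lambda>_. UNIV))" using assms by simp
  have 1: "f n summable_on UNIV" for n
  proof -
    have "(\<lambda>(n, k). f n k) summable_on {n} \<times> UNIV"
      by (rule summable_on_subset_banach[OF has_sum_imp_summable[OF assms]]) simp
    moreover have "bij_betw (Pair n) UNIV ({n} \<times> UNIV)"
      by (auto simp: bij_betw_def inj_on_def)
    ultimately have "(\<lambda>k. (\<lambda>(n, k). f n k) (n, k)) summable_on UNIV"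
      using summable_on_reindex_bij_betw by blast
    then show ?thesis by simp
  qed
  have 2: "(f n has_sum infsum (f n) UNIV) UNIV" for n using 1 by (rule has_sum_infsum)
  show "summable (f n)" using 1 by (rule summable_on_imp_summable)
  have 3: "(\<Sum>k. f n k) = infsum (f n) UNIV" for n
    using has_sum_imp_sums[OF 2[of n]] by (rule sums_unique[symmetric])
  have "((\<lambda>n. infsum (f n) UNIV) has_sum S) UNIV"
    by (rule has_sum_SigmaD[OF S]) (use 2 in simp)
  then show "(\<lambda>n. \<Sum>k. f n k) sums S"
    unfolding 3 by (rule has_sum_imp_sums)
qed

lemma has_sum_exp:
  fixes x :: "'a::{real_normed_field, banach}"
  shows "((\<lambda>n. x ^ n / fact n) has_sum exp x) UNIV"
proof (rule norm_summable_imp_has_sum)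
  have eq: "x ^ n /\<^sub>R fact n = x ^ n / fact n" for n by (simp add: scaleR_conv_of_real field_simps)
  show "summable (\<lambda>n. norm (x ^ n / fact n))" using summable_norm_exp[of x] unfolding eq .
  show "(\<lambda>n. x ^ n / fact n) sums exp x" using exp_converges[of x] unfolding eq .
qed

lemma has_sum_exp_mult_exp:
  fixes x y :: "'a::{real_normed_field, banach}"
  shows "((\<lambda>(n, k). (x ^ n / fact n) * (y ^ k / fact k)) has_sum (exp x * exp y)) UNIV"
proof -
  let ?f = "\<lambda>p. case p of (n, k) \<Rightarrow> (x ^ n / fact n) * (y ^ k / fact k)"
  have "(\<lambda>p. norm (?f p)) summable_on Sigma UNIV (\<lambda>_. UNIV)"
  proof (rule summable_on_SigmaI)
    show "((\<lambda>k. norm (?f (n, k))) has_sum (norm x ^ n / fact n * exp (norm y))) UNIV" for n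
      using has_sum_cmult_right[OF has_sum_exp[of "norm y"], of "norm x ^ n / fact n"]
      by (simp add: norm_mult norm_divide norm_power)
    show "(\<lambda>n. norm x ^ n / fact n * exp (norm y)) summable_on UNIV"
      by (intro summable_on_cmult_left has_sum_imp_summable[OF has_sum_exp])
  qed auto
  then have "?f summable_on Sigma UNIV (\<lambda>_. UNIV)" by (rule abs_summable_summable)
  then obtain S where S: "(?f has_sum S) (Sigma UNIV (\<lambda>_. UNIV))" by (auto simp: summable_on_def)
  have "((\<lambda>n. x ^ n / fact n * exp y) has_sum S) UNIV"
  proof (rule has_sum_SigmaD[OF S])
    show "((\<lambda>k. ?f (n, k)) has_sum (x ^ n / fact n * exp y)) UNIV" for n
      using has_sum_cmult_right[OF has_sum_exp[of y], of "x ^ n / fact n"] by simp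
  qed
  moreover have "((\<lambda>n. x ^ n / fact n * exp y) has_sum (exp x * exp y)) UNIV"
    by (rule has_sum_cmult_left[OF has_sum_exp])
  ultimately have "S = exp x * exp y" by (rule has_sum_unique)
  then show ?thesis using S by simp
qed

text \<open>Enumerating pairs by \<open>prod_decode\<close> reduces the claim to termwise
  integration of a single series; absolute convergence makes the enumeration immaterial.\<close>

lemma has_sum_integral_nat_product:
  fixes T :: "nat \<Rightarrow> nat \<Rightarrow> 'a \<Rightarrow> complex"
  assumes T: "\<And>n k. integrable M (T n k)"
    and N: "(\<lambda>(n, k). integral\<^sup>L M (\<lambda>z. norm (T n k z))) summable_on UNIV"
    and G: "AE z in M. ((\<lambda>(n, k). T n k z) has_sum G z) UNIV"
    and Gm: "G \<in> borel_measurable M"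
  shows "((\<lambda>(n, k). integral\<^sup>L M (T n k)) has_sum integral\<^sup>L M G) UNIV"
proof -
  define f where "f i = (case prod_decode i of (n, k) \<Rightarrow> T n k)" for i
  have bij: "bij_betw prod_decode UNIV UNIV" by (rule bij_prod_decode)
  have f_eq: "f i z = (\<lambda>(n, k). T n k z) (prod_decode i)" for i z by (simp add: f_def split_beta)
  have fi: "integrable M (f i)" for i by (simp add: f_def split_beta T)
  have ae: "AE z in M. summable (\<lambda>i. norm (f i z)) \<and> (\<lambda>i. f i z) sums G z"
    using G
  proof eventually_elim
    case (elim z)
    have h: "((\<lambda>i. f i z) has_sum G z) UNIV"
      unfolding f_eq by (subst has_sum_reindex_bij_betw[OF bij]) (rule elim)
    have "summable (\<lambda>i. norm (f i z))"
      using has_sum_imp_summable[OF h]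
      by (intro summable_on_imp_summable summable_on_iff_abs_summable_on_complex[THEN iffD1])
    then show ?case using has_sum_imp_sums[OF h] by simp
  qed
  have eqN: "(\<lambda>i. integral\<^sup>L M (\<lambda>z. norm (f i z))) = (\<lambda>i. (\<lambda>(n, k). integral\<^sup>L M (\<lambda>z. norm (T n k z))) (prod_decode i))"
    by (simp add: f_def split_beta)
  have sN: "summable (\<lambda>i. integral\<^sup>L M (\<lambda>z. norm (f i z)))"
    unfolding eqN by (intro summable_on_imp_summable) (simp add: summable_on_reindex_bij_betw[OF bij] N)
  have ae1: "AE z in M. summable (\<lambda>i. norm (f i z))" using ae by eventually_elim simp
  have "(\<lambda>i. integral\<^sup>L M (f i)) sums (\<integral>z. (\<Sum>i. f i z) \<partial>M)"
    by (rule sums_integral[OF fi ae1 sN])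
  also have "(\<integral>z. (\<Sum>i. f i z) \<partial>M) = integral\<^sup>L M G"
  proof (rule integral_cong_AE)
    show "(\<lambda>z. \<Sum>i. f i z) \<in> borel_measurable M"
      using integrable_suminf[OF fi ae1 sN] by (rule borel_measurable_integrable)
    show "AE z in M. (\<Sum>i. f i z) = G z" using ae by eventually_elim (simp add: sums_iff)
  qed (rule Gm)
  finally have s: "(\<lambda>i. integral\<^sup>L M (f i)) sums integral\<^sup>L M G" .
  have "summable (\<lambda>i. norm (integral\<^sup>L M (f i)))"
    by (rule summable_comparison_test'[OF sN, of 0]) simp
  from norm_summable_imp_has_sum[OF this s]
  have "((\<lambda>i. (\<lambda>(n, k). integral\<^sup>L M (T n k)) (prod_decode i)) has_sum integral\<^sup>L M G) UNIV"
    by (simp add: f_def split_beta)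
  then show ?thesis by (subst (asm) has_sum_reindex_bij_betw[OF bij])
qed

section \<open>The coefficients of the series\<close>

text \<open>Up to the factor \<open>fact k / \<alpha>\<close>, the integral of
  \<open>r ^ n * (r powr \<alpha>) ^ k * exp (- R * r powr \<alpha>)\<close> against
  \<open>r ^ (d - 1)\<close>.\<close>

definition gcoef :: "real \<Rightarrow> real \<Rightarrow> nat \<Rightarrow> nat \<Rightarrow> nat \<Rightarrow> real" where
  "gcoef \<alpha> R d n k = Gamma (real k + (real n + real d) / \<alpha>) / (fact k * R powr (real k + (real n + real d) / \<alpha>))"

lemma gcoef_nonneg: "\<alpha> > 0 \<Longrightarrow> R > 0 \<Longrightarrow> d > 0 \<Longrightarrow> gcoef \<alpha> R d n k \<ge> 0"
  unfolding gcoef_def by (intro divide_nonneg_nonneg less_imp_le[OF Gamma_real_pos]) (auto intro!: add_nonneg_pos)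

lemma has_bochner_integral_radial_powers:
  assumes a: "\<alpha> > 0" and R: "R > 0" and d: "d > 0"
  shows "has_bochner_integral (radial_measure (d - 1)) (\<lambda>r. r ^ n * (r powr \<alpha>) ^ k * exp (- R * r powr \<alpha>))
     (fact k * gcoef \<alpha> R d n k / \<alpha>)"
proof -
  have "has_bochner_integral (radial_measure (d - 1)) (\<lambda>r. r powr (real n + \<alpha> * real k) * exp (- R * r powr \<alpha>))
     (Gamma ((real n + \<alpha> * real k + real (d - 1) + 1) / \<alpha>) / (\<alpha> * R powr ((real n + \<alpha> * real k + real (d - 1) + 1) / \<alpha>)))"
    using a R by (intro has_bochner_integral_radial_powr_exp) auto
  moreover have "(real n + \<alpha> * real k + real (d - 1) + 1) / \<alpha> = real k + (real n + real d) / \<alpha>"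
    using a d by (simp add: of_nat_diff field_simps)
  moreover have "Gamma s / (\<alpha> * R powr s) = fact k * (Gamma s / (fact k * R powr s)) / \<alpha>" for s by simp
  moreover have "AE r in radial_measure (d - 1). r powr (real n + \<alpha> * real k) * exp (- R * r powr \<alpha>) = r ^ n * (r powr \<alpha>) ^ k * exp (- R * r powr \<alpha>)"
    using AE_radial_pos
  proof eventually_elim
    case (elim r)
    have "r powr (real n + \<alpha> * real k) = r ^ n * (r powr \<alpha>) ^ k"
      using elim by (simp add: powr_add powr_realpow powr_powr[symmetric])
    then show ?case by simp
  qed
  ultimately show ?thesis
    unfolding gcoef_def
    by (subst has_bochner_integral_cong_AE[where g="\<lambda>r. r powr (real n + \<alpha> * real k) * exp (- R * r powr \<alpha>)"]) auto
qed

lemma integrable_radial_exp: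
  assumes a: "\<alpha> > 0" and c: "c > 0"
  shows "integrable (radial_measure p) (\<lambda>r. exp (- c * r powr \<alpha>))"
  using has_bochner_integral_radial_powers[OF a c, of "Suc p" 0 0] by (auto intro: integrable.intros)

text \<open>Since \<open>\<alpha> > 1\<close>, the linear term \<open>K * r\<close> is at most
  \<open>c * r powr \<alpha>\<close> beyond \<open>r0\<close>, where \<open>r0\<close> solves
  \<open>c * r powr (\<alpha> - 1) = K\<close>. With \<open>c\<close> half of \<open>R - q\<close>,
  the other half is left for decay.\<close>

lemma integrable_radial_dominating:
  assumes a: "\<alpha> > 1" and q: "q < R" and K: "K \<ge> 0"
  shows "integrable (radial_measure p) (\<lambda>r. exp (K * r) * exp (q * r powr \<alpha>) * exp (- R * r powr \<alpha>))"
proof -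
  define c where "c = (R - q) / 2"
  have c: "c > 0" using q by (simp add: c_def)
  define r0 where "r0 = (K / c) powr (1 / (\<alpha> - 1))"
  have r0: "r0 \<ge> 0" by (simp add: r0_def)
  have bd: "K * r \<le> K * r0 + c * r powr \<alpha>" if r: "r > 0" for r
  proof (cases "r \<le> r0")
    case True
    then have "K * r \<le> K * r0" using K by (intro mult_left_mono) auto
    moreover have "c * r powr \<alpha> \<ge> 0" using c by simp
    ultimately show ?thesis by linarith
  next
    case False
    have "K / c = r0 powr (\<alpha> - 1)" using a K c by (simp add: r0_def powr_powr)
    also have "\<dots> \<le> r powr (\<alpha> - 1)" using False a r0 by (intro powr_mono2) auto
    finally have "K \<le> c * r powr (\<alpha> - 1)" using c by (simp add: field_simps)
    then have "K * r \<le> c * r powr (\<alpha> - 1) * r" using r by (intro mult_right_mono) auto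
    also have "\<dots> = c * r powr \<alpha>" using r by (simp add: powr_diff)
    finally show ?thesis using K r0 by (simp add: add_increasing)
  qed
  show ?thesis
  proof (rule Bochner_Integration.integrable_bound)
    show "integrable (radial_measure p) (\<lambda>r. exp (K * r0) * exp (- c * r powr \<alpha>))"
      using a c by (intro integrable_mult_right integrable_radial_exp) auto
    show "AE r in radial_measure p. norm (exp (K * r) * exp (q * r powr \<alpha>) * exp (- R * r powr \<alpha>)) \<le> norm (exp (K * r0) * exp (- c * r powr \<alpha>))"
      using AE_radial_pos
    proof eventually_elim
      case (elim r)
      have "q * r powr \<alpha> + - R * r powr \<alpha> = - 2 * c * r powr \<alpha>" by (simp add: c_def field_simps)
      then have "K * r + q * r powr \<alpha> + - R * r powr \<alpha> \<le> K * r0 + - c * r powr \<alpha>"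
        using bd[OF elim] by linarith
      then show ?case by (simp add: exp_add[symmetric] del: mult_minus_left)
    qed
  qed measurable
qed

text \<open>No estimate of Gamma is used: each term is \<alpha> times the integral of a product of
  terms of two exponential series, so every finite sum is at most \<alpha> times one fixed integral.
  The freedom in \<open>K\<close> absorbs all geometric losses in \<open>n\<close>.\<close>

lemma summable_gcoef:
  assumes a: "\<alpha> > 1" and q: "0 \<le> q" "q < R" and K: "K \<ge> 0" and d: "d > 0"
  shows "(\<lambda>(n, k). K ^ n / fact n * q ^ k * gcoef \<alpha> R d n k) summable_on UNIV"
proof (rule nonneg_bdd_above_summable_on)
  have R: "R > 0" and a0: "\<alpha> > 0" using q a by auto
  show "(case x of (n, k) \<Rightarrow> K ^ n / fact n * q ^ k * gcoef \<alpha> R d n k) \<ge> 0" for x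
    using gcoef_nonneg[OF a0 R d] q K by (auto split: prod.split)
  define h where "h x r = (case x of (n, k) \<Rightarrow> ((K * r) ^ n / fact n) * ((q * r powr \<alpha>) ^ k / fact k) * exp (- R * r powr \<alpha>))" for x :: "nat \<times> nat" and r
  let ?D = "\<lambda>r. exp (K * r) * exp (q * r powr \<alpha>) * exp (- R * r powr \<alpha>)"
  let ?N = "radial_measure (d - 1)"
  have hb: "has_bochner_integral ?N (h x) ((case x of (n, k) \<Rightarrow> K ^ n / fact n * q ^ k * gcoef \<alpha> R d n k) / \<alpha>)" for x
  proof -
    obtain n k where x: "x = (n, k)" by (cases x)
    have "has_bochner_integral ?N (\<lambda>r. (K ^ n / fact n * q ^ k / fact k) * (r ^ n * (r powr \<alpha>) ^ k * exp (- R * r powr \<alpha>)))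
       ((K ^ n / fact n * q ^ k / fact k) * (fact k * gcoef \<alpha> R d n k / \<alpha>))"
      by (intro has_bochner_integral_mult_right has_bochner_integral_radial_powers a0 R d)
    moreover have "h (n, k) = (\<lambda>r. (K ^ n / fact n * q ^ k / fact k) * (r ^ n * (r powr \<alpha>) ^ k * exp (- R * r powr \<alpha>)))"
      by (simp add: h_def fun_eq_iff power_mult_distrib)
    ultimately show ?thesis by (simp add: x mult.assoc)
  qed
  show "bdd_above (sum (\<lambda>(n, k). K ^ n / fact n * q ^ k * gcoef \<alpha> R d n k) ` {F. F \<subseteq> UNIV \<and> finite F})"
  proof (rule bdd_aboveI2)
    fix F :: "(nat \<times> nat) set" assume "F \<in> {F. F \<subseteq> UNIV \<and> finite F}"
    then have F: "finite F" by simp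
    have hi: "integrable ?N (h x)" and hI: "integral\<^sup>L ?N (h x) = (case x of (n, k) \<Rightarrow> K ^ n / fact n * q ^ k * gcoef \<alpha> R d n k) / \<alpha>" for x
      using hb[of x] by (auto intro: integrable.intros has_bochner_integral_integral_eq)
    have "(\<Sum>x\<in>F. case x of (n, k) \<Rightarrow> K ^ n / fact n * q ^ k * gcoef \<alpha> R d n k) = \<alpha> * (\<Sum>x\<in>F. integral\<^sup>L ?N (h x))"
      unfolding hI using a0 by (simp add: sum_distrib_left)
    also have "\<dots> = \<alpha> * integral\<^sup>L ?N (\<lambda>r. \<Sum>x\<in>F. h x r)"
      by (subst Bochner_Integration.integral_sum[OF hi]) simp
    also have "\<dots> \<le> \<alpha> * integral\<^sup>L ?N ?D"
    proof (intro mult_left_mono integral_mono_AE)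
      show "integrable ?N ?D" by (rule integrable_radial_dominating[OF a q(2) K])
      show "AE r in ?N. (\<Sum>x\<in>F. h x r) \<le> ?D r"
        using AE_radial_pos
      proof eventually_elim
        case (elim r)
        have "(\<Sum>x\<in>F. (\<lambda>(n, k). ((K * r) ^ n / fact n) * ((q * r powr \<alpha>) ^ k / fact k)) x) \<le> exp (K * r) * exp (q * r powr \<alpha>)"
          by (rule finite_sum_le_has_sum[OF has_sum_exp_mult_exp F]) (use K q elim in auto)
        then have "(\<Sum>x\<in>F. (\<lambda>(n, k). ((K * r) ^ n / fact n) * ((q * r powr \<alpha>) ^ k / fact k)) x) * exp (- R * r powr \<alpha>) \<le> ?D r"
          by (intro mult_right_mono) auto
        then show ?case by (simp add: h_def split_beta sum_distrib_right)
      qed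
    qed (use hi a0 in auto)
    finally show "(\<Sum>x\<in>F. case x of (n, k) \<Rightarrow> K ^ n / fact n * q ^ k * gcoef \<alpha> R d n k) \<le> \<alpha> * integral\<^sup>L ?N ?D" .
  qed
qed

section \<open>Lower bounds for the Gamma factors in the denominators\<close>

lemma Gamma_add_nat_ge: "x \<ge> 1 \<Longrightarrow> Gamma (real j + x) \<ge> fact j * Gamma (x::real)"
proof (induction j)
  case (Suc j)
  have "real j + x \<notin> \<int>\<^sub>\<le>\<^sub>0" using nonpos_Ints_nonpos[of "real j + x"] Suc.prems by auto
  then have "Gamma (real (Suc j) + x) = (real j + x) * Gamma (real j + x)"
    using Gamma_plus1[of "real j + x"] by (simp add: add_ac)
  moreover have "(real j + 1) * (fact j * Gamma x) \<le> (real j + x) * Gamma (real j + x)"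
  proof (intro mult_mono)
    show "0 \<le> fact j * Gamma x" using Suc.prems Gamma_real_pos[of x] by simp
  qed (use Suc in auto)
  ultimately show ?case by (simp add: algebra_simps)
qed simp

text \<open>Replacing \<open>fact n\<close> by \<open>fact m * fact (n - m)\<close> costs a binomial
  coefficient, hence at most \<open>2 ^ n\<close>.\<close>

lemma fact_Gamma_lower:
  assumes "m \<le> n" "x \<ge> 1"
  shows "fact n * Gamma x / 2 ^ n \<le> fact m * Gamma (real n - real m + x)"
proof -
  have G: "Gamma x > 0" using assms by (intro Gamma_real_pos) auto
  have "real (n choose m) \<le> 2 ^ n"
  proof -
    have "n choose m \<le> (\<Sum>k\<le>n. n choose k)" using assms by (intro member_le_sum) auto
    then have "n choose m \<le> 2 ^ n" by (simp add: choose_row_sum)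
    then show ?thesis using of_nat_mono by fastforce
  qed
  moreover have "fact n = fact m * fact (n - m) * real (n choose m)"
    using binomial_fact_lemma[OF assms(1)] by (metis of_nat_fact of_nat_mult)
  ultimately have "fact n \<le> fact m * fact (n - m) * (2 ^ n :: real)"
    by (simp add: mult_left_mono)
  then have "fact n / 2 ^ n \<le> (fact m * fact (n - m) :: real)" by (simp add: field_simps)
  then have "fact n / 2 ^ n * Gamma x \<le> fact m * fact (n - m) * Gamma x" using G by (intro mult_right_mono) auto
  also have "\<dots> \<le> fact m * Gamma (real (n - m) + x)"
    using Gamma_add_nat_ge[OF assms(2), of "n - m"] by (simp add: mult.assoc mult_left_mono)
  finally show ?thesis using assms by (simp add: of_nat_diff)
qed

section \<open>The density of a stable law\<close>

text \<open>For \<open>j = n - 2 * m\<close> the Gamma argument \<open>(n + j + d) / 2\<close> is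
  \<open>n - m + d / 2\<close>. The prefactor of the series arises here, from the Fourier constant,
  \<open>1 / fact n\<close> and the Funk-Hecke coefficient.\<close>

lemma fh_coeff_normalised:
  assumes "m \<le> n div 2"
  shows "fh_coeff d n (n - 2 * m) / ((2 * pi) ^ d * fact n)
     = 2 powr (1 - real d) / pi powr (real d / 2) / (2 ^ n * (fact m * Gamma (real n - real m + real d / 2)))"
proof -
  have 1: "(real n + real (n - 2 * m) + real d) / 2 = real n - real m + real d / 2"
    using assms by (simp add: of_nat_diff field_simps)
  have 2: "2 powr (1 - real d) = 2 / 2 ^ d" by (simp add: powr_diff powr_realpow)
  have 3: "(2 * pi) ^ d = 2 ^ d * (pi powr (real d / 2) * pi powr (real d / 2))"
    by (simp add: power_mult_distrib powr_realpow flip: powr_add)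
  have 4: "(n - (n - 2 * m)) div 2 = m" "n - 2 * m \<le> n" "even (n - (n - 2 * m))" using assms by auto
  have "F * P * 2 / (N * M * G) / (D * (P * P) * F) = 2 / D / P / (N * (M * G))" if "F \<noteq> 0" "P \<noteq> 0" for F P N M G D :: real
    using that by simp
  from this[of "fact n" "pi powr (real d / 2)" "2 ^ n" "fact m" "Gamma (real n - real m + real d / 2)" "2 ^ d"]
  show ?thesis unfolding fh_coeff_def 1 2 3 using 4 by simp
qed

text \<open>The power of \<open>- \<i>\<close> from the Fourier exponential splits into the part
  kept in \<open>Sstar\<close> and the sign of the \<open>m\<close>-th term.\<close>

lemma neg_i_power: "2 * m \<le> n \<Longrightarrow> (- \<i>) ^ n = (- \<i>) ^ (n - 2 * m) * (- 1) ^ m"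
proof -
  assume "2 * m \<le> n"
  then have "(- \<i>) ^ n = (- \<i>) ^ (n - 2 * m + 2 * m)" by simp
  also have "\<dots> = (- \<i>) ^ (n - 2 * m) * ((- \<i>)\<^sup>2) ^ m" by (simp only: power_add power_mult)
  finally show ?thesis by simp
qed

lemma norm_power_transform_le:
  fixes f :: "real^'n \<Rightarrow> complex"
  assumes f: "continuous_on UNIV f" and B: "\<And>u. norm u = 1 \<Longrightarrow> cmod (f u) \<le> B"
  shows "sphint (\<lambda>u. cmod (complex_of_real (x \<bullet> u) ^ n * f u)) \<le> norm x ^ n * B * fh_coeff CARD('n) 0 0"
    and "cmod (power_transform f n x) \<le> norm x ^ n * B * fh_coeff CARD('n) 0 0"
proof -
  have i: "integrable sphere_measure (\<lambda>u. complex_of_real (x \<bullet> u) ^ n * f u)"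
    by (intro continuous_integrable_sphere continuous_intros f)
  have "sphint (\<lambda>u. cmod (complex_of_real (x \<bullet> u) ^ n * f u)) \<le> sphint (\<lambda>u::real^'n. norm x ^ n * B)"
  proof (rule integral_mono)
    show "integrable sphere_measure (\<lambda>u. cmod (complex_of_real (x \<bullet> u) ^ n * f u))" using i by (rule integrable_norm)
    show "integrable sphere_measure (\<lambda>u::real^'n. norm x ^ n * B)" by simp
    fix u :: "real^'n" assume "u \<in> space sphere_measure"
    then have u: "norm u = 1" by simp
    have "\<bar>x \<bullet> u\<bar> \<le> norm x" using Cauchy_Schwarz_ineq2[of x u] u by simp
    then have "\<bar>x \<bullet> u\<bar> ^ n \<le> norm x ^ n" by (rule power_mono) simp
    then show "cmod (complex_of_real (x \<bullet> u) ^ n * f u) \<le> norm x ^ n * B"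
      unfolding norm_mult norm_power norm_of_real using B[OF u] by (intro mult_mono) auto
  qed
  also have "\<dots> = norm x ^ n * B * fh_coeff CARD('n) 0 0"
    using measure_sphere[where 'n='n] by simp
  finally show 1: "sphint (\<lambda>u. cmod (complex_of_real (x \<bullet> u) ^ n * f u)) \<le> norm x ^ n * B * fh_coeff CARD('n) 0 0" .
  show "cmod (power_transform f n x) \<le> norm x ^ n * B * fh_coeff CARD('n) 0 0"
    unfolding power_transform_def by (rule order_trans[OF integral_norm_bound 1])
qed

section \<open>Expansion of the inverse Fourier transform\<close>

context stable_law
begin

definition charfun :: "real^'n \<Rightarrow> complex" where
  "charfun z = exp (- complex_of_real (norm z powr \<alpha>) * V (sgn z))"

lemma charfun_measurable [measurable]: "charfun \<in> borel_measurable borel"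
proof -
  have [measurable]: "(\<lambda>z. V (sgn z)) \<in> borel_measurable borel"
    by (rule measurable_compose[OF sgn_borel_measurable borel_measurable_continuous_onI[OF continuous_V]])
  show ?thesis unfolding charfun_def[abs_def] by measurable
qed

lemma charfun_integrable: "integrable lborel charfun"
proof -
  obtain c where c: "c > 0" "\<And>u. norm u = 1 \<Longrightarrow> Re (V u) \<ge> c" using Re_V_lower by blast
  have "integrable lborel (\<lambda>z::real^'n. exp (- c * norm z powr \<alpha>) *\<^sub>R (1::real))"
    using alpha c by (intro integral_polar_product(1) integrable_radial_exp) auto
  then show ?thesis
  proof (rule Bochner_Integration.integrable_bound)
    show "AE z in lborel. norm (charfun z) \<le> norm (exp (- c * norm z powr \<alpha>) *\<^sub>R (1::real))"
    proof (rule AE_I2)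
      fix z :: "real^'n"
      have "norm z powr \<alpha> * c \<le> norm z powr \<alpha> * Re (V (sgn z))"
        using c(2)[of "sgn z"] by (cases "z = 0") (auto simp: norm_sgn intro: mult_left_mono)
      then show "norm (charfun z) \<le> norm (exp (- c * norm z powr \<alpha>) *\<^sub>R (1::real))"
        by (simp add: charfun_def mult.commute)
    qed
  qed simp
qed

lemma charfun_fourier_pair: "fourier_pair \<mu> charfun"
  unfolding fourier_pair_def fourier_pair_axioms_def
  using mu charf charfun_integrable by (simp add: charfun_def)

interpretation F: fourier_pair \<mu> charfun by (rule charfun_fourier_pair)

text \<open>The \<open>(n, k)\<close> term left by integrating the product of the two exponential
  series; the sum over \<open>m\<close> appears only when the moment is decomposed.\<close>

definition coef :: "nat \<Rightarrow> nat \<Rightarrow> real^'n \<Rightarrow> complex" where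
  "coef n k x = complex_of_real (gcoef \<alpha> R CARD('n) n k / ((2 * pi) ^ CARD('n) * \<alpha> * fact n)) * (- \<i>) ^ n
     * power_transform (\<lambda>u. Vs u ^ k) n x"

lemma continuous_Vs_power: "continuous_on UNIV (\<lambda>u. Vs u ^ k)"
  by (intro continuous_intros continuous_Vs)

lemma alpha0: "\<alpha> > 0" using alpha by simp

lemma coef_has_sum: "((\<lambda>(n, k). coef n k x) has_sum F.inv_transform x) UNIV"
proof -
  let ?d = "CARD('n)"
  let ?N = "radial_measure (?d - 1)"
  have d0: "?d > 0" by simp
  obtain q where q: "0 < q" "q < R" "\<And>u. norm u = 1 \<Longrightarrow> cmod (Vs u) \<le> q" using Vs_bound by blast
  define h where "h n k r = r ^ n * (r powr \<alpha>) ^ k * exp (- R * r powr \<alpha>) / (fact n * fact k)" for n k r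
  define P where "P n k u = (- \<i>) ^ n * (complex_of_real (x \<bullet> u) ^ n * Vs u ^ k)" for n k u
  define T where "T n k z = h n k (norm z) *\<^sub>R P n k (dir z)" for n k z
  have hb: "has_bochner_integral ?N (h n k) (gcoef \<alpha> R ?d n k / (\<alpha> * fact n))" for n k
    using has_bochner_integral_divide_zero[OF has_bochner_integral_radial_powers[OF alpha0 R_pos d0, of n k], of "fact n * fact k"]
    by (simp add: h_def[abs_def] mult_ac)
  note hi = integrable.intros[OF hb] has_bochner_integral_integral_eq[OF hb]
  have h0: "h n k r \<ge> 0" if "r \<ge> 0" for n k r using that by (simp add: h_def)
  have Pi: "integrable sphere_measure (P n k)" for n k
    unfolding P_def[abs_def] by (intro continuous_integrable_sphere continuous_intros continuous_Vs)
  have Ti: "integrable lborel (T n k)" for n k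
    unfolding T_def[abs_def] by (rule integral_polar_product(1)[OF hi(1) Pi])
  have TI: "integral\<^sup>L lborel (T n k) = (gcoef \<alpha> R ?d n k / (\<alpha> * fact n)) *\<^sub>R ((- \<i>) ^ n * power_transform (\<lambda>u. Vs u ^ k) n x)" for n k
    unfolding T_def[abs_def] integral_polar_product(2)[OF hi(1) Pi] hi(2)
    by (simp add: P_def[abs_def] power_transform_def)
  have TN: "integral\<^sup>L lborel (\<lambda>z. norm (T n k z)) \<le> (norm x ^ n / fact n * q ^ k * gcoef \<alpha> R ?d n k) * (fh_coeff ?d 0 0 / \<alpha>)" for n k
  proof -
    have "integral\<^sup>L lborel (\<lambda>z. norm (T n k z)) = integral\<^sup>L lborel (\<lambda>z. h n k (norm z) *\<^sub>R norm (P n k (dir z)))"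
      by (simp add: T_def h0)
    also have "\<dots> = (gcoef \<alpha> R ?d n k / (\<alpha> * fact n)) *\<^sub>R sphint (\<lambda>u. norm (P n k u))"
      unfolding integral_polar_product(2)[OF hi(1) integrable_norm[OF Pi]] hi(2) ..
    also have "sphint (\<lambda>u. norm (P n k u)) = sphint (\<lambda>u. cmod (complex_of_real (x \<bullet> u) ^ n * Vs u ^ k))"
      by (simp add: P_def norm_mult norm_power)
    also have "(gcoef \<alpha> R ?d n k / (\<alpha> * fact n)) *\<^sub>R \<dots> \<le> (gcoef \<alpha> R ?d n k / (\<alpha> * fact n)) *\<^sub>R (norm x ^ n * q ^ k * fh_coeff ?d 0 0)"
      using gcoef_nonneg[OF alpha0 R_pos d0, of n k] alpha0 q
      by (intro scaleR_left_mono norm_power_transform_le(1)[OF continuous_Vs_power]) (auto simp: norm_power intro!: power_mono)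
    finally show ?thesis by (simp add: mult_ac)
  qed
  have "((\<lambda>(n, k). integral\<^sup>L lborel (T n k)) has_sum integral\<^sup>L lborel (\<lambda>z. cis (- (x \<bullet> z)) * charfun z)) UNIV"
  proof (rule has_sum_integral_nat_product[OF Ti])
    have "(\<lambda>y. (\<lambda>(n, k). norm x ^ n / fact n * q ^ k * gcoef \<alpha> R ?d n k) y * (fh_coeff ?d 0 0 / \<alpha>)) summable_on UNIV"
      using q by (intro summable_on_cmult_left summable_gcoef alpha d0) auto
    then show "(\<lambda>(n, k). integral\<^sup>L lborel (\<lambda>z. norm (T n k z))) summable_on UNIV"
      by (rule summable_on_comparison_test) (use TN in \<open>auto intro!: integral_nonneg_AE\<close>)
    show "(\<lambda>z. cis (- (x \<bullet> z)) * charfun z) \<in> borel_measurable lborel"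
    proof -
      have "(\<lambda>z. cis (- (x \<bullet> z))) \<in> borel_measurable borel"
        by (rule measurable_compose[OF _ F.cis_measurable]) simp
      then show ?thesis using charfun_measurable by (intro borel_measurable_times) simp_all
    qed
    \<comment> \<open>At the origin \<open>sgn\<close> is 0 and differs from \<open>dir\<close>; a
      single point may be discarded.\<close>
    have "AE z in lborel. z \<noteq> (0::real^'n)" by (rule AE_lborel_singleton)
    then show "AE z in lborel. ((\<lambda>(n, k). T n k z) has_sum (cis (- (x \<bullet> z)) * charfun z)) UNIV"
    proof eventually_elim
      case (elim z)
      define t where "t = norm z powr \<alpha>"
      have dz: "dir z = sgn z" using elim by (simp add: dir_def)
      have xz: "x \<bullet> z = norm z * (x \<bullet> dir z)"
        by (subst norm_scaleR_dir[of z, symmetric]) (simp only: inner_scaleR_right)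
      have Teq: "T n k z = ((- \<i> * complex_of_real (x \<bullet> z)) ^ n / fact n) * ((complex_of_real t * Vs (sgn z)) ^ k / fact k) * exp (- complex_of_real (R * t))" for n k
      proof -
        have "exp (- complex_of_real (R * t)) = complex_of_real (exp (- R * t))" by (simp add: exp_of_real[symmetric])
        moreover have "(- \<i> * complex_of_real (norm z * (x \<bullet> sgn z))) ^ n = complex_of_real (norm z ^ n) * ((- \<i>) ^ n * complex_of_real (x \<bullet> sgn z) ^ n)"
          by (simp only: of_real_mult of_real_power power_mult_distrib mult_ac)
        ultimately show ?thesis
          unfolding T_def h_def P_def xz dz scaleR_conv_of_real t_def[symmetric]
          by (simp only:) (simp add: power_mult_distrib)
      qed
      have "((\<lambda>y. (\<lambda>(n, k). ((- \<i> * complex_of_real (x \<bullet> z)) ^ n / fact n) * ((complex_of_real t * Vs (sgn z)) ^ k / fact k)) y * exp (- complex_of_real (R * t)))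
          has_sum (exp (- \<i> * complex_of_real (x \<bullet> z)) * exp (complex_of_real t * Vs (sgn z)) * exp (- complex_of_real (R * t)))) UNIV"
        by (rule has_sum_cmult_left[OF has_sum_exp_mult_exp])
      moreover have "exp (- \<i> * complex_of_real (x \<bullet> z)) * exp (complex_of_real t * Vs (sgn z)) * exp (- complex_of_real (R * t)) = cis (- (x \<bullet> z)) * charfun z"
        unfolding charfun_def cis_conv_exp t_def Vstar_def by (simp add: exp_add[symmetric] algebra_simps)
      ultimately show ?case by (simp add: Teq case_prod_unfold)
    qed
  qed
  from has_sum_cmult_right[OF this, of "complex_of_real (1 / (2 * pi) ^ ?d)"]
  have "((\<lambda>y. complex_of_real (1 / (2 * pi) ^ ?d) * (\<lambda>(n, k). integral\<^sup>L lborel (T n k)) y) has_sum F.inv_transform x) UNIV"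
    unfolding F.inv_transform_def .
  moreover have "complex_of_real (1 / (2 * pi) ^ ?d) * integral\<^sup>L lborel (T n k) = coef n k x" for n k
    unfolding TI coef_def by (simp add: scaleR_conv_of_real mult_ac)
  ultimately show ?thesis by (simp add: case_prod_unfold)
qed

lemma dens_term_eq:
  "dens_term \<alpha> lam R x n m k =
    complex_of_real (2 powr (1 - real CARD('n)) / pi powr (real CARD('n) / 2) / (2 ^ n * (fact m * Gamma (real n - real m + real CARD('n) / 2)))
      * gcoef \<alpha> R CARD('n) n k / \<alpha> * norm x ^ n) * ((- 1) ^ m * (- \<i>) ^ (n - 2 * m)) * sh_proj (n - 2 * m) (\<lambda>u. Vs u ^ k) (sgn x)"
  unfolding dens_term_def Let_def Sstar_def gcoef_def by (simp add: power_divide mult_ac)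

text \<open>Homogeneity moves the harmonic of degree \<open>n - 2 * m\<close> from \<open>x\<close>
  to \<open>sgn x\<close> at the price of \<open>norm x ^ (n - 2 * m)\<close>, which joins the
  \<open>norm x ^ (2 * m)\<close> of the decomposition to give \<open>norm x ^ n\<close> for every
  \<open>m\<close>.\<close>

lemma coef_eq_dens: "coef n k x = (\<Sum>m\<le>n div 2. dens_term \<alpha> lam R x n m k)"
proof -
  let ?d = "CARD('n)"
  have "coef n k x = (\<Sum>m\<le>n div 2. complex_of_real (gcoef \<alpha> R ?d n k / ((2 * pi) ^ ?d * \<alpha> * fact n)) * (- \<i>) ^ n *
      (complex_of_real (fh_coeff ?d n (n - 2 * m) * norm x ^ (2 * m)) * sh_proj (n - 2 * m) (\<lambda>u. Vs u ^ k) x))"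
    unfolding coef_def power_transform_decomposition[OF d2 continuous_Vs_power] by (simp add: sum_distrib_left)
  also have "\<dots> = (\<Sum>m\<le>n div 2. dens_term \<alpha> lam R x n m k)"
  proof (rule sum.cong[OF refl])
    fix m assume "m \<in> {..n div 2}"
    then have m: "m \<le> n div 2" "2 * m \<le> n" by auto
    let ?p = "sh_proj (n - 2 * m) (\<lambda>u. Vs u ^ k)"
    have hp: "hpoly (n - 2 * m) ?p" using sh_proj_harm[OF d2 continuous_Vs_power] by (simp add: harm_iff)
    have "norm x *\<^sub>R sgn x = x" by (cases "x = 0") (simp_all add: sgn_div_norm)
    then have "?p x = ?p (norm x *\<^sub>R sgn x)" by simp
    also have "\<dots> = complex_of_real (norm x ^ (n - 2 * m)) * ?p (sgn x)" by (rule hpoly_scaleR[OF hp])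
    finally have p: "?p x = complex_of_real (norm x ^ (n - 2 * m)) * ?p (sgn x)" .
    have nx: "norm x ^ (2 * m) * norm x ^ (n - 2 * m) = norm x ^ n" using m by (simp flip: power_add)
    have "complex_of_real (gcoef \<alpha> R ?d n k / ((2 * pi) ^ ?d * \<alpha> * fact n)) * (- \<i>) ^ n *
      (complex_of_real (fh_coeff ?d n (n - 2 * m) * norm x ^ (2 * m)) * ?p x)
      = complex_of_real (fh_coeff ?d n (n - 2 * m) / ((2 * pi) ^ ?d * fact n) * gcoef \<alpha> R ?d n k / \<alpha> * (norm x ^ (2 * m) * norm x ^ (n - 2 * m))) * (- \<i>) ^ n * ?p (sgn x)"
      unfolding p by (simp add: mult_ac)
    also have "\<dots> = dens_term \<alpha> lam R x n m k"
      unfolding fh_coeff_normalised[OF m(1)] nx neg_i_power[OF m(2)] dens_term_eq by (simp add: mult_ac)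
    finally show "complex_of_real (gcoef \<alpha> R ?d n k / ((2 * pi) ^ ?d * \<alpha> * fact n)) * (- \<i>) ^ n *
      (complex_of_real (fh_coeff ?d n (n - 2 * m) * norm x ^ (2 * m)) * ?p x) = dens_term \<alpha> lam R x n m k" .
  qed
  finally show ?thesis .
qed

section \<open>Majorants, uniform and absolute convergence\<close>

definition dens_const :: real where
  "dens_const = 2 powr (1 - real CARD('n)) / pi powr (real CARD('n) / 2) / Gamma (real CARD('n) / 2) / \<alpha>"

lemma dens_const_nonneg: "dens_const \<ge> 0"
  unfolding dens_const_def using alpha0 by (intro divide_nonneg_nonneg less_imp_le[OF Gamma_real_pos]) auto

text \<open>The projection costs at most \<open>d ^ n\<close>, and the \<open>2 ^ n\<close> lost in
  \<open>fact_Gamma_lower\<close> cancels against the one in the denominator of the term.\<close>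

lemma norm_dens_term_le:
  assumes q: "0 < q" "\<And>u. norm u = 1 \<Longrightarrow> cmod (Vs u) \<le> q" and x: "norm x \<le> M" and m: "m \<le> n div 2"
  shows "norm (dens_term \<alpha> lam R x n m k)
     \<le> dens_const * ((2 * M * real CARD('n)) ^ n / fact n * q ^ k * gcoef \<alpha> R CARD('n) n k) * (1 / 2) ^ m"
proof -
  let ?d = "CARD('n)" and ?g = "gcoef \<alpha> R CARD('n) n k" and ?G = "Gamma (real CARD('n) / 2)"
  have d0: "?d > 0" by simp
  have M: "M \<ge> 0" using x norm_ge_zero order_trans by blast
  have g0: "?g \<ge> 0" by (rule gcoef_nonneg[OF alpha0 R_pos d0])
  have G0: "?G > 0" by (intro Gamma_real_pos) simp
  define Q where "Q = fact m * Gamma (real n - real m + real ?d / 2)"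
  define c where "c = 2 powr (1 - real CARD('n)) / pi powr (real CARD('n) / 2)"
  have c0: "c \<ge> 0" by (simp add: c_def)
  have mn: "m \<le> n" using m by simp
  have Q: "fact n * ?G / 2 ^ n \<le> Q"
    unfolding Q_def using d2 mn by (intro fact_Gamma_lower) auto
  have Qp: "fact n * ?G / 2 ^ n > 0" using G0 by simp
  have Q0: "Q > 0" using Q Qp by linarith
  have sgnx: "norm (sgn x) \<le> 1" by (simp add: norm_sgn)
  have sh: "cmod (sh_proj (n - 2 * m) (\<lambda>u. Vs u ^ k) (sgn x)) \<le> real ?d ^ n * q ^ k"
  proof -
    have "cmod (sh_proj (n - 2 * m) (\<lambda>u. Vs u ^ k) (sgn x)) \<le> real ?d ^ (n - 2 * m) * q ^ k"
      by (rule sh_proj_bound[OF d2 continuous_Vs_power _ _ sgnx]) (use q in \<open>auto simp: norm_power intro!: power_mono\<close>)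
    also have "\<dots> \<le> real ?d ^ n * q ^ k"
      using q by (intro mult_right_mono power_increasing) auto
    finally show ?thesis .
  qed
  have nonn: "c / (2 ^ n * Q) * ?g / \<alpha> * norm x ^ n \<ge> 0"
    using g0 alpha0 c0 Q0 by simp
  have "norm (dens_term \<alpha> lam R x n m k) = (c / (2 ^ n * Q) * ?g / \<alpha> * norm x ^ n) * cmod (sh_proj (n - 2 * m) (\<lambda>u. Vs u ^ k) (sgn x))"
    unfolding dens_term_eq Q_def[symmetric] c_def[symmetric] norm_mult norm_of_real abs_of_nonneg[OF nonn] by (simp add: norm_power)
  also have "\<dots> \<le> (c / (2 ^ n * Q) * ?g / \<alpha> * norm x ^ n) * (real ?d ^ n * q ^ k)"
    by (intro mult_left_mono sh nonn)
  also have "\<dots> \<le> (c / (2 ^ n * (fact n * ?G / 2 ^ n)) * ?g / \<alpha> * M ^ n) * (real ?d ^ n * q ^ k)"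
  proof -
    have "c / (2 ^ n * Q) \<le> c / (2 ^ n * (fact n * ?G / 2 ^ n))"
    proof (rule divide_left_mono[OF _ c0])
      show "2 ^ n * (fact n * ?G / 2 ^ n) \<le> 2 ^ n * Q" using Q by (rule mult_left_mono) simp
      show "0 < 2 ^ n * Q * (2 ^ n * (fact n * ?G / 2 ^ n))"
        by (intro mult_pos_pos Q0 Qp zero_less_power zero_less_numeral)
    qed
    then have "c / (2 ^ n * Q) * ?g / \<alpha> \<le> c / (2 ^ n * (fact n * ?G / 2 ^ n)) * ?g / \<alpha>"
      using g0 alpha0 by (intro divide_right_mono mult_right_mono) simp_all
    moreover have "norm x ^ n \<le> M ^ n" using x by (intro power_mono) simp_all
    moreover have "0 \<le> c / (2 ^ n * (fact n * ?G / 2 ^ n)) * ?g / \<alpha>" using g0 alpha0 c0 G0 by simp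
    ultimately have "c / (2 ^ n * Q) * ?g / \<alpha> * norm x ^ n \<le> c / (2 ^ n * (fact n * ?G / 2 ^ n)) * ?g / \<alpha> * M ^ n"
      by (intro mult_mono) simp_all
    then show ?thesis using q(1) by (intro mult_right_mono) simp_all
  qed
  also have "\<dots> = dens_const * ((M * real ?d) ^ n / fact n * q ^ k * ?g)"
    unfolding dens_const_def c_def using G0 by (simp add: power_mult_distrib mult_ac)
  \<comment> \<open>Inserting \<open>2 ^ n * (1 / 2) ^ m\<close>, which is at least 1 for
    \<open>m \<le> n\<close>, buys geometric decay in \<open>m\<close> for one more power of 2, so
    the number of values of \<open>m\<close> no longer matters.\<close>
  also have "\<dots> \<le> dens_const * ((M * real ?d) ^ n / fact n * q ^ k * ?g) * (2 ^ n * (1 / 2) ^ m)"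
  proof -
    have "2 ^ m \<le> (2 ^ n :: real)" using mn by (intro power_increasing) auto
    then have "1 \<le> (2 ^ n * (1 / 2) ^ m :: real)" by (simp add: power_divide field_simps)
    moreover have "0 \<le> dens_const * ((M * real ?d) ^ n / fact n * q ^ k * ?g)"
      using dens_const_nonneg M q g0 by (intro mult_nonneg_nonneg divide_nonneg_nonneg) auto
    ultimately show ?thesis using mult_left_mono by fastforce
  qed
  also have "\<dots> = dens_const * ((2 * M * real ?d) ^ n / fact n * q ^ k * ?g) * (1 / 2) ^ m"
    by (simp add: power_mult_distrib)
  finally show ?thesis .
qed

definition majorant :: "real \<Rightarrow> real \<Rightarrow> nat \<Rightarrow> nat \<Rightarrow> real" where
  "majorant q M n k = (2 * M * real CARD('n)) ^ n / fact n * q ^ k * gcoef \<alpha> R CARD('n) n k"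

lemma majorant_nonneg: "0 \<le> q \<Longrightarrow> 0 \<le> M \<Longrightarrow> majorant q M n k \<ge> 0"
  unfolding majorant_def using gcoef_nonneg[OF alpha0 R_pos, of "CARD('n)" n k] by simp

lemma majorant_summable_on: "0 \<le> q \<Longrightarrow> q < R \<Longrightarrow> 0 \<le> M \<Longrightarrow> (\<lambda>(n, k). majorant q M n k) summable_on UNIV"
  unfolding majorant_def by (intro summable_gcoef alpha) auto

lemma majorant_summable:
  assumes "0 \<le> q" "q < R" "0 \<le> M"
  shows "summable (majorant q M n)" "summable (\<lambda>n. \<Sum>k. majorant q M n k)"
  using has_sum_infsum[OF majorant_summable_on[OF assms]]
  by (auto intro: summable_has_sum_nat_product sums_summable[OF sums_has_sum_nat_product])

lemma summable_dens_term:
  assumes m: "m \<le> n div 2"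
  shows "summable (\<lambda>k. dens_term \<alpha> lam R x n m k)"
proof -
  obtain q where q: "0 < q" "q < R" "\<And>u. norm u = 1 \<Longrightarrow> cmod (Vs u) \<le> q" using Vs_bound by blast
  have "summable (\<lambda>k. dens_const * majorant q (norm x) n k * (1 / 2) ^ m)"
    using q by (intro summable_mult summable_mult2 majorant_summable(1)) auto
  then show ?thesis
    by (rule summable_comparison_test'[of _ 0])
       (unfold majorant_def, rule norm_dens_term_le[OF q(1,3) order_refl m])
qed

text \<open>In \<open>stable_g\<close> the series in \<open>k\<close> stands inside the finite sum
  over \<open>m\<close>; the exchange needs convergence for each \<open>m\<close>
  separately.\<close>

lemma stable_g_eq: "stable_g \<alpha> lam R x = F.inv_transform x"
proof -
  have "(\<Sum>k. coef n k x) = (\<Sum>m\<le>n div 2. \<Sum>k. dens_term \<alpha> lam R x n m k)" for n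
    unfolding coef_eq_dens by (rule suminf_sum) (simp add: summable_dens_term)
  then show ?thesis
    unfolding stable_g_def using sums_unique[OF sums_has_sum_nat_product[OF coef_has_sum[of x]]] by simp
qed

lemma sum_half_powers_le: "(\<Sum>m\<le>N. (1 / 2) ^ m) \<le> (2::real)"
  by (induction N) (auto simp: sum_gp0 sum_gp)

text \<open>The majorant sees \<open>x\<close> only through \<open>norm x \<le> M\<close>, and the
  sum over \<open>m\<close> is at most 2 times its geometric prefactor, so the Weierstrass test
  applies.\<close>

lemma uniform_limit_dens:
  assumes M: "M > 0"
  shows "uniform_limit (cball 0 M) (\<lambda>N x. \<Sum>n<N. \<Sum>m\<le>n div 2. \<Sum>k. dens_term \<alpha> lam R x n m k) (stable_g \<alpha> lam R) sequentially"
proof -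
  obtain q where q: "0 < q" "q < R" "\<And>u. norm u = 1 \<Longrightarrow> cmod (Vs u) \<le> q" using Vs_bound by blast
  have ms: "summable (majorant q M n)" "summable (\<lambda>n. \<Sum>k. majorant q M n k)" for n
    using q M by (auto intro!: majorant_summable)
  have s0: "0 \<le> (\<Sum>k. majorant q M n k)" for n
    using q M by (intro suminf_nonneg ms majorant_nonneg) auto
  show ?thesis
    unfolding stable_g_def[abs_def]
  proof (rule Weierstrass_m_test)
    show "summable (\<lambda>n. dens_const * (\<Sum>k. majorant q M n k) * 2)"
      by (intro summable_mult summable_mult2 ms)
    fix n and x :: "real^'n" assume "x \<in> cball 0 M"
    then have x: "norm x \<le> M" by simp
    have "norm (\<Sum>m\<le>n div 2. \<Sum>k. dens_term \<alpha> lam R x n m k) \<le> (\<Sum>m\<le>n div 2. dens_const * (\<Sum>k. majorant q M n k) * (1 / 2) ^ m)"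
    proof (rule sum_norm_le)
      fix m assume "m \<in> {..n div 2}"
      then have m: "m \<le> n div 2" by simp
      have "norm (\<Sum>k. dens_term \<alpha> lam R x n m k) \<le> (\<Sum>k. dens_const * majorant q M n k * (1 / 2) ^ m)"
        by (intro norm_suminf_le summable_mult summable_mult2 ms)
           (unfold majorant_def, rule norm_dens_term_le[OF q(1,3) x m])
      also have "\<dots> = dens_const * (\<Sum>k. majorant q M n k) * (1 / 2) ^ m"
        using ms(1)[of n] by (simp add: suminf_mult suminf_mult2[symmetric] summable_mult)
      finally show "norm (\<Sum>k. dens_term \<alpha> lam R x n m k) \<le> dens_const * (\<Sum>k. majorant q M n k) * (1 / 2) ^ m" .
    qed
    also have "\<dots> = dens_const * (\<Sum>k. majorant q M n k) * (\<Sum>m\<le>n div 2. (1 / 2) ^ m)"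
      by (rule sum_distrib_left[symmetric])
    also have "\<dots> \<le> dens_const * (\<Sum>k. majorant q M n k) * 2"
      using dens_const_nonneg s0 by (intro mult_left_mono sum_half_powers_le mult_nonneg_nonneg)
    finally show "norm (\<Sum>m\<le>n div 2. \<Sum>k. dens_term \<alpha> lam R x n m k) \<le> dens_const * (\<Sum>k. majorant q M n k) * 2" .
  qed
qed

text \<open>The majorant is a summable family in \<open>(n, k)\<close> times a geometric series in
  \<open>m\<close>. It is summed over all triples with \<open>m\<close> last, then reordered and
  restricted to \<open>m \<le> n div 2\<close>.\<close>

lemma abs_summable_dens:
  "(\<lambda>(n, m, k). norm (dens_term \<alpha> lam R x n m k)) summable_on {(n, m, k). m \<le> n div 2}"
proof -
  obtain q where q: "0 < q" "q < R" "\<And>u. norm u = 1 \<Longrightarrow> cmod (Vs u) \<le> q" using Vs_bound by blast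
  let ?b = "\<lambda>n k. dens_const * majorant q (norm x) n k"
  have geo: "((\<lambda>m. (1 / 2 :: real) ^ m) has_sum 2) UNIV"
    using geometric_sums[of "1 / 2 :: real"] by (intro norm_summable_imp_has_sum) (auto simp: sums_iff power_abs)
  have "(\<lambda>((n, k), m). ?b n k * (1 / 2) ^ m) summable_on Sigma UNIV (\<lambda>_. UNIV)"
  proof (rule summable_on_SigmaI)
    show "((\<lambda>m. (\<lambda>((n, k), m). ?b n k * (1 / 2) ^ m) ((n_k :: nat \<times> nat), m)) has_sum (dens_const * (\<lambda>(n, k). majorant q (norm x) n k) n_k * 2)) UNIV" for n_k
      using has_sum_cmult_right[OF geo] by (cases n_k) simp
    show "(\<lambda>n_k. dens_const * (\<lambda>(n, k). majorant q (norm x) n k) n_k * 2) summable_on UNIV"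
      using q by (intro summable_on_cmult_left summable_on_cmult_right majorant_summable_on) auto
    show "0 \<le> (\<lambda>((n, k), m). ?b n k * (1 / 2) ^ m) (n_k, m)" for n_k :: "nat \<times> nat" and m
      using dens_const_nonneg majorant_nonneg[of q "norm x"] q by (auto split: prod.split)
  qed
  moreover have "bij_betw (\<lambda>(n, m, k). ((n, k), m)) (UNIV :: (nat \<times> nat \<times> nat) set) (UNIV :: ((nat \<times> nat) \<times> nat) set)"
    by (rule bij_betw_byWitness[where f'="\<lambda>((n, k), m). (n, m, k)"]) auto
  ultimately have "(\<lambda>y. (\<lambda>((n, k), m). ?b n k * (1 / 2) ^ m) ((\<lambda>(n, m, k). ((n, k), m)) y)) summable_on (UNIV :: (nat \<times> nat \<times> nat) set)"
    by (subst summable_on_reindex_bij_betw) simp_all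
  then have "(\<lambda>(n, m, k). ?b n k * (1 / 2) ^ m) summable_on (UNIV :: (nat \<times> nat \<times> nat) set)"
    by (simp add: case_prod_unfold)
  then have "(\<lambda>(n, m, k). ?b n k * (1 / 2) ^ m) summable_on {(n, m, k). m \<le> n div 2}"
    by (rule summable_on_subset_banach) simp
  then show ?thesis
    by (rule summable_on_comparison_test) (use norm_dens_term_le[OF q(1,3) order_refl, of _ _ x] in \<open>auto simp: majorant_def\<close>)
qed

section \<open>The radial density\<close>

text \<open>After exchanging the integrals the inner one is Funk-Hecke for the constant harmonic
  1.\<close>

lemma sphint_power_transform:
  fixes f :: "real^'n \<Rightarrow> complex"
  assumes f: "continuous_on UNIV f"
  shows "sphint (power_transform f n) = complex_of_real (fh_coeff CARD('n) n 0) * sphint f"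
proof -
  have "sphint (power_transform f n) = sphint (\<lambda>x. sphint (\<lambda>u. complex_of_real (x \<bullet> u) ^ n * f u))"
    unfolding power_transform_def[abs_def] ..
  also have "\<dots> = sphint (\<lambda>u. sphint (\<lambda>x. complex_of_real (x \<bullet> u) ^ n * f u))"
  proof (rule sphint_swap)
    have "continuous_on UNIV (\<lambda>y :: (real^'n) \<times> (real^'n). complex_of_real (fst y \<bullet> snd y) ^ n * f (snd y))"
      by (intro continuous_intros continuous_on_compose2[OF f]) auto
    then show "continuous_on UNIV (\<lambda>(x, u). complex_of_real (x \<bullet> u) ^ n * f u)" by (simp add: split_beta)
  qed
  also have "\<dots> = sphint (\<lambda>u. sphint (\<lambda>x. complex_of_real (u \<bullet> x) ^ n * 1) * f u)"
    by (simp add: inner_commute)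
  also have "\<dots> = sphint (\<lambda>u. complex_of_real (fh_coeff CARD('n) n 0) * f u)"
  proof (rule Bochner_Integration.integral_cong[OF refl])
    fix u :: "real^'n" assume "u \<in> space sphere_measure"
    moreover have "sphint (\<lambda>x. complex_of_real (u \<bullet> x) ^ n * 1) = complex_of_real (fh_coeff CARD('n) n 0 * norm u ^ (n - 0)) * 1"
      by (rule funk_hecke_power[OF d2 hpoly_const]) (simp add: lap_def[abs_def])
    ultimately show "sphint (\<lambda>x. complex_of_real (u \<bullet> x) ^ n * 1) * f u = complex_of_real (fh_coeff CARD('n) n 0) * f u"
      by simp
  qed
  finally show ?thesis by simp
qed

lemma sphint_coef:
  "sphint (\<lambda>u. coef n k (r *\<^sub>R u)) =
     complex_of_real (gcoef \<alpha> R CARD('n) n k / ((2 * pi) ^ CARD('n) * \<alpha> * fact n)) * (- \<i>) ^ n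
       * (complex_of_real (r ^ n * fh_coeff CARD('n) n 0) * sphint (\<lambda>u. Vs u ^ k))"
proof -
  have "coef n k (r *\<^sub>R u) = complex_of_real (gcoef \<alpha> R CARD('n) n k / ((2 * pi) ^ CARD('n) * \<alpha> * fact n)) * (- \<i>) ^ n * complex_of_real (r ^ n)
      * power_transform (\<lambda>u. Vs u ^ k) n u" for u
    unfolding coef_def hpoly_scaleR[OF hpoly_power_transform[OF continuous_Vs_power]] by simp
  then show ?thesis
    by (simp only: integral_mult_right_zero sphint_power_transform[OF continuous_Vs_power] of_real_mult mult.assoc)
qed

lemma norm_coef_le:
  assumes q: "0 \<le> q" "\<And>u. norm u = 1 \<Longrightarrow> cmod (Vs u) \<le> q"
  shows "norm (coef n k x) \<le> (norm x ^ n / fact n * q ^ k * gcoef \<alpha> R CARD('n) n k) * (fh_coeff CARD('n) 0 0 / ((2 * pi) ^ CARD('n) * \<alpha>))"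
proof -
  have g0: "gcoef \<alpha> R CARD('n) n k \<ge> 0" by (rule gcoef_nonneg[OF alpha0 R_pos]) simp
  then have nn: "gcoef \<alpha> R CARD('n) n k / ((2 * pi) ^ CARD('n) * \<alpha> * fact n) \<ge> 0" using alpha0 by simp
  have "norm (coef n k x) = gcoef \<alpha> R CARD('n) n k / ((2 * pi) ^ CARD('n) * \<alpha> * fact n) * cmod (power_transform (\<lambda>u. Vs u ^ k) n x)"
    unfolding coef_def norm_mult norm_of_real abs_of_nonneg[OF nn] by (simp add: norm_power)
  also have "\<dots> \<le> gcoef \<alpha> R CARD('n) n k / ((2 * pi) ^ CARD('n) * \<alpha> * fact n) * (norm x ^ n * q ^ k * fh_coeff CARD('n) 0 0)"
    using q by (intro mult_left_mono nn norm_power_transform_le(2)[OF continuous_Vs_power]) (auto simp: norm_power intro!: power_mono)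
  finally show ?thesis by (simp add: mult_ac)
qed

lemma inv_transform_sphere_measurable: "(\<lambda>u. F.inv_transform (r *\<^sub>R u)) \<in> borel_measurable sphere_measure"
  by (rule borel_measurable_sphere_measure, rule measurable_compose[OF _ F.inv_transform_measurable]) simp

lemma radial_term_eq:
  assumes "r > 0"
  shows "radial_term \<alpha> lam R r n k = complex_of_real (r ^ (CARD('n) - 1)) * sphint (\<lambda>u. coef (2 * n) k (r *\<^sub>R u))"
proof -
  let ?d = "CARD('n)"
  have 1: "fh_coeff ?d (2 * n) 0 / ((2 * pi) ^ ?d * fact (2 * n))
     = 2 powr (1 - real ?d) / pi powr (real ?d / 2) / (2 ^ (2 * n) * (fact n * Gamma (real n + real ?d / 2)))"
    using fh_coeff_normalised[of n "2 * n" ?d] by simp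
  have 2: "(- \<i>) ^ (2 * n) = (- 1) ^ n" using neg_i_power[of n "2 * n"] by simp
  have "2 powr (1 - real ?d) = 1 / 2 ^ (?d - 1)"
  proof -
    have "1 - real ?d = - real (?d - 1)" using d2 by (simp add: of_nat_diff)
    then show ?thesis by (simp only: powr_minus powr_realpow) (simp add: powr_realpow divide_inverse)
  qed
  \<comment> \<open>The factor \<open>(r / 2) ^ (d - 1)\<close> of the radial series merges the
    polar Jacobian with \<open>2 powr (1 - d)\<close> from the density.\<close>
  then have 3: "(r / 2) ^ (?d - 1) = r ^ (?d - 1) * 2 powr (1 - real ?d)" by (simp add: power_divide)
  have 4: "(- (r\<^sup>2 / 4)) ^ n = (- 1) ^ n * r ^ (2 * n) / 2 ^ (2 * n)"
    by (simp add: power_minus[of "r\<^sup>2 / 4"] power_divide power_mult)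
  let ?S = "sphint (\<lambda>u::real^'n. Vs u ^ k)"
  have "complex_of_real (r ^ (?d - 1)) * sphint (\<lambda>u. coef (2 * n) k (r *\<^sub>R u))
      = complex_of_real (r ^ (?d - 1) * (fh_coeff ?d (2 * n) 0 / ((2 * pi) ^ ?d * fact (2 * n))) * gcoef \<alpha> R ?d (2 * n) k / \<alpha> * r ^ (2 * n) * (- 1) ^ n) * ?S"
    unfolding sphint_coef 2 by (simp add: mult_ac)
  also have "\<dots> = radial_term \<alpha> lam R r n k"
    unfolding 1 radial_term_def Let_def 3 4 gcoef_def by (simp add: mult_ac)
  finally show ?thesis by simp
qed

lemma radial_g_eq:
  assumes r: "r > 0"
  shows "radial_g \<alpha> lam R r = complex_of_real (r ^ (CARD('n) - 1)) * sphint (\<lambda>u. F.inv_transform (r *\<^sub>R u))"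
proof -
  let ?d = "CARD('n)" and ?c = "complex_of_real (r ^ (CARD('n) - 1))"
  obtain q where q: "0 < q" "q < R" "\<And>u. norm u = 1 \<Longrightarrow> cmod (Vs u) \<le> q" using Vs_bound by blast
  define C where "C = fh_coeff ?d 0 0 / ((2 * pi) ^ ?d * \<alpha>)"
  have ci: "integrable sphere_measure (\<lambda>u. coef n k (r *\<^sub>R u))" for n k
    unfolding coef_def
    by (intro continuous_integrable_sphere continuous_intros continuous_on_compose2[OF hpoly_continuous[OF hpoly_power_transform[OF continuous_Vs_power]]]) auto
  have cN: "sphint (\<lambda>u. norm (coef n k (r *\<^sub>R u))) \<le> (\<lambda>(n, k). r ^ n / fact n * q ^ k * gcoef \<alpha> R ?d n k) (n, k) * (C * fh_coeff ?d 0 0)" for n k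
  proof -
    have "sphint (\<lambda>u. norm (coef n k (r *\<^sub>R u))) \<le> sphint (\<lambda>u::real^'n. (r ^ n / fact n * q ^ k * gcoef \<alpha> R ?d n k) * C)"
    proof (rule integral_mono)
      show "norm (coef n k (r *\<^sub>R u)) \<le> (r ^ n / fact n * q ^ k * gcoef \<alpha> R ?d n k) * C" if "u \<in> space sphere_measure" for u
        unfolding C_def using norm_coef_le[of q n k "r *\<^sub>R u"] q that r by simp
    qed (use ci in auto)
    also have "\<dots> = (\<lambda>(n, k). r ^ n / fact n * q ^ k * gcoef \<alpha> R ?d n k) (n, k) * (C * fh_coeff ?d 0 0)"
      using measure_sphere[where 'n='n] by simp
    finally show ?thesis .
  qed
  have hs: "((\<lambda>(n, k). sphint (\<lambda>u. coef n k (r *\<^sub>R u))) has_sum sphint (\<lambda>u. F.inv_transform (r *\<^sub>R u))) UNIV"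
  proof (rule has_sum_integral_nat_product[OF ci])
    have "(\<lambda>y. (\<lambda>(n, k). r ^ n / fact n * q ^ k * gcoef \<alpha> R ?d n k) y * (C * fh_coeff ?d 0 0)) summable_on UNIV"
      using q r by (intro summable_on_cmult_left summable_gcoef alpha) auto
    then show "(\<lambda>(n, k). sphint (\<lambda>u. norm (coef n k (r *\<^sub>R u)))) summable_on UNIV"
      by (rule summable_on_comparison_test) (use cN in \<open>auto intro!: integral_nonneg_AE\<close>)
  qed (use coef_has_sum inv_transform_sphere_measurable in auto)
  have s1: "(\<lambda>n. \<Sum>k. sphint (\<lambda>u. coef n k (r *\<^sub>R u))) sums sphint (\<lambda>u. F.inv_transform (r *\<^sub>R u))"
    by (rule sums_has_sum_nat_product[OF hs])
  have odd0: "(\<Sum>k. sphint (\<lambda>u. coef n k (r *\<^sub>R u))) = 0" if "n \<notin> range (\<lambda>n. 2 * n)" for n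
  proof -
    have "odd n" using that by (auto elim!: evenE)
    then have "fh_coeff ?d n 0 = 0" by (simp add: fh_coeff_def)
    then show ?thesis by (simp add: sphint_coef)
  qed
  \<comment> \<open>Odd degrees contribute 0, so the series may be read along \<open>2 * n\<close>,
    the index of the radial formula.\<close>
  have "(\<lambda>n. \<Sum>k. sphint (\<lambda>u. coef (2 * n) k (r *\<^sub>R u))) sums sphint (\<lambda>u. F.inv_transform (r *\<^sub>R u))"
    using sums_mono_reindex[of "\<lambda>n. 2 * n" "\<lambda>n. \<Sum>k. sphint (\<lambda>u. coef n k (r *\<^sub>R u))", OF _ odd0] s1
    by (simp add: strict_mono_def)
  from sums_mult[OF this, of ?c]
  have "(\<lambda>n. ?c * (\<Sum>k. sphint (\<lambda>u. coef (2 * n) k (r *\<^sub>R u)))) sums (?c * sphint (\<lambda>u. F.inv_transform (r *\<^sub>R u)))" .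
  moreover have "?c * (\<Sum>k. sphint (\<lambda>u. coef (2 * n) k (r *\<^sub>R u))) = (\<Sum>k. radial_term \<alpha> lam R r n k)" for n
    unfolding radial_term_eq[OF r] by (rule suminf_mult[symmetric]) (rule summable_has_sum_nat_product[OF hs])
  ultimately show ?thesis unfolding radial_g_def by (simp add: sums_iff)
qed

lemma norm_inv_transform_le:
  "norm (F.inv_transform x) \<le> 1 / (2 * pi) ^ CARD('n) * integral\<^sup>L lborel (\<lambda>z. norm (charfun z))"
  by (rule LIMSEQ_le_const2[OF tendsto_norm[OF F.smoothed_lim]]) (use F.norm_smoothed_le in blast)

text \<open>The inverse transform is bounded by the integral of \<open>norm (charfun z)\<close>,
  hence integrable over the sphere. This lets the complex integral be replaced by a nonnegative one,
  as polar coordinates require.\<close>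

lemma radial_g_nn_integral:
  assumes r: "r > 0"
  shows "Im (radial_g \<alpha> lam R r) = 0"
    and "ennreal (Re (radial_g \<alpha> lam R r)) = ennreal (r ^ (CARD('n) - 1)) * (\<integral>\<^sup>+u. ennreal (Re (F.inv_transform (r *\<^sub>R u))) \<partial>sphere_measure)"
proof -
  have i: "integrable sphere_measure (\<lambda>u. F.inv_transform (r *\<^sub>R u))"
    by (rule sph.integrable_const_bound[OF _ inv_transform_sphere_measurable, where B="1 / (2 * pi) ^ CARD('n) * integral\<^sup>L lborel (\<lambda>z. norm (charfun z))"]) (intro AE_I2 norm_inv_transform_le)
  have "F.inv_transform x = complex_of_real (Re (F.inv_transform x))" for x
    using F.inv_transform_real[of x] by (simp add: complex_eq_iff)
  then have "sphint (\<lambda>u. F.inv_transform (r *\<^sub>R u)) = sphint (\<lambda>u. complex_of_real (Re (F.inv_transform (r *\<^sub>R u))))"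
    by simp
  also have "\<dots> = complex_of_real (sphint (\<lambda>u. Re (F.inv_transform (r *\<^sub>R u))))" by (rule integral_complex_of_real)
  finally have g: "radial_g \<alpha> lam R r = complex_of_real (r ^ (CARD('n) - 1) * sphint (\<lambda>u. Re (F.inv_transform (r *\<^sub>R u))))"
    unfolding radial_g_eq[OF r] by simp
  then show "Im (radial_g \<alpha> lam R r) = 0" by (simp only: Im_complex_of_real)
  have "ennreal (Re (radial_g \<alpha> lam R r)) = ennreal (r ^ (CARD('n) - 1)) * ennreal (sphint (\<lambda>u. Re (F.inv_transform (r *\<^sub>R u))))"
    unfolding g Re_complex_of_real using r by (intro ennreal_mult integral_nonneg_AE) (simp_all add: F.inv_transform_nonneg)
  also have "ennreal (sphint (\<lambda>u. Re (F.inv_transform (r *\<^sub>R u)))) = (\<integral>\<^sup>+u. ennreal (Re (F.inv_transform (r *\<^sub>R u))) \<partial>sphere_measure)"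
    by (rule nn_integral_eq_integral[symmetric]) (simp_all add: F.inv_transform_nonneg integrable_Re[OF i])
  finally show "ennreal (Re (radial_g \<alpha> lam R r)) = ennreal (r ^ (CARD('n) - 1)) * (\<integral>\<^sup>+u. ennreal (Re (F.inv_transform (r *\<^sub>R u))) \<partial>sphere_measure)" .
qed

lemma distr_norm:
  "distr \<mu> lborel norm = density lborel (\<lambda>r. if r > 0 then ennreal (Re (radial_g \<alpha> lam R r)) else 0)"
proof -
  let ?g = "\<lambda>x. ennreal (Re (F.inv_transform x))"
  let ?p = "CARD('n) - 1"
  \<comment> \<open>\<rho> rewrites the radial series as a spherical integral, whose measurability
    in \<open>r\<close> comes from Tonelli's theorem.\<close>
  define \<rho> where "\<rho> r = ennreal (r ^ ?p) * indicator {0<..} r * (\<integral>\<^sup>+u. ?g (r *\<^sub>R u) \<partial>sphere_measure)" for r :: real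
  have eq: "(\<lambda>r. if r > 0 then ennreal (Re (radial_g \<alpha> lam R r)) else 0) = \<rho>"
    by (auto simp: \<rho>_def radial_g_nn_integral(2))
  have gm [measurable]: "?g \<in> borel_measurable borel"
    using F.inv_transform_measurable by measurable
  have inner: "(\<lambda>r. \<integral>\<^sup>+u. f (r *\<^sub>R u) \<partial>sphere_measure) \<in> borel_measurable borel" if "f \<in> borel_measurable borel" for f :: "real^'n \<Rightarrow> ennreal"
  proof -
    have "(\<lambda>(r, u). f (r *\<^sub>R u)) \<in> borel_measurable (borel \<Otimes>\<^sub>M sphere_measure)"
      using measurable_compose[OF polar_scaleR_measurable that] by (simp add: split_beta)
    then show ?thesis by (rule sph.borel_measurable_nn_integral)
  qed
  have \<rho>m: "\<rho> \<in> borel_measurable borel" unfolding \<rho>_def[abs_def] using inner[OF gm] by measurable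
  show ?thesis
    unfolding eq
  proof (rule measure_eqI)
    show "sets (distr \<mu> lborel norm) = sets (density lborel \<rho>)" by simp
    fix A assume "A \<in> sets (distr \<mu> lborel norm)"
    then have A [measurable]: "A \<in> sets borel" by simp
    have nA [measurable]: "norm -` A \<in> sets (borel :: (real^'n) measure)"
      by (rule measurable_sets_borel[OF borel_measurable_norm A])
    have nm: "norm \<in> measurable \<mu> lborel"
      unfolding measurable_cong_sets[OF mu(2) sets_lborel] by (rule borel_measurable_norm)
    have sp: "space \<mu> = UNIV" using sets_eq_imp_space_eq[OF mu(2)] by simp
    have fm: "(\<lambda>x. ?g x * indicator A (norm x)) \<in> borel_measurable borel" by measurable
    have "emeasure (distr \<mu> lborel norm) A = emeasure \<mu> (norm -` A)"
      using emeasure_distr[OF nm, of A] A by (simp add: sp)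
    also have "\<dots> = emeasure (density lborel ?g) (norm -` A)"
      using F.inversion by simp
    also have "\<dots> = (\<integral>\<^sup>+x. ?g x * indicator A (norm x) \<partial>lborel)"
      using gm nA by (subst emeasure_density) (auto intro!: nn_integral_cong split: split_indicator)
    also have "\<dots> = (\<integral>\<^sup>+r. \<integral>\<^sup>+u. ?g (r *\<^sub>R u) * indicator A (norm (r *\<^sub>R u)) \<partial>sphere_measure \<partial>radial_measure ?p)"
      by (rule nn_integral_polar[OF fm])
    also have "\<dots> = (\<integral>\<^sup>+r. (ennreal (r ^ ?p) * indicator {0<..} r) * (\<integral>\<^sup>+u. ?g (r *\<^sub>R u) * indicator A (norm (r *\<^sub>R u)) \<partial>sphere_measure) \<partial>lborel)"
      unfolding radial_measure_def using inner[OF fm] by (intro nn_integral_density) simp_all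
    also have "\<dots> = (\<integral>\<^sup>+r. \<rho> r * indicator A r \<partial>lborel)"
    proof (rule nn_integral_cong)
      fix r :: real
      show "(ennreal (r ^ ?p) * indicator {0<..} r) * (\<integral>\<^sup>+u. ?g (r *\<^sub>R u) * indicator A (norm (r *\<^sub>R u)) \<partial>sphere_measure) = \<rho> r * indicator A r"
      proof (cases "r > 0")
        case True
        have m: "(\<lambda>u. ?g (r *\<^sub>R u)) \<in> borel_measurable sphere_measure"
          by (rule borel_measurable_sphere_measure, rule measurable_compose[OF _ gm]) simp
        have "(\<integral>\<^sup>+u. ?g (r *\<^sub>R u) * indicator A (norm (r *\<^sub>R u)) \<partial>sphere_measure) = (\<integral>\<^sup>+u. ?g (r *\<^sub>R u) * indicator A r \<partial>sphere_measure)"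
          using True by (intro nn_integral_cong) simp
        also have "\<dots> = (\<integral>\<^sup>+u. ?g (r *\<^sub>R u) \<partial>sphere_measure) * indicator A r"
          by (rule nn_integral_multc[OF m])
        finally show ?thesis by (simp add: \<rho>_def mult.assoc)
      qed (simp add: \<rho>_def)
    qed
    also have "\<dots> = emeasure (density lborel \<rho>) A"
      using \<rho>m by (subst emeasure_density) simp_all
    finally show "emeasure (distr \<mu> lborel norm) A = emeasure (density lborel \<rho>) A" .
  qed
qed

lemma stable_law_inversion:
  "Im (stable_g \<alpha> lam R x) = 0" "\<mu> = density lborel (\<lambda>x. ennreal (Re (stable_g \<alpha> lam R x)))"
  unfolding stable_g_eq by (rule F.inv_transform_real) (rule F.inversion)

end

theorem theorem5p4:
  fixes \<mu> lam :: "(real^'n::finite) measure" and \<alpha> R :: real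
  assumes d2: "CARD('n) \<ge> 2"
    and alpha: "1 < \<alpha>" "\<alpha> < 2"
    and lam: "finite_measure lam" "sets lam = sets (restrict_space borel (sphere (0::real^'n) 1))"
             "emeasure lam (space lam) \<noteq> 0"
    and mu: "prob_space \<mu>" "sets \<mu> = sets borel"
    and charf: "\<forall>z. integral\<^sup>L \<mu> (\<lambda>x. cis (z \<bullet> x))
                   = exp (- complex_of_real (norm z powr \<alpha>) * stable_V \<alpha> lam (sgn z))"
    and nondeg: "nondegenerate \<mu>"
    and R: "R > rho0 \<alpha> lam"
  shows "(\<forall>x. Im (stable_g \<alpha> lam R x) = 0)
       \<and> \<mu> = density lborel (\<lambda>x. ennreal (Re (stable_g \<alpha> lam R x)))
       \<and> (\<forall>M>0. uniform_limit (cball 0 M)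
                 (\<lambda>N x. \<Sum>n<N. \<Sum>m\<le>n div 2. \<Sum>k. dens_term \<alpha> lam R x n m k)
                 (stable_g \<alpha> lam R) sequentially
              \<and> (\<forall>x\<in>cball 0 M. ((\<lambda>(n, m, k). norm (dens_term \<alpha> lam R x n m k))
                                  summable_on {(n, m, k). m \<le> n div 2})))
       \<and> (\<forall>r>0. Im (radial_g \<alpha> lam R r) = 0)
       \<and> distr \<mu> lborel norm
           = density lborel (\<lambda>r. if r > 0 then ennreal (Re (radial_g \<alpha> lam R r)) else 0)"
proof -
  interpret stable_law \<mu> lam \<alpha> R
    by (rule stable_law.intro) fact+
  show ?thesis
    using stable_law_inversion uniform_limit_dens abs_summable_dens radial_g_nn_integral(1) distr_norm by blast
qed



end
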